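(* Let $m\ge 2$ and $n\ge 1$ be integers, let $f_c(x)=x^m+c$, and let $p$ be a prime with $p\nmid nm(m-1)$. (1) If $n$ is prime, then $Y_1(n)$ has good reduction modulo $p$ if and only if $Y_0(n)$ has good reduction modulo $p$. (2) The curve $Y_1(n)$ is geometrically irreducible modulo $p$ if and only if $Y_0(n)$ is geometrically irreducible modulo $p$.
   Context: Let $f_c(x)=x^m+c$, and let $f_c^n$ be the $n$-th iterate in $x$. Put $\Psi_n(x,c)=f_c^n(x)-x$ and $\Phi_n(x,c)=\prod_{d\mid n}\Psi_d(x,c)^{\mu(n/d)}\in\mathbb{Z}[x,c]$ (the $n$-th dynatomic polynomial). $Y_1(n)$ is the closed subscheme of $\mathbb{A}^2_{\mathbb{Z}}$ defined by $\Phi_n(x,c)=0$; for a ring $R$, $Y_1(n)_R$ is its base change to $R$. The automorphism $\sigma:(x,c)\mapsto(f_c(x),c)$ generates an action of $\mathbb{Z}/n\mathbb{Z}$ on $Y_1(n)_R$, and $Y_0(n)_R:=Y_1(n)_R/\langle\sigma\rangle$. For $i\in\{0,1\}$, $Y_i(n)$ has good reduction modulo $p$ if $Y_i(n)_{\mathbb{F}_p}$ is smooth over $\mathbb{F}_p$, and it is geometrically irreducible modulo $p$ if $Y_i(n)_{\mathbb{F}_p}$ is geometrically irreducible. *)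

theory Defs
  imports
    "HOL-Algebra.Algebraic_Closure_Type"
    "HOL-Algebra.Ring_Divisibility"
    "HOL-Algebra.Generated_Rings"
    "HOL-Algebra.QuotRing"
    "HOL-Computational_Algebra.Polynomial_Factorial"
    "HOL-Computational_Algebra.Squarefree"
    "HOL-Library.Poly_Mapping"
    "HOL-Library.Extended_Nat"
    "Berlekamp_Zassenhaus.Finite_Field"
begin

section \<open>Spectra and local rings\<close>

text \<open>Affine schemes are represented by their coordinate rings, as records of HOL-Algebra.\<close>

definition spec :: "'a ring \<Rightarrow> 'a set set" where
  "spec A = {P. primeideal P A}"

definition zariski_closed :: "'a ring \<Rightarrow> 'a set set \<Rightarrow> bool" where
  "zariski_closed A Z \<longleftrightarrow> (\<exists>S \<subseteq> carrier A. Z = {P \<in> spec A. S \<subseteq> P})"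

definition irreducible_spec :: "'a ring \<Rightarrow> bool" where
  "irreducible_spec A \<longleftrightarrow>
     spec A \<noteq> {} \<and>
     (\<forall>Z1 Z2. zariski_closed A Z1 \<and> zariski_closed A Z2 \<and> spec A = Z1 \<union> Z2
        \<longrightarrow> Z1 = spec A \<or> Z2 = spec A)"

definition krull_dim :: "'a ring \<Rightarrow> enat" where
  "krull_dim A = Sup {enat d | d. \<exists>P :: nat \<Rightarrow> 'a set.
     (\<forall>i \<le> d. P i \<in> spec A) \<and> (\<forall>i < d. P i \<subset> P (Suc i))}"

definition regular_local_ring :: "'a ring \<Rightarrow> bool" where
  "regular_local_ring A \<longleftrightarrow>
     cring A \<and> noetherian_ring A \<and>
     (\<exists>M. {I. maximalideal I A} = {M} \<and>
       (\<exists>S \<subseteq> carrier A. finite S \<and> enat (card S) = krull_dim A \<and> M = Idl\<^bsub>A\<^esub> S))"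

text \<open>\<open>frac_class A P a s\<close> is the fraction \<open>a / s\<close> in the localization of \<open>A\<close> at the prime \<open>P\<close>,
  as an equivalence class of pairs.\<close>

definition frac_class :: "'a ring \<Rightarrow> 'a set \<Rightarrow> 'a \<Rightarrow> 'a \<Rightarrow> ('a \<times> 'a) set" where
  "frac_class A P a s =
     {(b, t). b \<in> carrier A \<and> t \<in> carrier A - P \<and>
        (\<exists>u \<in> carrier A - P. u \<otimes>\<^bsub>A\<^esub> (a \<otimes>\<^bsub>A\<^esub> t) = u \<otimes>\<^bsub>A\<^esub> (b \<otimes>\<^bsub>A\<^esub> s))}"

definition localization :: "'a ring \<Rightarrow> 'a set \<Rightarrow> ('a \<times> 'a) set ring" where
  "localization A P =
     \<lparr>carrier = {frac_class A P a s | a s. a \<in> carrier A \<and> s \<in> carrier A - P},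
      monoid.mult = (\<lambda>U V. \<Union>(a, s)\<in>U. \<Union>(b, t)\<in>V. frac_class A P (a \<otimes>\<^bsub>A\<^esub> b) (s \<otimes>\<^bsub>A\<^esub> t)),
      one = frac_class A P \<one>\<^bsub>A\<^esub> \<one>\<^bsub>A\<^esub>,
      ring.zero = frac_class A P \<zero>\<^bsub>A\<^esub> \<one>\<^bsub>A\<^esub>,
      add = (\<lambda>U V. \<Union>(a, s)\<in>U. \<Union>(b, t)\<in>V.
        frac_class A P (a \<otimes>\<^bsub>A\<^esub> t \<oplus>\<^bsub>A\<^esub> b \<otimes>\<^bsub>A\<^esub> s) (s \<otimes>\<^bsub>A\<^esub> t))\<rparr>"


section \<open>Algebras over a field\<close>

text \<open>A \<open>k\<close>-algebra is given by a ring \<open>A\<close> and its structure map \<open>\<alpha> :: 'k \<Rightarrow> 'a\<close>.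
  The tensor product of two \<open>k\<close>-algebras \<open>A\<close>, \<open>B\<close> is the monoid ring over the integers of the
  multiplicative monoid \<open>A \<times> B\<close>, modulo the relations making the generator \<open>(a, b)\<close>
  (representing \<open>a \<otimes> b\<close>) biadditive and \<open>k\<close>-balanced; these relations already span an ideal.\<close>

definition monoid_ring :: "('x, 'm) monoid_scheme \<Rightarrow> ('x \<Rightarrow>\<^sub>0 int) ring" where
  "monoid_ring M =
     \<lparr>carrier = {f. Poly_Mapping.keys f \<subseteq> carrier M},
      monoid.mult = (\<lambda>f g. frag_extend (\<lambda>u. frag_extend (\<lambda>v. frag_of (u \<otimes>\<^bsub>M\<^esub> v)) g) f),
      one = frag_of \<one>\<^bsub>M\<^esub>,
      ring.zero = 0,
      add = (+)\<rparr>"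

definition tensor_relations ::
    "'a ring \<Rightarrow> ('k \<Rightarrow> 'a) \<Rightarrow> 'b ring \<Rightarrow> ('k \<Rightarrow> 'b) \<Rightarrow> ('a \<times> 'b \<Rightarrow>\<^sub>0 int) set" where
  "tensor_relations A \<alpha> B \<beta> =
     {frag_of (a \<oplus>\<^bsub>A\<^esub> a', b) - frag_of (a, b) - frag_of (a', b) | a a' b.
        a \<in> carrier A \<and> a' \<in> carrier A \<and> b \<in> carrier B} \<union>
     {frag_of (a, b \<oplus>\<^bsub>B\<^esub> b') - frag_of (a, b) - frag_of (a, b') | a b b'.
        a \<in> carrier A \<and> b \<in> carrier B \<and> b' \<in> carrier B} \<union>
     {frag_of (\<alpha> r \<otimes>\<^bsub>A\<^esub> a, b) - frag_of (a, \<beta> r \<otimes>\<^bsub>B\<^esub> b) | r a b.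
        a \<in> carrier A \<and> b \<in> carrier B}"

definition tensor_product ::
    "'a ring \<Rightarrow> ('k \<Rightarrow> 'a) \<Rightarrow> 'b ring \<Rightarrow> ('k \<Rightarrow> 'b) \<Rightarrow> ('a \<times> 'b \<Rightarrow>\<^sub>0 int) set ring" where
  "tensor_product A \<alpha> B \<beta> =
     monoid_ring (A \<times>\<times> B) Quot Idl\<^bsub>monoid_ring (A \<times>\<times> B)\<^esub> (tensor_relations A \<alpha> B \<beta>)"

definition geometric_base_change ::
    "'a ring \<Rightarrow> ('k::field \<Rightarrow> 'a) \<Rightarrow> ('a \<times> 'k alg_closure \<Rightarrow>\<^sub>0 int) set ring" where
  "geometric_base_change A \<alpha> = tensor_product A \<alpha> ring_of_type_algebra to_ac"

definition finite_type :: "'a ring \<Rightarrow> ('k::field \<Rightarrow> 'a) \<Rightarrow> bool" where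
  "finite_type A \<alpha> \<longleftrightarrow>
     (\<exists>S. finite S \<and> S \<subseteq> carrier A \<and> generate_ring A (range \<alpha> \<union> S) = carrier A)"

text \<open>Smoothness over a field: of finite type, and regular after base change to an algebraic
  closure.\<close>

definition smooth_over_field :: "'a ring \<Rightarrow> ('k::field \<Rightarrow> 'a) \<Rightarrow> bool" where
  "smooth_over_field A \<alpha> \<longleftrightarrow>
     finite_type A \<alpha> \<and>
     (\<forall>P \<in> spec (geometric_base_change A \<alpha>).
        regular_local_ring (localization (geometric_base_change A \<alpha>) P))"

definition geometrically_irreducible :: "'a ring \<Rightarrow> ('k::field \<Rightarrow> 'a) \<Rightarrow> bool" where
  "geometrically_irreducible A \<alpha> \<longleftrightarrow> irreducible_spec (geometric_base_change A \<alpha>)"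


section \<open>Dynatomic curves\<close>

text \<open>Polynomials in \<open>x\<close> and \<open>c\<close> over \<open>R\<close> have type \<open>'r poly poly\<close>: the outer variable is \<open>x\<close>,
  the inner one is \<open>c\<close>.\<close>

definition var_x :: "'r::comm_ring_1 poly poly" where
  "var_x = [:0, 1:]"

definition var_c :: "'r::comm_ring_1 poly poly" where
  "var_c = [:[:0, 1:]:]"

definition unicritical :: "nat \<Rightarrow> 'r::comm_ring_1 poly poly" where
  "unicritical m = var_x ^ m + var_c"

definition period_poly :: "nat \<Rightarrow> nat \<Rightarrow> int poly poly" where
  "period_poly m n = ((\<lambda>q. pcompose (unicritical m) q) ^^ n) var_x - var_x"

definition moebius :: "nat \<Rightarrow> int" where
  "moebius n = (if squarefree n then (- 1) ^ card (prime_factors n) else 0)"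

text \<open>The product is formed in the fraction field of \<open>\<int>[x, c]\<close>.\<close>

definition dynatomic :: "nat \<Rightarrow> nat \<Rightarrow> int poly poly" where
  "dynatomic m n = (THE \<Phi>. to_fract \<Phi> =
     (\<Prod>d | d dvd n. to_fract (period_poly m d) powi moebius (n div d)))"

definition dynatomic_ideal :: "nat \<Rightarrow> nat \<Rightarrow> 'r::comm_ring_1 poly poly set" where
  "dynatomic_ideal m n =
     PIdl\<^bsub>ring_of_type_algebra\<^esub> (map_poly (map_poly of_int) (dynatomic m n))"

definition Y1_ring :: "nat \<Rightarrow> nat \<Rightarrow> 'r::comm_ring_1 poly poly set ring" where
  "Y1_ring m n = ring_of_type_algebra Quot dynatomic_ideal m n"

definition Y_structure_map :: "nat \<Rightarrow> nat \<Rightarrow> 'r::comm_ring_1 \<Rightarrow> 'r poly poly set" where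
  "Y_structure_map m n r = dynatomic_ideal m n +>\<^bsub>ring_of_type_algebra\<^esub> [:[:r:]:]"

text \<open>The comorphism of \<open>\<sigma>\<close>: \<open>g(x, c) \<mapsto> g(f\<^sub>c(x), c)\<close>, applied to a residue class through its
  representatives.\<close>

definition sigma_comorphism ::
    "nat \<Rightarrow> nat \<Rightarrow> 'r::comm_ring_1 poly poly set \<Rightarrow> 'r poly poly set" where
  "sigma_comorphism m n U =
     (\<Union>g\<in>U. dynatomic_ideal m n +>\<^bsub>ring_of_type_algebra\<^esub> pcompose g (unicritical m))"

text \<open>The quotient of an affine scheme by a finite group is the spectrum of the ring of invariants;
  being invariant under \<open>\<langle>\<sigma>\<rangle>\<close> means being fixed by the generator.\<close>

definition Y0_ring :: "nat \<Rightarrow> nat \<Rightarrow> 'r::comm_ring_1 poly poly set ring" where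
  "Y0_ring m n =
     (Y1_ring m n)\<lparr>carrier := {U \<in> carrier (Y1_ring m n). sigma_comorphism m n U = U}\<rparr>"

definition Y1_good_reduction :: "'p::prime_card itself \<Rightarrow> nat \<Rightarrow> nat \<Rightarrow> bool" where
  "Y1_good_reduction _ m n \<longleftrightarrow>
     smooth_over_field (Y1_ring m n) (Y_structure_map m n :: 'p mod_ring \<Rightarrow> _)"

definition Y0_good_reduction :: "'p::prime_card itself \<Rightarrow> nat \<Rightarrow> nat \<Rightarrow> bool" where
  "Y0_good_reduction _ m n \<longleftrightarrow>
     smooth_over_field (Y0_ring m n) (Y_structure_map m n :: 'p mod_ring \<Rightarrow> _)"

definition Y1_geom_irreducible_mod :: "'p::prime_card itself \<Rightarrow> nat \<Rightarrow> nat \<Rightarrow> bool" where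
  "Y1_geom_irreducible_mod _ m n \<longleftrightarrow>
     geometrically_irreducible (Y1_ring m n) (Y_structure_map m n :: 'p mod_ring \<Rightarrow> _)"

definition Y0_geom_irreducible_mod :: "'p::prime_card itself \<Rightarrow> nat \<Rightarrow> nat \<Rightarrow> bool" where
  "Y0_geom_irreducible_mod _ m n \<longleftrightarrow>
     geometrically_irreducible (Y0_ring m n) (Y_structure_map m n :: 'p mod_ring \<Rightarrow> _)"

end

theory Submission
  imports Defs "HOL-Number_Theory.Totient"
begin

text \<open>Over an algebraic closure \<open>K\<close> the coordinate ring of \<open>Y\<^sub>1(n)\<close> is \<open>K[x, c]/(F)\<close> with \<open>F\<close> monic in
  \<open>x\<close>.  Taking invariants commutes with the extension of the base field, so \<open>Y\<^sub>0(n)\<close> becomes \<open>D/(F)\<close>,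
  where \<open>D\<close> is the ring of polynomials invariant modulo \<open>F\<close>.  Its primes are minimal or come from
  points \<open>(x, c)\<close>, and regularity at a point means that one function generates the maximal ideal locally.
  Since \<open>p\<close> does not divide \<open>n\<close>, functions can be averaged over \<open>\<langle>\<sigma>\<rangle>\<close>.

  If the orbit of \<open>(x, c)\<close> has \<open>n\<close> elements, averaging products with a function that is nonzero at
  \<open>(x, c)\<close> but vanishes on the rest of the orbit transfers a uniformiser from one side to the other.
  For prime \<open>n\<close> the remaining points are fixed by \<open>\<sigma>\<close>, and those are always regular on \<open>Y\<^sub>1(n)\<close>: on the
  curve \<open>f\<^sub>c(x) = x\<close>, parametrised by \<open>x\<close>, the polynomial \<open>\<Phi>\<^sub>n\<close> restricts to the factor of
  \<open>\<lambda>\<^sup>n - 1\<close> belonging to the primitive \<open>n\<close>-th roots of unity, where \<open>\<lambda> = m x^(m-1)\<close> is the multiplier,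
  and \<open>p \<nmid> n m (m-1)\<close> makes its zeros simple, so \<open>\<Phi>\<^sub>n = 0\<close> meets that curve transversally.
  Regularity at a fixed point descends to the quotient.

  Irreducibility passes to a quotient.  Conversely, for \<open>n > 1\<close> there is a fixed point of \<open>\<sigma>\<close> on the curve; it is
  regular, hence lies on exactly one component of \<open>Y\<^sub>1(n)\<close>, which is therefore stable under \<open>\<sigma>\<close>; if the quotient
  is irreducible, the components are permuted transitively, so there is only one.\<close>

text \<open>One set of arguments covers both curves: a ring is presented as D/(F) with D a subring
  of K[x, c], and Y_1 is the case of the trivial group, where D contains all polynomials. Statements
  about spectra and local rings then become statements about divisibility by F. The delicate
  direction is the descent of regularity at a fixed point. The quotient map may ramify there, so a
  uniformiser upstairs need not come from an invariant. Invariants are measured by their order along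
  the uniformiser, and one of least order is chosen; it exists because the invariant c - c_0 has
  finite order at the point (x_0, c_0). Two definitions must be unlocked first. The dynatomic
  polynomial is a definite description in a fraction field; it is a polynomial because the period
  polynomials over the integers are squarefree, which makes the factors for different divisors
  coprime. The tensor product is given by generators and relations; a basis of K over the base field
  identifies the ideal of relations with the kernel of an evaluation.\<close>

section \<open>Ideals and Noetherian rings\<close>

interpretation self_module: Modules.module "(*) :: 'a::comm_ring_1 \<Rightarrow> 'a \<Rightarrow> 'a"
  by unfold_locales (auto simp: algebra_simps)

declare self_module.scale_scale [simp del] \<comment> \<open>loops with associativity\<close>

text \<open>Ideals are the submodules of the ring over itself, so generated ideals are spans and
  inherit the induction rules for spans.\<close>

abbreviation ideal_set :: "'a::comm_ring_1 set \<Rightarrow> bool" where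
  "ideal_set \<equiv> self_module.subspace"

abbreviation ideal_gen :: "'a::comm_ring_1 set \<Rightarrow> 'a set" where
  "ideal_gen \<equiv> self_module.span"

definition noetherian_type :: "'a::comm_ring_1 itself \<Rightarrow> bool" where
  "noetherian_type _ \<longleftrightarrow> (\<forall>I::'a set. ideal_set I \<longrightarrow> (\<exists>F. finite F \<and> F \<subseteq> I \<and> I \<subseteq> ideal_gen F))"

lemma noetherian_field: "noetherian_type TYPE('k::field)"
  unfolding noetherian_type_def
proof (intro allI impI)
  fix I :: "'k set" assume I: "ideal_set I"
  show "\<exists>F. finite F \<and> F \<subseteq> I \<and> I \<subseteq> ideal_gen F"
  proof (cases "\<exists>a\<in>I. a \<noteq> 0")
    case True
    then obtain a where a: "a \<in> I" "a \<noteq> 0" by blast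
    have "b \<in> ideal_gen {a}" for b
      using self_module.span_scale[OF self_module.span_base[of a "{a}"], of "b / a"] a by simp
    then show ?thesis using a by (intro exI[of _ "{a}"]) auto
  next
    case False
    then show ?thesis by (intro exI[of _ "{}"]) auto
  qed
qed

text \<open>Hilbert's basis theorem. The ideals of leading coefficients grow with the degree and
  stabilise at some \<open>N\<close>. Lifts of generators for the degrees up to \<open>N\<close>
  cancel the leading term of any element of \<open>J\<close>, and the degree drops.\<close>

lemma noetherian_poly:
  assumes noeth: "noetherian_type TYPE('a::comm_ring_1)"
  shows "noetherian_type TYPE('a poly)"
  unfolding noetherian_type_def
proof (intro allI impI)
  fix J :: "'a poly set" assume J: "ideal_set J"
  \<comment> \<open>Allowing degree below \<open>k\<close>, hence coefficient zero at
    \<open>k\<close>, makes \<open>L k\<close> an ideal.\<close>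
  define L where "L k = {a. \<exists>p\<in>J. degree p \<le> k \<and> coeff p k = a}" for k
  have L_mono1: "L k \<subseteq> L (Suc k)" for k
  proof
    fix a assume "a \<in> L k"
    then obtain p where p: "p \<in> J" "degree p \<le> k" "coeff p k = a" by (auto simp: L_def)
    have "[:0, 1:] * p \<in> J" by (rule self_module.subspace_scale[OF J p(1)])
    moreover have "coeff ([:0, 1:] * p) (Suc k) = a" using p by simp
    moreover have "degree ([:0, 1:] * p) \<le> Suc k" using p by simp
    ultimately show "a \<in> L (Suc k)" unfolding L_def by blast
  qed
  have L_mono: "j \<le> k \<Longrightarrow> L j \<subseteq> L k" for j k
    by (rule lift_Suc_mono_le[of L, OF L_mono1])
  have L_ideal: "ideal_set (L k)" for k
  proof (rule self_module.subspaceI)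
    show "0 \<in> L k" unfolding L_def using self_module.subspace_0[OF J] by force
    show "x + y \<in> L k" if xy: "x \<in> L k" "y \<in> L k" for x y
    proof -
      from xy obtain p q where "p \<in> J" "degree p \<le> k" "coeff p k = x"
        "q \<in> J" "degree q \<le> k" "coeff q k = y" by (auto simp: L_def)
      then have "p + q \<in> J \<and> degree (p + q) \<le> k \<and> coeff (p + q) k = x + y"
        using self_module.subspace_add[OF J] by (auto intro: degree_add_le)
      then show ?thesis unfolding L_def by blast
    qed
    show "c * x \<in> L k" if x: "x \<in> L k" for c x
    proof -
      from x obtain p where "p \<in> J" "degree p \<le> k" "coeff p k = x" by (auto simp: L_def)
      then have "[:c:] * p \<in> J \<and> degree ([:c:] * p) \<le> k \<and> coeff ([:c:] * p) k = c * x"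
        using self_module.subspace_scale[OF J, of p "[:c:]"] by (auto intro: order_trans[OF degree_smult_le])
      then show ?thesis unfolding L_def by blast
    qed
  qed
  have "ideal_set (\<Union>k. L k)"
  proof (rule self_module.subspaceI)
    show "0 \<in> (\<Union>k. L k)" using self_module.subspace_0[OF L_ideal] by blast
    show "x + y \<in> (\<Union>k. L k)" if xy: "x \<in> (\<Union>k. L k)" "y \<in> (\<Union>k. L k)" for x y
    proof -
      from xy obtain i j where "x \<in> L i" "y \<in> L j" by blast
      then have "x \<in> L (max i j)" "y \<in> L (max i j)"
        using L_mono[of i "max i j"] L_mono[of j "max i j"] by auto
      then show ?thesis using self_module.subspace_add[OF L_ideal] by blast
    qed
    show "c * x \<in> (\<Union>k. L k)" if "x \<in> (\<Union>k. L k)" for c x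
      using that self_module.subspace_scale[OF L_ideal] by blast
  qed
  then obtain G where G: "finite G" "G \<subseteq> (\<Union>k. L k)" "(\<Union>k. L k) \<subseteq> ideal_gen G"
    using noeth unfolding noetherian_type_def by blast
  have "\<exists>N. G \<subseteq> L N"
    using G(1,2)
  proof (induction G)
    case (insert g G)
    then obtain N k where "G \<subseteq> L N" "g \<in> L k" by auto
    then have "insert g G \<subseteq> L (max N k)"
      using L_mono[of N "max N k"] L_mono[of k "max N k"] by auto
    then show ?case by blast
  qed auto
  then obtain N where N: "G \<subseteq> L N" by blast
  have L_top: "L k \<subseteq> L N" for k
    using G(3) self_module.span_minimal[OF N L_ideal] by blast
  have "\<forall>k. \<exists>F. finite F \<and> F \<subseteq> L k \<and> L k \<subseteq> ideal_gen F"
    using noeth L_ideal unfolding noetherian_type_def by blast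
  then obtain B where B: "\<And>k. finite (B k)" "\<And>k. B k \<subseteq> L k" "\<And>k. L k \<subseteq> ideal_gen (B k)"
    by metis
  define lift where "lift k a = (SOME p. p \<in> J \<and> degree p \<le> k \<and> coeff p k = a)" for k a
  have lift: "lift k a \<in> J \<and> degree (lift k a) \<le> k \<and> coeff (lift k a) k = a" if "a \<in> L k" for k a
    unfolding lift_def by (rule someI_ex) (use that in \<open>auto simp: L_def\<close>)
  define F where "F = (\<Union>k\<le>N. lift k ` B k)"
  have finF: "finite F" and FJ: "F \<subseteq> J" using B(1) by (auto simp: F_def) (use B(2) lift in blast)
  have realise: "\<exists>r \<in> ideal_gen F. degree r \<le> k \<and> coeff r k = a" if "k \<le> N" "a \<in> L k" for k a
  proof -
    have "a \<in> ideal_gen (B k)" using B that by blast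
    then show ?thesis
    proof (induction rule: self_module.span_induct_alt)
      case base
      show ?case using self_module.span_zero[of F] by force
    next
      case (step c x y)
      then obtain r where r: "r \<in> ideal_gen F" "degree r \<le> k" "coeff r k = y" by blast
      have x: "lift k x \<in> ideal_gen F" "degree (lift k x) \<le> k" "coeff (lift k x) k = x"
        using step lift[of x k] B(2)[of k] that by (auto simp: F_def intro!: self_module.span_base)
      have "[:c:] * lift k x + r \<in> ideal_gen F"
        by (intro self_module.span_add self_module.span_scale x r)
      moreover have "degree ([:c:] * lift k x + r) \<le> k"
        using x r by (intro degree_add_le) (auto intro: order_trans[OF degree_smult_le])
      moreover have "coeff ([:c:] * lift k x + r) k = c * x + y" using x r by simp
      ultimately show ?case by blast
    qed
  qed
  have realise': "\<exists>r \<in> ideal_gen F. degree r \<le> k \<and> coeff r k = a" if a: "a \<in> L k" for k a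
  proof (cases "k \<le> N")
    case True
    then show ?thesis using realise a by blast
  next
    case False
    obtain r where r: "r \<in> ideal_gen F" "degree r \<le> N" "coeff r N = a"
      using realise[of N a] a L_top by blast
    \<comment> \<open>Above \<open>N\<close> no new leading coefficients appear, so a realisation in
      degree \<open>N\<close> is shifted up by a power of the variable.\<close>
    have "monom 1 (k - N) * r \<in> ideal_gen F" by (rule self_module.span_scale[OF r(1)])
    moreover have "degree (monom 1 (k - N) * r) \<le> k"
      using degree_mult_le[of "monom 1 (k - N)" r] degree_monom_le[of "1::'a" "k - N"] r False by linarith
    moreover have "coeff (monom 1 (k - N) * r) k = a"
      using r False by (simp add: coeff_monom_mult)
    ultimately show ?thesis by blast
  qed
  have "p \<in> ideal_gen F" if "p \<in> J" for p
    using that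
  proof (induction "degree p" arbitrary: p rule: less_induct)
    case less
    have "coeff p (degree p) \<in> L (degree p)" using less.prems by (auto simp: L_def)
    then obtain r where r: "r \<in> ideal_gen F" "degree r \<le> degree p" "coeff r (degree p) = coeff p (degree p)"
      using realise' by blast
    have rJ: "r \<in> J" using r(1) self_module.span_minimal[OF FJ J] by blast
    have pr: "p - r \<in> J" by (rule self_module.subspace_diff[OF J less.prems rJ])
    have "p - r \<in> ideal_gen F"
    proof (cases "degree p = 0")
      case True
      then have "p = r" using r by (metis degree_eq_zeroE coeff_pCons_0 le_zero_eq)
      then show ?thesis using self_module.span_zero[of F] by simp
    next
      case False
      have "degree (p - r) \<le> degree p" using r by (intro degree_diff_le) auto
      moreover have "coeff (p - r) (degree p) = 0" using r by simp
      ultimately have "degree (p - r) < degree p"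
        using False by (metis degree_0 le_neq_implies_less leading_coeff_0_iff not_gr_zero)
      then show ?thesis using less.hyps pr by blast
    qed
    then show ?case using self_module.span_add[OF _ r(1)] by fastforce
  qed
  then show "\<exists>F. finite F \<and> F \<subseteq> J \<and> J \<subseteq> ideal_gen F" using finF FJ by blast
qed

section \<open>Ideals and primes of a subring\<close>

text \<open>Ideals are relative to a subring \<open>D\<close> given as a set, so that all
  polynomials (\<open>D = UNIV\<close>) and the invariants fall under the same statements.\<close>

definition ideal_in :: "'r::comm_ring_1 set \<Rightarrow> 'r set \<Rightarrow> bool" where
  "ideal_in D J \<longleftrightarrow> J \<subseteq> D \<and> 0 \<in> J \<and> (\<forall>a\<in>J. \<forall>b\<in>J. a + b \<in> J) \<and> (\<forall>r\<in>D. \<forall>a\<in>J. r * a \<in> J)"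

definition prime_in :: "'r::comm_ring_1 set \<Rightarrow> 'r set \<Rightarrow> bool" where
  "prime_in D P \<longleftrightarrow> ideal_in D P \<and> 1 \<notin> P \<and> (\<forall>a\<in>D. \<forall>b\<in>D. a * b \<in> P \<longrightarrow> a \<in> P \<or> b \<in> P)"

text \<open>Finite generation modulo \<open>I\<close>: instead of naming the ideal generated by
  \<open>F\<close> and \<open>I\<close>, every ideal containing both is required to contain
  \<open>J\<close>.\<close>

definition noetherian_over :: "'r::comm_ring_1 set \<Rightarrow> 'r set \<Rightarrow> bool" where
  "noetherian_over D I \<longleftrightarrow> (\<forall>J. ideal_in D J \<and> I \<subseteq> J \<longrightarrow>
     (\<exists>F. finite F \<and> F \<subseteq> J \<and> (\<forall>J'. ideal_in D J' \<and> I \<subseteq> J' \<and> F \<subseteq> J' \<longrightarrow> J \<subseteq> J')))"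

lemma ideal_inD:
  assumes "ideal_in D J"
  shows "a \<in> J \<Longrightarrow> a \<in> D" "0 \<in> J" "a \<in> J \<Longrightarrow> b \<in> J \<Longrightarrow> a + b \<in> J"
    "r \<in> D \<Longrightarrow> a \<in> J \<Longrightarrow> r * a \<in> J" "r \<in> D \<Longrightarrow> a \<in> J \<Longrightarrow> a * r \<in> J"
  using assms by (auto simp: ideal_in_def mult.commute)

lemma ideal_in_lincomb:
  assumes "ideal_in D J" "r \<in> D" "s \<in> D" "x \<in> J" "y \<in> J"
  shows "r * x + s * y \<in> J"
  using assms by (simp add: ideal_inD)

lemma prime_inD:
  assumes "prime_in D P"
  shows "ideal_in D P" "1 \<notin> P" "a \<in> D \<Longrightarrow> b \<in> D \<Longrightarrow> a * b \<in> P \<Longrightarrow> a \<in> P \<or> b \<in> P"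
  using assms by (auto simp: prime_in_def)

locale subring_ideal =
  fixes D I :: "'r::comm_ring_1 set"
  assumes D_one [simp]: "1 \<in> D"
    and D_add [simp]: "a \<in> D \<Longrightarrow> b \<in> D \<Longrightarrow> a + b \<in> D"
    and D_mult [simp]: "a \<in> D \<Longrightarrow> b \<in> D \<Longrightarrow> a * b \<in> D"
    and D_uminus [simp]: "a \<in> D \<Longrightarrow> - a \<in> D"
    and I_ideal: "ideal_in D I"
begin

lemma D_zero [simp]: "0 \<in> D"
  using ideal_inD[OF I_ideal] by blast

lemma D_diff [simp]: "a \<in> D \<Longrightarrow> b \<in> D \<Longrightarrow> a - b \<in> D"
  using D_add[of a "- b"] by simp

lemma ideal_in_uminus: "ideal_in D J \<Longrightarrow> a \<in> J \<Longrightarrow> - a \<in> J"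
  using ideal_inD(4)[of D J "- 1" a] by simp

lemma ideal_in_diff: "ideal_in D J \<Longrightarrow> a \<in> J \<Longrightarrow> b \<in> J \<Longrightarrow> a - b \<in> J"
  using ideal_inD(3)[of D J a "- b"] ideal_in_uminus by simp

lemma I_D: "a \<in> I \<Longrightarrow> a \<in> D"
  using I_ideal by (rule ideal_inD)

end

lemma cringI_laws:
  fixes R :: "'a ring"
  assumes a_assoc: "\<And>x y z. x \<in> carrier R \<Longrightarrow> y \<in> carrier R \<Longrightarrow> z \<in> carrier R \<Longrightarrow> x \<oplus>\<^bsub>R\<^esub> y \<oplus>\<^bsub>R\<^esub> z = x \<oplus>\<^bsub>R\<^esub> (y \<oplus>\<^bsub>R\<^esub> z)"
    and m_assoc: "\<And>x y z. x \<in> carrier R \<Longrightarrow> y \<in> carrier R \<Longrightarrow> z \<in> carrier R \<Longrightarrow> x \<otimes>\<^bsub>R\<^esub> y \<otimes>\<^bsub>R\<^esub> z = x \<otimes>\<^bsub>R\<^esub> (y \<otimes>\<^bsub>R\<^esub> z)"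
    and distr: "\<And>x y z. x \<in> carrier R \<Longrightarrow> y \<in> carrier R \<Longrightarrow> z \<in> carrier R \<Longrightarrow> (x \<oplus>\<^bsub>R\<^esub> y) \<otimes>\<^bsub>R\<^esub> z = x \<otimes>\<^bsub>R\<^esub> z \<oplus>\<^bsub>R\<^esub> y \<otimes>\<^bsub>R\<^esub> z"
    and a_comm: "\<And>x y. x \<in> carrier R \<Longrightarrow> y \<in> carrier R \<Longrightarrow> x \<oplus>\<^bsub>R\<^esub> y = y \<oplus>\<^bsub>R\<^esub> x"
    and m_comm: "\<And>x y. x \<in> carrier R \<Longrightarrow> y \<in> carrier R \<Longrightarrow> x \<otimes>\<^bsub>R\<^esub> y = y \<otimes>\<^bsub>R\<^esub> x"
    and a_closed: "\<And>x y. x \<in> carrier R \<Longrightarrow> y \<in> carrier R \<Longrightarrow> x \<oplus>\<^bsub>R\<^esub> y \<in> carrier R"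
    and m_closed: "\<And>x y. x \<in> carrier R \<Longrightarrow> y \<in> carrier R \<Longrightarrow> x \<otimes>\<^bsub>R\<^esub> y \<in> carrier R"
    and l_zero: "\<And>x. x \<in> carrier R \<Longrightarrow> \<zero>\<^bsub>R\<^esub> \<oplus>\<^bsub>R\<^esub> x = x"
    and l_one: "\<And>x. x \<in> carrier R \<Longrightarrow> \<one>\<^bsub>R\<^esub> \<otimes>\<^bsub>R\<^esub> x = x"
    and l_neg: "\<And>x. x \<in> carrier R \<Longrightarrow> \<exists>y\<in>carrier R. y \<oplus>\<^bsub>R\<^esub> x = \<zero>\<^bsub>R\<^esub>"
    and zero_closed: "\<zero>\<^bsub>R\<^esub> \<in> carrier R"
    and one_closed: "\<one>\<^bsub>R\<^esub> \<in> carrier R"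
  shows "cring R"
proof (rule cringI)
  show "abelian_group R"
    by (rule abelian_groupI; (rule zero_closed | (rule a_closed a_assoc l_zero l_neg; assumption) | (rule a_comm; assumption)))
  show "comm_monoid R"
    by (rule comm_monoidI; (rule one_closed | (rule m_closed m_assoc l_one; assumption) | (rule m_comm; assumption)))
qed (rule distr)

section \<open>Rings presented as a quotient D/I\<close>

text \<open>\<open>h\<close> induces an isomorphism from D/I to \<open>A\<close>; its values outside
  \<open>D\<close> carry no meaning. Questions about the abstract record \<open>A\<close> become
  questions about elements of \<open>D\<close> modulo \<open>I\<close>.\<close>

locale presented_ring = subring_ideal D I
  for A :: "'a ring" and D I :: "'r::comm_ring_1 set" and h :: "'r \<Rightarrow> 'a" +
  assumes carrier_A: "carrier A = h ` D"
    and h_mult: "a \<in> D \<Longrightarrow> b \<in> D \<Longrightarrow> h a \<otimes>\<^bsub>A\<^esub> h b = h (a * b)"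
    and h_add: "a \<in> D \<Longrightarrow> b \<in> D \<Longrightarrow> h a \<oplus>\<^bsub>A\<^esub> h b = h (a + b)"
    and h_one: "\<one>\<^bsub>A\<^esub> = h 1"
    and h_zero: "\<zero>\<^bsub>A\<^esub> = h 0"
    and h_eq_iff: "a \<in> D \<Longrightarrow> b \<in> D \<Longrightarrow> h a = h b \<longleftrightarrow> a - b \<in> I"
begin

lemma A_laws:
  assumes "x \<in> carrier A" "y \<in> carrier A" "z \<in> carrier A"
  shows "x \<oplus>\<^bsub>A\<^esub> y \<oplus>\<^bsub>A\<^esub> z = x \<oplus>\<^bsub>A\<^esub> (y \<oplus>\<^bsub>A\<^esub> z)" "x \<otimes>\<^bsub>A\<^esub> y \<otimes>\<^bsub>A\<^esub> z = x \<otimes>\<^bsub>A\<^esub> (y \<otimes>\<^bsub>A\<^esub> z)"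
    "(x \<oplus>\<^bsub>A\<^esub> y) \<otimes>\<^bsub>A\<^esub> z = x \<otimes>\<^bsub>A\<^esub> z \<oplus>\<^bsub>A\<^esub> y \<otimes>\<^bsub>A\<^esub> z" "x \<oplus>\<^bsub>A\<^esub> y = y \<oplus>\<^bsub>A\<^esub> x" "x \<otimes>\<^bsub>A\<^esub> y = y \<otimes>\<^bsub>A\<^esub> x"
    "x \<oplus>\<^bsub>A\<^esub> y \<in> carrier A" "x \<otimes>\<^bsub>A\<^esub> y \<in> carrier A" "\<zero>\<^bsub>A\<^esub> \<oplus>\<^bsub>A\<^esub> x = x" "\<one>\<^bsub>A\<^esub> \<otimes>\<^bsub>A\<^esub> x = x" "\<exists>y\<in>carrier A. y \<oplus>\<^bsub>A\<^esub> x = \<zero>\<^bsub>A\<^esub>"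
proof -
  obtain a b c where *: "a \<in> D" "b \<in> D" "c \<in> D" "x = h a" "y = h b" "z = h c"
    using assms unfolding carrier_A by blast
  show "x \<oplus>\<^bsub>A\<^esub> y \<oplus>\<^bsub>A\<^esub> z = x \<oplus>\<^bsub>A\<^esub> (y \<oplus>\<^bsub>A\<^esub> z)" "x \<otimes>\<^bsub>A\<^esub> y \<otimes>\<^bsub>A\<^esub> z = x \<otimes>\<^bsub>A\<^esub> (y \<otimes>\<^bsub>A\<^esub> z)"
    "(x \<oplus>\<^bsub>A\<^esub> y) \<otimes>\<^bsub>A\<^esub> z = x \<otimes>\<^bsub>A\<^esub> z \<oplus>\<^bsub>A\<^esub> y \<otimes>\<^bsub>A\<^esub> z"
    by (simp_all only: * h_add h_mult D_add D_mult add.assoc mult.assoc distrib_right)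
  show "x \<oplus>\<^bsub>A\<^esub> y = y \<oplus>\<^bsub>A\<^esub> x" using * h_add add.commute by metis
  show "x \<otimes>\<^bsub>A\<^esub> y = y \<otimes>\<^bsub>A\<^esub> x" using * h_mult mult.commute by metis
  show "x \<oplus>\<^bsub>A\<^esub> y \<in> carrier A" "x \<otimes>\<^bsub>A\<^esub> y \<in> carrier A" "\<zero>\<^bsub>A\<^esub> \<oplus>\<^bsub>A\<^esub> x = x" "\<one>\<^bsub>A\<^esub> \<otimes>\<^bsub>A\<^esub> x = x"
    using * by (simp_all add: h_add h_mult h_zero h_one carrier_A)
  have "h (- a) \<in> carrier A" "h (- a) \<oplus>\<^bsub>A\<^esub> x = \<zero>\<^bsub>A\<^esub>"
    using * by (simp_all add: carrier_A h_add h_zero)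
  then show "\<exists>y\<in>carrier A. y \<oplus>\<^bsub>A\<^esub> x = \<zero>\<^bsub>A\<^esub>" by blast
qed

lemma cring_A: "cring A"
proof (rule cringI_laws)
  show "\<zero>\<^bsub>A\<^esub> \<in> carrier A" "\<one>\<^bsub>A\<^esub> \<in> carrier A" by (simp_all add: carrier_A h_zero h_one)
qed (rule A_laws; assumption)+

lemma h_image_iff:
  assumes "ideal_in D J" "I \<subseteq> J" "a \<in> D"
  shows "h a \<in> h ` J \<longleftrightarrow> a \<in> J"
proof
  assume "h a \<in> h ` J"
  then obtain b where b: "b \<in> J" "h a = h b" by blast
  then have "a - b \<in> J" using h_eq_iff[of a b] assms ideal_inD(1)[OF assms(1)] by blast
  then have "a - b + b \<in> J" using b ideal_inD(3)[OF assms(1)] by blast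
  then show "a \<in> J" by simp
qed auto

lemma ideal_image:
  assumes J: "ideal_in D J"
  shows "ideal (h ` J) A"
proof -
  interpret A: cring A by (rule cring_A)
  have *: "h a \<ominus>\<^bsub>A\<^esub> h b = h (a - b)" if "a \<in> D" "b \<in> D" for a b
  proof -
    have "\<ominus>\<^bsub>A\<^esub> h b = h (- b)"
      by (rule A.minus_equality) (use that in \<open>auto simp: h_add h_zero carrier_A\<close>)
    then show ?thesis using that by (simp add: a_minus_def h_add)
  qed
  have JD: "a \<in> J \<Longrightarrow> a \<in> D" for a by (rule ideal_inD(1)[OF J])
  show ?thesis
  proof (rule idealI[OF A.ring_axioms])
    show "subgroup (h ` J) (add_monoid A)"
    proof (rule A.add.subgroupI)
      show "h ` J \<subseteq> carrier A" using JD by (auto simp: carrier_A)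
      show "h ` J \<noteq> {}" using ideal_inD(2)[OF J] by blast
      show "\<ominus>\<^bsub>A\<^esub> x \<in> h ` J" if "x \<in> h ` J" for x
      proof -
        from that obtain a where a: "a \<in> J" "x = h a" by blast
        have "\<ominus>\<^bsub>A\<^esub> h a = h (- a)"
          by (rule A.minus_equality) (use a JD in \<open>auto simp: h_add h_zero carrier_A\<close>)
        then show ?thesis using a ideal_in_uminus[OF J] by auto
      qed
      show "x \<oplus>\<^bsub>A\<^esub> y \<in> h ` J" if "x \<in> h ` J" "y \<in> h ` J" for x y
        using that JD ideal_inD(3)[OF J] by (auto simp: h_add)
    qed
    show "x \<otimes>\<^bsub>A\<^esub> a \<in> h ` J" "a \<otimes>\<^bsub>A\<^esub> x \<in> h ` J" if "a \<in> h ` J" "x \<in> carrier A" for a x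
      using that JD ideal_inD(4,5)[OF J] by (auto simp: h_mult carrier_A)
  qed
qed

lemma ideal_preimage:
  assumes "ideal K A"
  shows "ideal_in D {a \<in> D. h a \<in> K}" "I \<subseteq> {a \<in> D. h a \<in> K}" "K = h ` {a \<in> D. h a \<in> K}"
proof -
  interpret K: ideal K A by fact
  have 0: "h 0 \<in> K"
    using additive_subgroup.zero_closed[OF K.is_additive_subgroup] by (simp only: h_zero)
  have add: "h (a + b) \<in> K" if "a \<in> D" "b \<in> D" "h a \<in> K" "h b \<in> K" for a b
    using additive_subgroup.a_closed[OF K.is_additive_subgroup that(3,4)] that by (simp add: h_add)
  have mul: "h (r * a) \<in> K" if "r \<in> D" "a \<in> D" "h a \<in> K" for r a
    using K.I_l_closed[OF that(3), of "h r"] that by (simp add: h_mult carrier_A)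
  show "ideal_in D {a \<in> D. h a \<in> K}"
    using 0 add mul by (auto simp: ideal_in_def)
  show "I \<subseteq> {a \<in> D. h a \<in> K}"
  proof
    fix a assume a: "a \<in> I"
    then have "h a = h 0" using h_eq_iff[of a 0] I_D by simp
    then show "a \<in> {a \<in> D. h a \<in> K}" using 0 a I_D by simp
  qed
  show "K = h ` {a \<in> D. h a \<in> K}"
    using K.a_subset by (auto simp: carrier_A)
qed

lemma spec_eq: "spec A = (\<lambda>P. h ` P) ` {P. prime_in D P \<and> I \<subseteq> P}"
proof (intro equalityI subsetI)
  fix K assume "K \<in> spec A"
  then have "primeideal K A" by (simp add: spec_def)
  then interpret K: primeideal K A .
  have pre: "ideal_in D {a \<in> D. h a \<in> K}" "I \<subseteq> {a \<in> D. h a \<in> K}" "K = h ` {a \<in> D. h a \<in> K}"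
    using ideal_preimage K.ideal_axioms by blast+
  have "h 1 \<notin> K" using K.I_notcarr K.one_imp_carrier by (auto simp: h_one)
  moreover have "h a \<in> K \<or> h b \<in> K" if "a \<in> D" "b \<in> D" "h (a * b) \<in> K" for a b
    using K.I_prime[of "h a" "h b"] that by (auto simp: h_mult carrier_A)
  ultimately have "prime_in D {a \<in> D. h a \<in> K}"
    using pre by (auto simp: prime_in_def)
  then show "K \<in> (\<lambda>P. h ` P) ` {P. prime_in D P \<and> I \<subseteq> P}" using pre by blast
next
  fix K assume "K \<in> (\<lambda>P. h ` P) ` {P. prime_in D P \<and> I \<subseteq> P}"
  then obtain P where P: "prime_in D P" "I \<subseteq> P" "K = h ` P" by blast
  note Pi = prime_inD(1)[OF P(1)]
  have "primeideal (h ` P) A"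
  proof (rule primeidealI[OF ideal_image[OF Pi] cring_A])
    show "carrier A \<noteq> h ` P"
      using h_image_iff[OF Pi P(2), of 1] prime_inD(2)[OF P(1)] by (auto simp: carrier_A)
    show "a \<in> h ` P \<or> b \<in> h ` P" if ab: "a \<in> carrier A" "b \<in> carrier A" "a \<otimes>\<^bsub>A\<^esub> b \<in> h ` P" for a b
    proof -
      from ab obtain x y where xy: "x \<in> D" "y \<in> D" "a = h x" "b = h y" by (auto simp: carrier_A)
      then have "x * y \<in> P" using ab(3) h_image_iff[OF Pi P(2), of "x * y"] by (simp add: h_mult)
      then show ?thesis using prime_inD(3)[OF P(1)] xy by blast
    qed
  qed
  then show "K \<in> spec A" using P by (simp add: spec_def)
qed

text \<open>Two elements can replace two closed sets: from each proper closed set pick a defining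
  element that is missed by some prime. The zero sets of these elements contain the closed sets, so
  they still cover, and they are still proper.\<close>

lemma irreducible_spec_iff:
  "irreducible_spec A \<longleftrightarrow> (\<exists>P. prime_in D P \<and> I \<subseteq> P) \<and>
     (\<forall>a\<in>D. \<forall>b\<in>D. (\<forall>P. prime_in D P \<and> I \<subseteq> P \<longrightarrow> a \<in> P \<or> b \<in> P) \<longrightarrow>
        (\<forall>P. prime_in D P \<and> I \<subseteq> P \<longrightarrow> a \<in> P) \<or> (\<forall>P. prime_in D P \<and> I \<subseteq> P \<longrightarrow> b \<in> P))"
  (is "_ \<longleftrightarrow> ?ne \<and> ?irr")
proof -
  let ?pr = "\<lambda>P. prime_in D P \<and> I \<subseteq> P"
  have mem: "h a \<in> h ` P \<longleftrightarrow> a \<in> P" if "?pr P" "a \<in> D" for a P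
    using h_image_iff prime_inD(1) that by blast
  have ne: "spec A \<noteq> {} \<longleftrightarrow> ?ne" by (auto simp: spec_eq)
  have 1: "irreducible_spec A" if "?ne" "?irr"
    unfolding irreducible_spec_def
  proof (intro conjI allI impI)
    show "spec A \<noteq> {}" using ne that by blast
    fix Z1 Z2 assume "zariski_closed A Z1 \<and> zariski_closed A Z2 \<and> spec A = Z1 \<union> Z2"
    then obtain S1 S2 where S: "S1 \<subseteq> carrier A" "Z1 = {P \<in> spec A. S1 \<subseteq> P}"
      "S2 \<subseteq> carrier A" "Z2 = {P \<in> spec A. S2 \<subseteq> P}" and un: "spec A = Z1 \<union> Z2"
      unfolding zariski_closed_def by blast
    show "Z1 = spec A \<or> Z2 = spec A"
    proof (rule ccontr)
      assume "\<not> (Z1 = spec A \<or> Z2 = spec A)"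
      then obtain K1 K2 x y where K: "K1 \<in> spec A" "K2 \<in> spec A" "x \<in> S1" "x \<notin> K1" "y \<in> S2" "y \<notin> K2"
        using S by blast
      obtain P1 where P1: "?pr P1" "K1 = h ` P1" using K(1) by (auto simp only: spec_eq)
      obtain P2 where P2: "?pr P2" "K2 = h ` P2" using K(2) by (auto simp only: spec_eq)
      obtain a where a: "a \<in> D" "x = h a" using K(3) S(1) carrier_A by blast
      obtain b where b: "b \<in> D" "y = h b" using K(5) S(3) carrier_A by blast
      note ab = P1(1) P2(1) a(1) b(1) a(2) b(2) P1(2) P2(2)
      have "a \<in> P \<or> b \<in> P" if P: "?pr P" for P
      proof -
        have "h ` P \<in> Z1 \<union> Z2" using P un by (auto simp: spec_eq)
        then have "x \<in> h ` P \<or> y \<in> h ` P" using S K by blast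
        then show ?thesis using mem[OF P ab(3)] mem[OF P ab(4)] ab(5,6) by simp
      qed
      then have "(\<forall>P. ?pr P \<longrightarrow> a \<in> P) \<or> (\<forall>P. ?pr P \<longrightarrow> b \<in> P)"
        using \<open>?irr\<close> ab(3,4) by blast
      then show False using K ab by blast
    qed
  qed
  have 2: "?irr" if irr: "irreducible_spec A"
  proof (intro ballI impI)
    fix a b assume ab: "a \<in> D" "b \<in> D" and or: "\<forall>P. ?pr P \<longrightarrow> a \<in> P \<or> b \<in> P"
    let ?Z1 = "{P \<in> spec A. {h a} \<subseteq> P}" and ?Z2 = "{P \<in> spec A. {h b} \<subseteq> P}"
    have "zariski_closed A ?Z1" "zariski_closed A ?Z2"
      unfolding zariski_closed_def using ab carrier_A by blast+
    moreover have "spec A = ?Z1 \<union> ?Z2" using or by (auto simp: spec_eq)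
    ultimately have "?Z1 = spec A \<or> ?Z2 = spec A" using irr unfolding irreducible_spec_def by blast
    then show "(\<forall>P. ?pr P \<longrightarrow> a \<in> P) \<or> (\<forall>P. ?pr P \<longrightarrow> b \<in> P)"
    proof
      assume "?Z1 = spec A"
      then have "h a \<in> h ` P" if "?pr P" for P using that spec_eq by blast
      then show ?thesis using mem ab by blast
    next
      assume "?Z2 = spec A"
      then have "h b \<in> h ` P" if "?pr P" for P using that spec_eq by blast
      then show ?thesis using mem ab by blast
    qed
  qed
  have 3: "?ne" if "irreducible_spec A" using ne that by (simp add: irreducible_spec_def)
  show ?thesis using 1 2 3 by blast
qed

end

section \<open>The localisation at a prime\<close>

locale presented_prime = presented_ring A D I h
  for A :: "'a ring" and D I :: "'r::comm_ring_1 set" and h :: "'r \<Rightarrow> 'a" +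
  fixes q :: "'r set"
  assumes q_prime: "prime_in D q" and I_q: "I \<subseteq> q"
begin

abbreviation "S \<equiv> D - q"

definition fraction :: "'r \<Rightarrow> 'r \<Rightarrow> ('a \<times> 'a) set" where
  "fraction a s = frac_class A (h ` q) (h a) (h s)"

abbreviation "L \<equiv> localization A (h ` q)"

lemmas q_ideal = prime_inD(1)[OF q_prime]
lemmas q_D = ideal_inD(1)[OF q_ideal]

lemma one_S [simp]: "1 \<in> S"
  using prime_inD(2)[OF q_prime] by simp

lemma S_mult [simp]: "s \<in> S \<Longrightarrow> t \<in> S \<Longrightarrow> s * t \<in> S"
  using prime_inD(3)[OF q_prime] by auto

lemma S_D: "s \<in> S \<Longrightarrow> s \<in> D" by simp

lemma complement: "carrier A - h ` q = h ` S"
  using h_image_iff[OF q_ideal I_q] by (auto simp: carrier_A)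

lemma frac_rep: "fraction a s = {(h b, h t) | b t. b \<in> D \<and> t \<in> S \<and> (\<exists>u\<in>S. u * (a * t - b * s) \<in> I)}"
  if "a \<in> D" "s \<in> S"
proof -
  have *: "(\<exists>u\<in>h ` S. u \<otimes>\<^bsub>A\<^esub> (h a \<otimes>\<^bsub>A\<^esub> h t) = u \<otimes>\<^bsub>A\<^esub> (h b \<otimes>\<^bsub>A\<^esub> h s)) \<longleftrightarrow>
     (\<exists>u\<in>S. u * (a * t - b * s) \<in> I)" if "b \<in> D" "t \<in> S" for b t
    using that \<open>a \<in> D\<close> \<open>s \<in> S\<close> by (simp add: h_mult h_eq_iff right_diff_distrib)
  show ?thesis
    unfolding fraction_def frac_class_def complement unfolding carrier_A
  proof (intro equalityI subsetI)
    fix x assume "x \<in> {(b, t). b \<in> h ` D \<and> t \<in> h ` S \<and>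
      (\<exists>u\<in>h ` S. u \<otimes>\<^bsub>A\<^esub> (h a \<otimes>\<^bsub>A\<^esub> t) = u \<otimes>\<^bsub>A\<^esub> (b \<otimes>\<^bsub>A\<^esub> h s))}"
    then obtain b t where "b \<in> D" "t \<in> S" "x = (h b, h t)"
      "\<exists>u\<in>h ` S. u \<otimes>\<^bsub>A\<^esub> (h a \<otimes>\<^bsub>A\<^esub> h t) = u \<otimes>\<^bsub>A\<^esub> (h b \<otimes>\<^bsub>A\<^esub> h s)" by blast
    then show "x \<in> {(h b, h t) | b t. b \<in> D \<and> t \<in> S \<and> (\<exists>u\<in>S. u * (a * t - b * s) \<in> I)}"
      using * by blast
  next
    fix x assume "x \<in> {(h b, h t) | b t. b \<in> D \<and> t \<in> S \<and> (\<exists>u\<in>S. u * (a * t - b * s) \<in> I)}"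
    then obtain b t where "b \<in> D" "t \<in> S" "x = (h b, h t)" "\<exists>u\<in>S. u * (a * t - b * s) \<in> I" by blast
    then show "x \<in> {(b, t). b \<in> h ` D \<and> t \<in> h ` S \<and>
      (\<exists>u\<in>h ` S. u \<otimes>\<^bsub>A\<^esub> (h a \<otimes>\<^bsub>A\<^esub> t) = u \<otimes>\<^bsub>A\<^esub> (b \<otimes>\<^bsub>A\<^esub> h s))}"
      using *[of b t] by auto
  qed
qed

text \<open>Multiples of the two relations are added so that the terms with \<open>b\<close> cancel;
  the denominator \<open>t\<close> then joins the witness from \<open>S\<close>.\<close>

lemma rel_trans:
  assumes "u \<in> S" "v \<in> S" "u * (a * t - b * s) \<in> I" "v * (b * w - c * t) \<in> I"
    "t \<in> S" "w \<in> S" "s \<in> S"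
  shows "\<exists>u\<in>S. u * (a * w - c * s) \<in> I"
proof
  have "v * w * (u * (a * t - b * s)) + u * s * (v * (b * w - c * t)) \<in> I"
    by (rule ideal_in_lincomb[OF I_ideal]) (use assms in auto)
  moreover have "v * w * (u * (a * t - b * s)) + u * s * (v * (b * w - c * t)) = u * v * t * (a * w - c * s)"
    by (simp add: algebra_simps)
  ultimately show "u * v * t * (a * w - c * s) \<in> I" by (simp only:)
  show "u * v * t \<in> S" using assms by (intro S_mult)
qed

lemma rel_sym:
  assumes "u * (a * t - b * s) \<in> I" shows "u * (b * s - a * t) \<in> I"
proof -
  have "- (u * (a * t - b * s)) = u * (b * s - a * t)"
    by (simp only: mult_minus_right[symmetric] minus_diff_eq)
  then show ?thesis using ideal_in_uminus[OF I_ideal assms] by simp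
qed

lemma frac_self: "a \<in> D \<Longrightarrow> s \<in> S \<Longrightarrow> (h a, h s) \<in> fraction a s"
  using frac_rep[of a s] one_S ideal_inD(2)[OF I_ideal] by force

lemma frac_subset:
  assumes "a \<in> D" "b \<in> D" "s \<in> S" "t \<in> S" "u \<in> S" "u * (a * t - b * s) \<in> I"
  shows "fraction a s \<subseteq> fraction b t"
proof
  fix x assume "x \<in> fraction a s"
  then obtain c w v where "c \<in> D" "w \<in> S" "x = (h c, h w)" "v \<in> S" "v * (a * w - c * s) \<in> I"
    using frac_rep assms by auto
  moreover have "\<exists>u\<in>S. u * (b * w - c * t) \<in> I"
    by (rule rel_trans[of u v b s a t]) (use assms calculation in \<open>auto intro: rel_sym\<close>)
  ultimately show "x \<in> fraction b t" using frac_rep[of b t] assms by blast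
qed

lemma frac_eqI:
  assumes "a \<in> D" "b \<in> D" "s \<in> S" "t \<in> S" "u \<in> S" "u * (a * t - b * s) \<in> I"
  shows "fraction a s = fraction b t"
  using frac_subset[OF assms] frac_subset[OF assms(2,1,4,3,5) rel_sym[OF assms(6)]] by blast

lemma frac_mem_iff:
  assumes "a \<in> D" "b \<in> D" "s \<in> S" "t \<in> S"
  shows "(h b, h t) \<in> fraction a s \<longleftrightarrow> (\<exists>u\<in>S. u * (a * t - b * s) \<in> I)"
proof
  assume "(h b, h t) \<in> fraction a s"
  then obtain c w u where *: "c \<in> D" "w \<in> S" "h b = h c" "h t = h w" "u \<in> S" "u * (a * w - c * s) \<in> I"
    using frac_rep[of a s] assms by auto
  then have 1: "b - c \<in> I" "t - w \<in> I" using h_eq_iff assms by auto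
  \<comment> \<open>\<open>c\<close> and \<open>w\<close> represent the same classes as
    \<open>b\<close> and \<open>t\<close>, so exchanging them changes the relation by this element
    of \<open>I\<close>.\<close>
  have "(u * a) * (t - w) + (- (u * s)) * (b - c) \<in> I"
    by (rule ideal_in_lincomb[OF I_ideal]) (use 1 * assms in auto)
  then have "u * (a * w - c * s) + ((u * a) * (t - w) + (- (u * s)) * (b - c)) \<in> I"
    using *(6) ideal_inD(3)[OF I_ideal] by blast
  moreover have "u * (a * w - c * s) + ((u * a) * (t - w) + (- (u * s)) * (b - c)) = u * (a * t - b * s)"
    by (simp add: algebra_simps)
  ultimately have "u * (a * t - b * s) \<in> I" by (simp only:)
  then show "\<exists>u\<in>S. u * (a * t - b * s) \<in> I" using * by blast
qed (use frac_rep[of a s] assms in blast)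

lemma frac_eq_iff:
  assumes "a \<in> D" "b \<in> D" "s \<in> S" "t \<in> S"
  shows "fraction a s = fraction b t \<longleftrightarrow> (\<exists>u\<in>S. u * (a * t - b * s) \<in> I)"
  using frac_mem_iff[OF assms] frac_self[of b t] frac_eqI[OF assms] assms by blast

lemma frac_eqI':
  assumes "a * t = b * s" "a \<in> D" "b \<in> D" "s \<in> S" "t \<in> S"
  shows "fraction a s = fraction b t"
  using frac_eqI[of a b s t 1] assms ideal_inD(2)[OF I_ideal] one_S by simp

lemma carrier_L: "carrier L = {fraction a s | a s. a \<in> D \<and> s \<in> S}"
proof -
  have "carrier L = {frac_class A (h ` q) a s | a s. a \<in> h ` D \<and> s \<in> h ` S}"
    unfolding localization_def carrier_A[symmetric] complement[symmetric] by simp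
  then show ?thesis by (auto simp: fraction_def)
qed

lemma frac_carrier [simp]: "a \<in> D \<Longrightarrow> s \<in> S \<Longrightarrow> fraction a s \<in> carrier L"
  by (auto simp: carrier_L)

text \<open>The operations of \<open>localization\<close> are unions over all pairs of
  representatives. If every pair contributes the same set \<open>V\<close>, the union is
  \<open>V\<close>, because both classes are nonempty.\<close>

lemma frac_binop:
  assumes ab: "a \<in> D" "b \<in> D" "s \<in> S" "t \<in> S"
    and f: "\<And>a' s' b' t'. a' \<in> D \<Longrightarrow> s' \<in> S \<Longrightarrow> b' \<in> D \<Longrightarrow> t' \<in> S \<Longrightarrow>
      fraction a' s' = fraction a s \<Longrightarrow> fraction b' t' = fraction b t \<Longrightarrow> f (h a') (h s') (h b') (h t') = V"
  shows "\<Union> ((\<lambda>(x, y). \<Union> ((\<lambda>(z, w). f x y z w) ` fraction b t)) ` fraction a s) = V"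
proof -
  have *: "f x y z w = V" if x: "(x, y) \<in> fraction a s" and z: "(z, w) \<in> fraction b t" for x y z w
  proof -
    from x obtain a' s' where a': "a' \<in> D" "s' \<in> S" "x = h a'" "y = h s'"
      using frac_rep[of a s] ab by auto
    from z obtain b' t' where b': "b' \<in> D" "t' \<in> S" "z = h b'" "w = h t'"
      using frac_rep[of b t] ab by auto
    have "fraction a' s' = fraction a s" using x a' ab frac_mem_iff frac_eq_iff by metis
    moreover have "fraction b' t' = fraction b t" using z b' ab frac_mem_iff frac_eq_iff by metis
    ultimately show ?thesis using f a' b' by blast
  qed
  have "(h a, h s) \<in> fraction a s" "(h b, h t) \<in> fraction b t" using ab frac_self by auto
  then show ?thesis using * by fastforce
qed

lemma frac_mult:
  assumes ab: "a \<in> D" "b \<in> D" "s \<in> S" "t \<in> S"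
  shows "fraction a s \<otimes>\<^bsub>L\<^esub> fraction b t = fraction (a * b) (s * t)"
proof -
  have "fraction a s \<otimes>\<^bsub>L\<^esub> fraction b t =
    \<Union> ((\<lambda>(x, y). \<Union> ((\<lambda>(z, w). frac_class A (h ` q) (x \<otimes>\<^bsub>A\<^esub> z) (y \<otimes>\<^bsub>A\<^esub> w)) ` fraction b t)) ` fraction a s)"
    by (simp add: localization_def)
  also have "\<dots> = fraction (a * b) (s * t)"
  proof (rule frac_binop[OF ab])
    fix a' s' b' t' assume p: "a' \<in> D" "s' \<in> S" "b' \<in> D" "t' \<in> S"
      and e: "fraction a' s' = fraction a s" "fraction b' t' = fraction b t"
    obtain u v where uv: "u \<in> S" "v \<in> S" "u * (a' * s - a * s') \<in> I" "v * (b' * t - b * t') \<in> I"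
      using e p ab by (auto simp: frac_eq_iff)
    have "v * b' * t * (u * (a' * s - a * s')) + u * a * s' * (v * (b' * t - b * t')) \<in> I"
      by (rule ideal_in_lincomb[OF I_ideal]) (use uv p ab in auto)
    moreover have "v * b' * t * (u * (a' * s - a * s')) + u * a * s' * (v * (b' * t - b * t'))
        = u * v * (a' * b' * (s * t) - a * b * (s' * t'))"
      by (simp add: algebra_simps)
    ultimately have "u * v * (a' * b' * (s * t) - a * b * (s' * t')) \<in> I" by (simp only:)
    then have "fraction (a' * b') (s' * t') = fraction (a * b) (s * t)"
      using uv p ab S_mult D_mult by (intro frac_eqI[of _ _ _ _ "u * v"]) blast+
    then show "frac_class A (h ` q) (h a' \<otimes>\<^bsub>A\<^esub> h b') (h s' \<otimes>\<^bsub>A\<^esub> h t') = fraction (a * b) (s * t)"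
      using p by (simp add: h_mult fraction_def)
  qed
  finally show ?thesis .
qed

lemma frac_add:
  assumes ab: "a \<in> D" "b \<in> D" "s \<in> S" "t \<in> S"
  shows "fraction a s \<oplus>\<^bsub>L\<^esub> fraction b t = fraction (a * t + b * s) (s * t)"
proof -
  have "fraction a s \<oplus>\<^bsub>L\<^esub> fraction b t =
    \<Union> ((\<lambda>(x, y). \<Union> ((\<lambda>(z, w). frac_class A (h ` q) (x \<otimes>\<^bsub>A\<^esub> w \<oplus>\<^bsub>A\<^esub> z \<otimes>\<^bsub>A\<^esub> y) (y \<otimes>\<^bsub>A\<^esub> w)) ` fraction b t)) ` fraction a s)"
    by (simp add: localization_def)
  also have "\<dots> = fraction (a * t + b * s) (s * t)"
  proof (rule frac_binop[OF ab])
    fix a' s' b' t' assume p: "a' \<in> D" "s' \<in> S" "b' \<in> D" "t' \<in> S"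
      and e: "fraction a' s' = fraction a s" "fraction b' t' = fraction b t"
    obtain u v where uv: "u \<in> S" "v \<in> S" "u * (a' * s - a * s') \<in> I" "v * (b' * t - b * t') \<in> I"
      using e p ab by (auto simp: frac_eq_iff)
    have "v * t * t' * (u * (a' * s - a * s')) + u * s * s' * (v * (b' * t - b * t')) \<in> I"
      by (rule ideal_in_lincomb[OF I_ideal]) (use uv p ab in auto)
    moreover have "v * t * t' * (u * (a' * s - a * s')) + u * s * s' * (v * (b' * t - b * t'))
        = u * v * ((a' * t' + b' * s') * (s * t) - (a * t + b * s) * (s' * t'))"
      by (simp add: algebra_simps)
    ultimately have "u * v * ((a' * t' + b' * s') * (s * t) - (a * t + b * s) * (s' * t')) \<in> I"
      by (simp only:)
    then have "fraction (a' * t' + b' * s') (s' * t') = fraction (a * t + b * s) (s * t)"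
      using uv p ab S_mult D_mult D_add S_D by (intro frac_eqI[of _ _ _ _ "u * v"]) metis+
    then show "frac_class A (h ` q) (h a' \<otimes>\<^bsub>A\<^esub> h t' \<oplus>\<^bsub>A\<^esub> h b' \<otimes>\<^bsub>A\<^esub> h s') (h s' \<otimes>\<^bsub>A\<^esub> h t')
        = fraction (a * t + b * s) (s * t)"
      using p by (simp add: h_mult h_add fraction_def)
  qed
  finally show ?thesis .
qed

lemma frac_one: "\<one>\<^bsub>L\<^esub> = fraction 1 1"
  by (simp add: localization_def fraction_def h_one)

lemma frac_zero: "\<zero>\<^bsub>L\<^esub> = fraction 0 1"
  by (simp add: localization_def fraction_def h_one h_zero)

lemma L_laws:
  assumes "x \<in> carrier L" "y \<in> carrier L" "z \<in> carrier L"
  shows "x \<oplus>\<^bsub>L\<^esub> y \<oplus>\<^bsub>L\<^esub> z = x \<oplus>\<^bsub>L\<^esub> (y \<oplus>\<^bsub>L\<^esub> z)"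
    "x \<oplus>\<^bsub>L\<^esub> y = y \<oplus>\<^bsub>L\<^esub> x"
    "x \<otimes>\<^bsub>L\<^esub> y \<otimes>\<^bsub>L\<^esub> z = x \<otimes>\<^bsub>L\<^esub> (y \<otimes>\<^bsub>L\<^esub> z)"
    "x \<otimes>\<^bsub>L\<^esub> y = y \<otimes>\<^bsub>L\<^esub> x"
    "(x \<oplus>\<^bsub>L\<^esub> y) \<otimes>\<^bsub>L\<^esub> z = x \<otimes>\<^bsub>L\<^esub> z \<oplus>\<^bsub>L\<^esub> y \<otimes>\<^bsub>L\<^esub> z"
    "\<zero>\<^bsub>L\<^esub> \<oplus>\<^bsub>L\<^esub> x = x" "\<one>\<^bsub>L\<^esub> \<otimes>\<^bsub>L\<^esub> x = x"
    "x \<oplus>\<^bsub>L\<^esub> y \<in> carrier L" "x \<otimes>\<^bsub>L\<^esub> y \<in> carrier L"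
    "\<exists>y\<in>carrier L. y \<oplus>\<^bsub>L\<^esub> x = \<zero>\<^bsub>L\<^esub>"
proof -
  obtain a s where x: "a \<in> D" "s \<in> S" "x = fraction a s" using assms carrier_L by blast
  obtain b t where y: "b \<in> D" "t \<in> S" "y = fraction b t" using assms carrier_L by blast
  obtain c w where z: "c \<in> D" "w \<in> S" "z = fraction c w" using assms carrier_L by blast
  note xyz = x(3) y(3) z(3) and * = x(1) y(1) z(1) and ** = x(2) y(2) z(2)
  note D = * S_D[OF **(1)] S_D[OF **(2)] S_D[OF **(3)]
  note st = S_mult[OF **(1,2)] and tw = S_mult[OF **(2,3)] and sw = S_mult[OF **(1,3)]
    and ts = S_mult[OF **(2,1)] and wt = S_mult[OF **(3,2)] and tw = S_mult[OF **(2,3)]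
  note SS = ** st tw sw ts wt S_mult[OF st **(3)] S_mult[OF **(1) tw] S_mult[OF sw tw] one_S
  have "(a * t + b * s) * w + c * (s * t) = a * (t * w) + (b * w + c * t) * s"
    by (simp only: distrib_right distrib_left mult.assoc mult.commute mult.left_commute add.assoc)
  then have "fraction ((a * t + b * s) * w + c * (s * t)) (s * t * w)
      = fraction (a * (t * w) + (b * w + c * t) * s) (s * (t * w))"
    by (simp only: mult.assoc)
  then show "x \<oplus>\<^bsub>L\<^esub> y \<oplus>\<^bsub>L\<^esub> z = x \<oplus>\<^bsub>L\<^esub> (y \<oplus>\<^bsub>L\<^esub> z)"
    by (simp only: xyz frac_add D SS D_add D_mult)
  have "fraction (a * t + b * s) (s * t) = fraction (b * s + a * t) (t * s)"
    by (simp only: add.commute mult.commute)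
  then show "x \<oplus>\<^bsub>L\<^esub> y = y \<oplus>\<^bsub>L\<^esub> x"
    by (simp only: xyz frac_add D SS)
  have "fraction (a * b * c) (s * t * w) = fraction (a * (b * c)) (s * (t * w))"
    by (simp only: mult.assoc)
  then show "x \<otimes>\<^bsub>L\<^esub> y \<otimes>\<^bsub>L\<^esub> z = x \<otimes>\<^bsub>L\<^esub> (y \<otimes>\<^bsub>L\<^esub> z)"
    by (simp only: xyz frac_mult D SS D_mult)
  have "fraction (a * b) (s * t) = fraction (b * a) (t * s)"
    by (simp only: mult.commute)
  then show "x \<otimes>\<^bsub>L\<^esub> y = y \<otimes>\<^bsub>L\<^esub> x"
    by (simp only: xyz frac_mult D SS)
  have "fraction ((a * t + b * s) * c) (s * t * w) = fraction (a * c * (t * w) + b * c * (s * w)) (s * w * (t * w))"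
  proof (rule frac_eqI')
    show "(a * t + b * s) * c * (s * w * (t * w)) = (a * c * (t * w) + b * c * (s * w)) * (s * t * w)"
      by (simp only: distrib_right distrib_left mult.assoc mult.commute mult.left_commute)
  qed (simp_all only: SS D D_add D_mult)
  then show "(x \<oplus>\<^bsub>L\<^esub> y) \<otimes>\<^bsub>L\<^esub> z = x \<otimes>\<^bsub>L\<^esub> z \<oplus>\<^bsub>L\<^esub> y \<otimes>\<^bsub>L\<^esub> z"
    by (simp only: xyz frac_mult frac_add D SS D_add D_mult)
  show "\<zero>\<^bsub>L\<^esub> \<oplus>\<^bsub>L\<^esub> x = x"
    by (simp only: xyz frac_zero frac_add D SS D_zero D_one, simp)
  show "\<one>\<^bsub>L\<^esub> \<otimes>\<^bsub>L\<^esub> x = x"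
    by (simp only: xyz frac_one frac_mult D SS D_one, simp)
  show "x \<oplus>\<^bsub>L\<^esub> y \<in> carrier L" "x \<otimes>\<^bsub>L\<^esub> y \<in> carrier L"
    by (simp_all only: xyz frac_mult frac_add frac_carrier D SS D_add D_mult)
  have "fraction (- a * s + a * s) (s * s) = fraction 0 1"
    by (rule frac_eqI', simp_all only: S_mult[OF **(1) **(1)] SS, simp_all)
  then have "fraction (- a) s \<oplus>\<^bsub>L\<^esub> x = \<zero>\<^bsub>L\<^esub>"
    by (simp only: xyz frac_zero frac_add D SS D_uminus)
  then show "\<exists>y\<in>carrier L. y \<oplus>\<^bsub>L\<^esub> x = \<zero>\<^bsub>L\<^esub>"
    by (rule bexI, simp only: frac_carrier D SS D_uminus)
qed

end

section \<open>Ideals, dimension and regularity of the localisation\<close>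

context presented_prime
begin

lemma cring_L: "cring L"
proof (rule cringI_laws)
  show "\<zero>\<^bsub>L\<^esub> \<in> carrier L" "\<one>\<^bsub>L\<^esub> \<in> carrier L"
    by (simp_all only: frac_zero frac_one frac_carrier D_zero D_one one_S)
qed (rule L_laws; assumption)+

lemma frac_split: "a \<in> D \<Longrightarrow> s \<in> S \<Longrightarrow> fraction a s = fraction 1 s \<otimes>\<^bsub>L\<^esub> fraction a 1"
  by (simp only: frac_mult D_one one_S mult_1_left mult_1_right)

lemma frac_cancel:
  assumes "a \<in> D" "s \<in> S"
  shows "fraction s 1 \<otimes>\<^bsub>L\<^esub> fraction a s = fraction a 1"
proof -
  have "fraction (s * a) (1 * s) = fraction a 1"
    by (rule frac_eqI') (use assms S_D one_S in \<open>simp_all add: mult.commute\<close>)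
  then show ?thesis using assms S_D one_S by (simp only: frac_mult)
qed

text \<open>The contraction goes all the way down to \<open>D\<close>, not only to D/I, and
  therefore contains \<open>I\<close>.\<close>

definition contraction :: "('a \<times> 'a) set set \<Rightarrow> 'r set" where
  "contraction K = {a \<in> D. fraction a 1 \<in> K}"

definition extension :: "'r set \<Rightarrow> ('a \<times> 'a) set set" where
  "extension P = {fraction a s | a s. a \<in> P \<and> s \<in> S}"

text \<open>Denominators are units of the localisation, so the numerator alone decides
  membership.\<close>

lemma contraction_mem:
  assumes K: "ideal K L" and as: "a \<in> D" "s \<in> S"
  shows "fraction a s \<in> K \<longleftrightarrow> a \<in> contraction K"
proof
  assume "fraction a s \<in> K"
  then have "fraction s 1 \<otimes>\<^bsub>L\<^esub> fraction a s \<in> K"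
    by (rule ideal.I_l_closed[OF K _ frac_carrier[OF S_D[OF as(2)] one_S]])
  then show "a \<in> contraction K" using as frac_cancel by (simp add: contraction_def)
next
  assume "a \<in> contraction K"
  then have "fraction a 1 \<in> K" by (simp add: contraction_def)
  then have "fraction 1 s \<otimes>\<^bsub>L\<^esub> fraction a 1 \<in> K"
    by (rule ideal.I_l_closed[OF K _ frac_carrier[OF D_one as(2)]])
  then show "fraction a s \<in> K" using frac_split[OF as] by (simp only:)
qed

lemma contraction_ideal:
  assumes K: "ideal K L"
  shows "ideal_in D (contraction K)"
  unfolding ideal_in_def
proof (intro conjI ballI)
  show "contraction K \<subseteq> D" by (auto simp: contraction_def)
  show "0 \<in> contraction K"
    using additive_subgroup.zero_closed[OF ideal.axioms(1)[OF K]]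
    by (simp add: contraction_def frac_zero)
  show "a + b \<in> contraction K" if "a \<in> contraction K" "b \<in> contraction K" for a b
  proof -
    have "fraction a 1 \<oplus>\<^bsub>L\<^esub> fraction b 1 \<in> K"
      using additive_subgroup.a_closed[OF ideal.axioms(1)[OF K]] that by (simp add: contraction_def)
    moreover have "fraction a 1 \<oplus>\<^bsub>L\<^esub> fraction b 1 = fraction (a + b) 1"
      using that one_S by (simp add: frac_add contraction_def del: Diff_iff)
    ultimately show ?thesis using that by (simp add: contraction_def)
  qed
  show "r * a \<in> contraction K" if "r \<in> D" "a \<in> contraction K" for r a
  proof -
    have "fraction a 1 \<in> K" using that by (simp add: contraction_def)
    then have "fraction r 1 \<otimes>\<^bsub>L\<^esub> fraction a 1 \<in> K"
      by (rule ideal.I_l_closed[OF K _ frac_carrier[OF that(1) one_S]])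
    moreover have "fraction r 1 \<otimes>\<^bsub>L\<^esub> fraction a 1 = fraction (r * a) 1"
      using that one_S by (simp add: frac_mult contraction_def del: Diff_iff)
    ultimately show ?thesis using that by (simp add: contraction_def)
  qed
qed

lemma I_contraction:
  assumes K: "ideal K L"
  shows "I \<subseteq> contraction K"
proof
  fix a assume a: "a \<in> I"
  then have "fraction a 1 = fraction 0 1"
    using one_S I_D by (intro frac_eqI[of a 0 1 1 1]) auto
  then have "fraction a 1 \<in> K"
    using additive_subgroup.zero_closed[OF ideal.axioms(1)[OF K]] by (simp add: frac_zero)
  then show "a \<in> contraction K" using a I_D by (simp add: contraction_def)
qed

lemma ideal_subset_iff:
  assumes K: "ideal K L" and K': "ideal K' L"
  shows "K \<subseteq> K' \<longleftrightarrow> contraction K \<subseteq> contraction K'"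
proof
  assume c: "contraction K \<subseteq> contraction K'"
  show "K \<subseteq> K'"
  proof
    fix x assume x: "x \<in> K"
    then have "x \<in> carrier L" using ideal.Icarr[OF K] by blast
    then obtain a s where "a \<in> D" "s \<in> S" "x = fraction a s" using carrier_L by blast
    then show "x \<in> K'" using x c contraction_mem[OF K] contraction_mem[OF K'] by blast
  qed
qed (auto simp: contraction_def)

text \<open>An equality of fractions only puts a multiple \<open>u * t * a\<close> into
  \<open>P\<close>; since \<open>u * t\<close> lies outside \<open>q\<close>, hence outside
  \<open>P\<close>, primality removes it.\<close>

lemma extension_mem:
  assumes P: "prime_in D P" "I \<subseteq> P" "P \<subseteq> q" and as: "a \<in> D" "s \<in> S"
  shows "fraction a s \<in> extension P \<longleftrightarrow> a \<in> P"
proof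
  note Pi = prime_inD(1)[OF P(1)]
  assume "fraction a s \<in> extension P"
  then obtain b t where bt: "b \<in> P" "t \<in> S" "fraction a s = fraction b t" by (auto simp: extension_def)
  then have "b \<in> D" using ideal_inD(1)[OF Pi] by blast
  then obtain u where u: "u \<in> S" "u * (a * t - b * s) \<in> I" using bt as frac_eq_iff by blast
  have "u * (a * t - b * s) \<in> P" using u P by blast
  moreover have "u * s * b \<in> P"
    using ideal_inD(4)[OF Pi D_mult[OF S_D[OF u(1)] S_D[OF as(2)]] bt(1)] .
  ultimately have "u * (a * t - b * s) + u * s * b \<in> P" by (rule ideal_inD(3)[OF Pi])
  moreover have "u * (a * t - b * s) + u * s * b = u * t * a" by (simp add: algebra_simps)
  ultimately have "u * t * a \<in> P" by (simp only:)
  moreover have "u * t \<notin> P" "u * t \<in> D" using S_mult[OF u(1) bt(2)] P(3) by auto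
  ultimately show "a \<in> P" using prime_inD(3)[OF P(1), of "u * t" a] as by blast
qed (use as in \<open>auto simp: extension_def\<close>)

lemma extension_ideal:
  assumes P: "ideal_in D P"
  shows "ideal (extension P) L"
proof -
  interpret L: cring L by (rule cring_L)
  note PD = ideal_inD(1)[OF P]
  have carr: "x \<in> extension P \<Longrightarrow> x \<in> carrier L" for x using PD by (auto simp: extension_def)
  have mult: "x \<otimes>\<^bsub>L\<^esub> y \<in> extension P" if xy: "x \<in> carrier L" "y \<in> extension P" for x y
  proof -
    obtain a s where a: "a \<in> D" "s \<in> S" "x = fraction a s" using xy(1) carrier_L by blast
    obtain b t where b: "b \<in> P" "t \<in> S" "y = fraction b t" using xy(2) by (auto simp: extension_def)
    have "x \<otimes>\<^bsub>L\<^esub> y = fraction (a * b) (s * t)" using a b PD by (simp only: frac_mult)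
    then show ?thesis using a b S_mult[OF a(2) b(2)] ideal_inD(4)[OF P] unfolding extension_def by blast
  qed
  show ?thesis
  proof (rule idealI[OF L.ring_axioms])
    show "subgroup (extension P) (add_monoid L)"
    proof (rule L.add.subgroupI)
      show "extension P \<subseteq> carrier L" using carr by blast
      show "extension P \<noteq> {}" using ideal_inD(2)[OF P] one_S unfolding extension_def by blast
      show "\<ominus>\<^bsub>L\<^esub> x \<in> extension P" if x: "x \<in> extension P" for x
      proof -
        have "\<ominus>\<^bsub>L\<^esub> x = (\<ominus>\<^bsub>L\<^esub> \<one>\<^bsub>L\<^esub>) \<otimes>\<^bsub>L\<^esub> x" using carr[OF x] L.l_minus[of "\<one>\<^bsub>L\<^esub>" x] by simp
        then show ?thesis using mult[OF _ x] by simp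
      qed
      show "x \<oplus>\<^bsub>L\<^esub> y \<in> extension P" if xy: "x \<in> extension P" "y \<in> extension P" for x y
      proof -
        obtain a s where a: "a \<in> P" "s \<in> S" "x = fraction a s" using xy(1) by (auto simp: extension_def)
        obtain b t where b: "b \<in> P" "t \<in> S" "y = fraction b t" using xy(2) by (auto simp: extension_def)
        have "x \<oplus>\<^bsub>L\<^esub> y = fraction (a * t + b * s) (s * t)" using a b PD by (simp only: frac_add)
        moreover have "a * t + b * s \<in> P"
          using a b by (intro ideal_inD(3)[OF P] ideal_inD(5)[OF P]) auto
        ultimately show ?thesis using S_mult[OF a(2) b(2)] unfolding extension_def by blast
      qed
    qed
    show "x \<otimes>\<^bsub>L\<^esub> a \<in> extension P" if "a \<in> extension P" "x \<in> carrier L" for a x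
      using mult that by blast
    then show "a \<otimes>\<^bsub>L\<^esub> x \<in> extension P" if "a \<in> extension P" "x \<in> carrier L" for a x
      using that carr L.m_comm[of a x] by metis
  qed
qed

lemma contraction_extension:
  assumes "prime_in D P" "I \<subseteq> P" "P \<subseteq> q"
  shows "contraction (extension P) = P"
  using extension_mem[OF assms _ one_S] ideal_inD(1)[OF prime_inD(1)[OF assms(1)]]
  by (auto simp: contraction_def)

lemma ideal_eq_carrier:
  assumes K: "ideal K L" and a: "a \<in> contraction K" "a \<in> S"
  shows "K = carrier L"
proof -
  have "fraction a 1 \<in> K" using a by (simp add: contraction_def)
  then have "fraction 1 a \<otimes>\<^bsub>L\<^esub> fraction a 1 \<in> K"
    by (rule ideal.I_l_closed[OF K _ frac_carrier[OF D_one a(2)]])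
  moreover have "fraction 1 a \<otimes>\<^bsub>L\<^esub> fraction a 1 = fraction (1 * a) (a * 1)"
    using a one_S by (simp only: frac_mult D_one S_D)
  moreover have "\<dots> = \<one>\<^bsub>L\<^esub>" unfolding frac_one
    by (rule frac_eqI') (use a(2) one_S S_D in simp_all)
  ultimately show ?thesis using ideal.one_imp_carrier[OF K] by simp
qed

lemma spec_L: "spec L = extension ` {P. prime_in D P \<and> I \<subseteq> P \<and> P \<subseteq> q}"
proof (intro equalityI subsetI)
  fix K assume "K \<in> spec L"
  then have Kp: "primeideal K L" by (simp add: spec_def)
  then have K: "ideal K L" by (rule primeideal.axioms(1))
  have ne: "K \<noteq> carrier L" using primeideal.I_notcarr[OF Kp] by blast
  then have sub: "contraction K \<subseteq> q"
    using ideal_eq_carrier[OF K] by (auto simp: contraction_def)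
  have "a \<in> contraction K \<or> b \<in> contraction K" if ab: "a \<in> D" "b \<in> D" "a * b \<in> contraction K" for a b
  proof -
    have "fraction a 1 \<otimes>\<^bsub>L\<^esub> fraction b 1 \<in> K"
      using ab one_S by (simp add: frac_mult contraction_def del: Diff_iff)
    then show ?thesis
      using primeideal.I_prime[OF Kp frac_carrier[OF ab(1) one_S] frac_carrier[OF ab(2) one_S]] ab
      by (simp only: contraction_def mem_Collect_eq simp_thms)
  qed
  then have P: "prime_in D (contraction K)" "I \<subseteq> contraction K"
    using contraction_ideal[OF K] I_contraction[OF K] sub one_S by (auto simp: prime_in_def)
  have "extension (contraction K) = K"
    using ideal_subset_iff[OF K extension_ideal] ideal_subset_iff[OF extension_ideal K]
      contraction_ideal[OF K] contraction_extension[OF P sub] by blast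
  then show "K \<in> extension ` {P. prime_in D P \<and> I \<subseteq> P \<and> P \<subseteq> q}" using P sub by blast
next
  fix K assume "K \<in> extension ` {P. prime_in D P \<and> I \<subseteq> P \<and> P \<subseteq> q}"
  then obtain P where P: "prime_in D P" "I \<subseteq> P" "P \<subseteq> q" "K = extension P" by blast
  have "primeideal (extension P) L"
  proof (rule primeidealI[OF extension_ideal[OF prime_inD(1)[OF P(1)]] cring_L])
    have "fraction 1 1 \<notin> extension P"
      using extension_mem[OF P(1-3), of 1 1] prime_inD(2)[OF P(1)] one_S by blast
    then show "carrier L \<noteq> extension P" using frac_carrier[of 1 1] one_S D_one by blast
    show "x \<in> extension P \<or> y \<in> extension P"
      if xy: "x \<in> carrier L" "y \<in> carrier L" "x \<otimes>\<^bsub>L\<^esub> y \<in> extension P" for x y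
    proof -
      obtain a s where a: "a \<in> D" "s \<in> S" "x = fraction a s" using xy(1) carrier_L by blast
      obtain b t where b: "b \<in> D" "t \<in> S" "y = fraction b t" using xy(2) carrier_L by blast
      have "fraction (a * b) (s * t) \<in> extension P" using xy a b by (simp only: frac_mult)
      then have "a * b \<in> P" using extension_mem[OF P(1-3)] a b S_mult[OF a(2) b(2)] D_mult by blast
      then have "a \<in> P \<or> b \<in> P" using prime_inD(3)[OF P(1)] a b by blast
      then show ?thesis using extension_mem[OF P(1-3)] a b by blast
    qed
  qed
  then show "K \<in> spec L" using P by (simp add: spec_def)
qed

lemma extension_psubset:
  assumes "prime_in D P" "I \<subseteq> P" "P \<subseteq> q" "prime_in D P'" "I \<subseteq> P'" "P' \<subseteq> q"
  shows "extension P \<subset> extension P' \<longleftrightarrow> P \<subset> P'"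
  using ideal_subset_iff[OF extension_ideal extension_ideal] prime_inD(1)[OF assms(1)]
    prime_inD(1)[OF assms(4)] contraction_extension[OF assms(1-3)] contraction_extension[OF assms(4-6)]
  unfolding psubset_eq by (metis subset_antisym subset_refl)

lemma maximal_ideals: "{K. maximalideal K L} = {extension q}"
proof -
  have eq: "ideal (extension q) L" by (rule extension_ideal[OF q_ideal])
  have cq: "contraction (extension q) = q" by (rule contraction_extension[OF q_prime I_q subset_refl])
  have ne: "carrier L \<noteq> extension q"
  proof
    assume "carrier L = extension q"
    then have "fraction 1 1 \<in> extension q" using frac_carrier[of 1 1] one_S D_one by blast
    then show False using extension_mem[OF q_prime I_q subset_refl D_one one_S] one_S by blast
  qed
  have proper: "K \<subseteq> extension q" if K: "ideal K L" "K \<noteq> carrier L" for K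
  proof -
    have "contraction K \<subseteq> q" using ideal_eq_carrier[OF K(1)] K(2) by (auto simp: contraction_def)
    then show ?thesis using ideal_subset_iff[OF K(1) eq] cq by simp
  qed
  show ?thesis
  proof (intro equalityI subsetI)
    fix K assume "K \<in> {K. maximalideal K L}"
    then have K: "maximalideal K L" by simp
    then have i: "ideal K L" by (rule maximalideal.axioms(1))
    have "K \<noteq> carrier L" using maximalideal.I_notcarr[OF K] by blast
    then have "K \<subseteq> extension q" using proper i by blast
    then show "K \<in> {extension q}"
      using maximalideal.I_maximal[OF K eq] ne ideal.Icarr[OF eq] by blast
  next
    fix K assume "K \<in> {extension q}"
    then show "K \<in> {K. maximalideal K L}"
      using maximalidealI[OF eq ne] proper by blast
  qed
qed

text \<open>An ideal of the localisation is determined by its contraction, so finitely many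
  generators of the contraction modulo \<open>I\<close> also generate the ideal.\<close>

lemma noetherian_L:
  assumes noeth: "noetherian_over D I"
  shows "noetherian_ring L"
proof -
  interpret L: cring L by (rule cring_L)
  show ?thesis
  proof (rule L.noetherian_ringI)
    fix K assume K: "ideal K L"
    obtain F where F: "finite F" "F \<subseteq> contraction K"
      "\<And>J'. ideal_in D J' \<Longrightarrow> I \<subseteq> J' \<Longrightarrow> F \<subseteq> J' \<Longrightarrow> contraction K \<subseteq> J'"
      using noeth contraction_ideal[OF K] I_contraction[OF K] unfolding noetherian_over_def by metis
    define G where "G = (\<lambda>a. fraction a 1) ` F"
    have G: "G \<subseteq> K" using F(2) by (auto simp: G_def contraction_def)
    then have Gc: "G \<subseteq> carrier L" using ideal.Icarr[OF K] by blast
    have iG: "ideal (Idl\<^bsub>L\<^esub> G) L" by (rule L.genideal_ideal[OF Gc])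
    have "F \<subseteq> contraction (Idl\<^bsub>L\<^esub> G)"
      using F(2) L.genideal_self[OF Gc] by (auto simp: G_def contraction_def)
    then have "contraction K \<subseteq> contraction (Idl\<^bsub>L\<^esub> G)"
      using F(3) contraction_ideal[OF iG] I_contraction[OF iG] by blast
    then have "K \<subseteq> Idl\<^bsub>L\<^esub> G" using ideal_subset_iff[OF K iG] by blast
    moreover have "Idl\<^bsub>L\<^esub> G \<subseteq> K" by (rule L.genideal_minimal[OF K G])
    ultimately show "\<exists>A\<subseteq>carrier L. finite A \<and> K = Idl\<^bsub>L\<^esub> A"
      using Gc F(1) by (intro exI[of _ G]) (auto simp: G_def)
  qed
qed

lemma krull_dim_minimal:
  assumes minimal: "\<And>P. prime_in D P \<Longrightarrow> I \<subseteq> P \<Longrightarrow> P \<subseteq> q \<Longrightarrow> P = q"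
  shows "krull_dim L = 0"
proof -
  have "spec L = {extension q}" using minimal q_prime I_q by (auto simp: spec_L)
  then have "d = 0" if "\<forall>i\<le>d. P i \<in> spec L" "\<forall>i<d. P i \<subset> P (Suc i)" for d :: nat and P
    using that by (cases d) (auto simp: less_Suc_eq_le all_conj_distrib dest: spec[of _ 0] spec[of _ "Suc 0"])
  then have "krull_dim L \<le> 0" unfolding krull_dim_def
    by (intro Sup_least) (auto simp: zero_enat_def)
  then show ?thesis by simp
qed

text \<open>In a chain of three primes below \<open>q\<close> the middle one would be
  \<open>q\<close> by \<open>max\<close>, which leaves no room for the third.\<close>

lemma krull_dim_one:
  assumes P0: "prime_in D P0" "I \<subseteq> P0" "P0 \<subset> q"
    and max: "\<And>P P'. prime_in D P \<Longrightarrow> I \<subseteq> P \<Longrightarrow> prime_in D P' \<Longrightarrow> P \<subset> P' \<Longrightarrow> P' \<subseteq> q \<Longrightarrow> P' = q"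
  shows "krull_dim L = 1"
proof (rule antisym)
  show "krull_dim L \<le> 1" unfolding krull_dim_def
  proof (rule Sup_least)
    fix e assume "e \<in> {enat d | d. \<exists>P. (\<forall>i\<le>d. P i \<in> spec L) \<and> (\<forall>i<d. P i \<subset> P (Suc i))}"
    then obtain d P where d: "e = enat d" "\<forall>i\<le>d. P i \<in> spec L" "\<forall>i<d. P i \<subset> P (Suc i)" by blast
    have "d \<le> 1"
    proof (rule ccontr)
      assume "\<not> d \<le> 1"
      then have c: "P 0 \<in> spec L" "P 1 \<in> spec L" "P 2 \<in> spec L" "P 0 \<subset> P 1" "P 1 \<subset> P 2"
        using d(2)[rule_format, of 0] d(2)[rule_format, of 1] d(2)[rule_format, of 2]
          d(3)[rule_format, of 0] d(3)[rule_format, of 1] by (auto simp: numeral_2_eq_2)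
      then obtain Q0 Q1 Q2 where
        Q: "prime_in D Q0" "I \<subseteq> Q0" "Q0 \<subseteq> q" "prime_in D Q1" "I \<subseteq> Q1" "Q1 \<subseteq> q"
          "prime_in D Q2" "I \<subseteq> Q2" "Q2 \<subseteq> q" "P 0 = extension Q0" "P 1 = extension Q1" "P 2 = extension Q2"
        unfolding spec_L by blast
      then have "Q0 \<subset> Q1" "Q1 \<subset> Q2" using c extension_psubset by auto
      then show False using max[of Q0 Q1] Q by blast
    qed
    then show "e \<le> 1" using d by (simp add: one_enat_def)
  qed
  let ?P = "\<lambda>i::nat. if i = 0 then extension P0 else extension q"
  have P: "(\<forall>i\<le>1. ?P i \<in> spec L) \<and> (\<forall>i<1. ?P i \<subset> ?P (Suc i))"
    using P0 q_prime I_q extension_psubset[of P0 q] by (auto simp: spec_L)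
  have "enat 1 \<in> {enat d | d. \<exists>P. (\<forall>i\<le>d. P i \<in> spec L) \<and> (\<forall>i<d. P i \<subset> P (Suc i))}"
    by (rule CollectI, rule exI[of _ 1], rule conjI[OF refl], rule exI[of _ ?P], rule P)
  then show "1 \<le> krull_dim L" unfolding krull_dim_def one_enat_def by (rule Sup_upper)
qed

text \<open>In dimension 0 the generating set has to be empty, so the maximal ideal must be zero.
  This is what \<open>zero\<close> says: each element of \<open>q\<close> is killed by an element
  outside \<open>q\<close>.\<close>

lemma regular_minimal:
  assumes noeth: "noetherian_over D I"
    and minimal: "\<And>P. prime_in D P \<Longrightarrow> I \<subseteq> P \<Longrightarrow> P \<subseteq> q \<Longrightarrow> P = q"
    and zero: "\<And>a. a \<in> q \<Longrightarrow> \<exists>u\<in>S. u * a \<in> I"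
  shows "regular_local_ring L"
proof -
  interpret L: cring L by (rule cring_L)
  have iq: "ideal (extension q) L" by (rule extension_ideal[OF q_ideal])
  have "extension q \<subseteq> {\<zero>\<^bsub>L\<^esub>}"
  proof
    fix x assume "x \<in> extension q"
    then obtain a s where a: "a \<in> q" "s \<in> S" "x = fraction a s" by (auto simp: extension_def)
    then obtain u where "u \<in> S" "u * a \<in> I" using zero by blast
    then have "fraction a s = fraction 0 1"
      using a q_D one_S by (intro frac_eqI[of a 0 s 1 u]) auto
    then show "x \<in> {\<zero>\<^bsub>L\<^esub>}" using a by (simp add: frac_zero)
  qed
  moreover have "\<zero>\<^bsub>L\<^esub> \<in> Idl\<^bsub>L\<^esub> {}"
    using additive_subgroup.zero_closed ideal.axioms(1) L.genideal_ideal by blast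
  moreover have "Idl\<^bsub>L\<^esub> {} \<subseteq> extension q" using L.genideal_minimal[OF iq] by blast
  ultimately have "extension q = Idl\<^bsub>L\<^esub> {}" by blast
  moreover have "krull_dim L = enat (card ({} :: ('a \<times> 'a) set set))"
    using krull_dim_minimal[OF minimal] by (simp add: zero_enat_def)
  ultimately have "\<exists>F\<subseteq>carrier L. finite F \<and> enat (card F) = krull_dim L \<and> extension q = Idl\<^bsub>L\<^esub> F"
    by (intro exI[of _ "{}"]) simp
  then show ?thesis
    unfolding regular_local_ring_def using maximal_ideals cring_L noetherian_L[OF noeth] by blast
qed

text \<open>In dimension 1 regularity means that the maximal ideal is principal. The generator may
  be taken with denominator 1, and divisibility by it, with denominators cleared, is the relation
  modulo \<open>I\<close>.\<close>

lemma regular_one_iff: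
  assumes noeth: "noetherian_over D I"
    and P0: "prime_in D P0" "I \<subseteq> P0" "P0 \<subset> q"
    and max: "\<And>P P'. prime_in D P \<Longrightarrow> I \<subseteq> P \<Longrightarrow> prime_in D P' \<Longrightarrow> P \<subset> P' \<Longrightarrow> P' \<subseteq> q \<Longrightarrow> P' = q"
  shows "regular_local_ring L \<longleftrightarrow> (\<exists>\<pi>\<in>q. \<forall>a\<in>q. \<exists>u\<in>S. \<exists>r\<in>D. u * a - r * \<pi> \<in> I)"
proof -
  interpret L: cring L by (rule cring_L)
  have iq: "ideal (extension q) L" by (rule extension_ideal[OF q_ideal])
  have dim: "krull_dim L = 1" by (rule krull_dim_one[OF P0 max])
  have "regular_local_ring L \<longleftrightarrow> (\<exists>F\<subseteq>carrier L. finite F \<and> card F = 1 \<and> extension q = Idl\<^bsub>L\<^esub> F)"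
    unfolding regular_local_ring_def maximal_ideals dim
    using cring_L noetherian_L[OF noeth] by (auto simp: one_enat_def)
  also have "\<dots> \<longleftrightarrow> (\<exists>x\<in>carrier L. extension q = Idl\<^bsub>L\<^esub> {x})"
    by (auto simp: card_1_singleton_iff)
  also have "\<dots> \<longleftrightarrow> (\<exists>\<pi>\<in>q. \<forall>a\<in>q. \<exists>u\<in>S. \<exists>r\<in>D. u * a - r * \<pi> \<in> I)"
  proof
    assume "\<exists>x\<in>carrier L. extension q = Idl\<^bsub>L\<^esub> {x}"
    then obtain x where x: "x \<in> carrier L" "extension q = Idl\<^bsub>L\<^esub> {x}" by blast
    obtain p s where p: "p \<in> D" "s \<in> S" "x = fraction p s" using x(1) carrier_L by blast
    have "x \<in> extension q" using L.genideal_self'[OF x(1)] x(2) by simp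
    then have pq: "p \<in> q" using extension_mem[OF q_prime I_q subset_refl] p by blast
    have "\<exists>u\<in>S. \<exists>r\<in>D. u * a - r * p \<in> I" if a: "a \<in> q" for a
    proof -
      have aD: "a \<in> D" using a q_D by blast
      have "fraction a 1 \<in> extension q" using a one_S unfolding extension_def by blast
      then have "fraction a 1 \<in> Idl\<^bsub>L\<^esub> {x}" using x(2) by (simp only:)
      then have "fraction a 1 \<in> PIdl\<^bsub>L\<^esub> x" using L.cgenideal_eq_genideal[OF x(1)] by simp
      then obtain y where y: "y \<in> carrier L" "fraction a 1 = y \<otimes>\<^bsub>L\<^esub> x" by (auto simp: cgenideal_def)
      obtain b t where b: "b \<in> D" "t \<in> S" "y = fraction b t" using y(1) carrier_L by blast
      have ts: "t * s \<in> S" using b p by (intro S_mult)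
      have "fraction a 1 = fraction (b * p) (t * s)" using y b p by (simp only: frac_mult)
      then obtain u where u: "u \<in> S" "u * (a * (t * s) - b * p * 1) \<in> I"
        using frac_eq_iff[OF aD D_mult[OF b(1) p(1)] one_S ts] by blast
      have "u * (a * (t * s) - b * p * 1) = u * (t * s) * a - u * b * p" by (simp add: algebra_simps)
      with u(2) have "u * (t * s) * a - u * b * p \<in> I" by (simp only:)
      then show ?thesis using S_mult[OF u(1) ts] D_mult[OF S_D[OF u(1)] b(1)] by blast
    qed
    then show "\<exists>\<pi>\<in>q. \<forall>a\<in>q. \<exists>u\<in>S. \<exists>r\<in>D. u * a - r * \<pi> \<in> I" using pq by blast
  next
    assume "\<exists>\<pi>\<in>q. \<forall>a\<in>q. \<exists>u\<in>S. \<exists>r\<in>D. u * a - r * \<pi> \<in> I"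
    then obtain p where p: "p \<in> q" "\<And>a. a \<in> q \<Longrightarrow> \<exists>u\<in>S. \<exists>r\<in>D. u * a - r * p \<in> I" by blast
    have pD: "p \<in> D" using p q_D by blast
    let ?x = "fraction p 1"
    have xc: "?x \<in> carrier L" using pD one_S by (rule frac_carrier)
    have "?x \<in> extension q" using p(1) one_S unfolding extension_def by blast
    then have "Idl\<^bsub>L\<^esub> {?x} \<subseteq> extension q" using L.genideal_minimal[OF iq] by simp
    moreover have "extension q \<subseteq> Idl\<^bsub>L\<^esub> {?x}"
    proof
      fix y assume "y \<in> extension q"
      then obtain a s where a: "a \<in> q" "s \<in> S" "y = fraction a s" by (auto simp: extension_def)
      obtain u r where u: "u \<in> S" "r \<in> D" "u * a - r * p \<in> I" using p(2)[OF a(1)] by blast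
      have us: "u * s \<in> S" using u a by (intro S_mult)
      have "s * (u * a - r * p) \<in> I" using u(3) S_D[OF a(2)] by (rule ideal_inD(4)[OF I_ideal, rotated])
      moreover have "s * (u * a - r * p) = 1 * (a * (u * s * 1) - r * p * s)" by (simp add: algebra_simps)
      ultimately have "1 * (a * (u * s * 1) - r * p * s) \<in> I" by (simp only:)
      then have "fraction a s = fraction (r * p) (u * s * 1)"
        using a u pD q_D one_S us by (intro frac_eqI[of a "r * p" s "u * s * 1" 1]) auto
      also have "\<dots> = fraction r (u * s) \<otimes>\<^bsub>L\<^esub> ?x"
        using u pD us one_S by (simp only: frac_mult)
      finally have "y \<in> PIdl\<^bsub>L\<^esub> ?x" using a u us by (auto simp: cgenideal_def)
      then show "y \<in> Idl\<^bsub>L\<^esub> {?x}" using L.cgenideal_eq_genideal[OF xc] by simp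
    qed
    ultimately show "\<exists>x\<in>carrier L. extension q = Idl\<^bsub>L\<^esub> {x}" using xc by blast
  qed
  finally show ?thesis .
qed

end

instance alg_closure :: (field) field_gcd ..

section \<open>Linear algebra over a domain and monic division\<close>

text \<open>Fraction-free Gaussian elimination: a row \<open>p\<close> with nonzero entry in column
  \<open>b\<close> clears that column in the other rows, and the coefficient of row \<open>p\<close>
  is chosen afterwards to restore the relation.\<close>

lemma linear_dependence:
  fixes v :: "'i \<Rightarrow> 'j \<Rightarrow> 'a::idom"
  assumes "finite A" "finite B" "card B < card A"
  shows "\<exists>r. (\<exists>i\<in>A. r i \<noteq> 0) \<and> (\<forall>j\<in>B. (\<Sum>i\<in>A. r i * v i j) = 0)"
  using assms(2,1,3)
proof (induction B arbitrary: A v)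
  case empty
  then have "A \<noteq> {}" by auto
  then show ?case by (intro exI[of _ "\<lambda>_. 1"]) auto
next
  case (insert b B)
  show ?case
  proof (cases "\<forall>i\<in>A. v i b = 0")
    case True
    have "card B < card A" using insert by simp
    then obtain r where "\<exists>i\<in>A. r i \<noteq> 0" "\<forall>j\<in>B. (\<Sum>i\<in>A. r i * v i j) = 0"
      using insert.IH insert.prems by blast
    then show ?thesis using True by (intro exI[of _ r]) simp
  next
    case False
    then obtain p where p: "p \<in> A" "v p b \<noteq> 0" by blast
    have "card B < card (A - {p})" using insert p by simp
    then obtain s where s: "\<exists>i\<in>A - {p}. s i \<noteq> 0"
      "\<And>j. j \<in> B \<Longrightarrow> (\<Sum>i\<in>A - {p}. s i * (v p b * v i j - v i b * v p j)) = 0"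
      using insert.IH[of "A - {p}" "\<lambda>i j. v p b * v i j - v i b * v p j"] insert.prems by auto
    define r where "r i = (if i = p then - (\<Sum>i\<in>A - {p}. s i * v i b) else v p b * s i)" for i
    have "(\<Sum>i\<in>A. r i * v i j) = (\<Sum>i\<in>A - {p}. s i * (v p b * v i j - v i b * v p j))" for j
    proof -
      have "(\<Sum>i\<in>A. r i * v i j) = r p * v p j + (\<Sum>i\<in>A - {p}. r i * v i j)"
        using insert.prems p by (simp add: sum.remove)
      also have "(\<Sum>i\<in>A - {p}. r i * v i j) = (\<Sum>i\<in>A - {p}. s i * (v p b * v i j))"
        by (intro sum.cong) (auto simp: r_def)
      also have "r p * v p j = - (\<Sum>i\<in>A - {p}. s i * (v i b * v p j))"
        by (simp add: r_def sum_distrib_right mult.assoc)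
      finally show ?thesis by (simp add: right_diff_distrib sum_subtractf)
    qed
    moreover have "(\<Sum>i\<in>A - {p}. s i * (v p b * v i b - v i b * v p b)) = 0"
      by (simp add: mult.commute)
    moreover have "\<exists>i\<in>A. r i \<noteq> 0" using s(1) p by (auto simp: r_def)
    ultimately show ?thesis using s(2) by (intro exI[of _ r]) auto
  qed
qed

lemma monic_remainder:
  fixes F :: "'a::comm_ring_1 poly"
  assumes "lead_coeff F = 1" "degree F > 0"
  shows "\<exists>r. F dvd g - r \<and> degree r < degree F"
proof (induction g)
  case 0
  show ?case using assms by (intro exI[of _ 0]) auto
next
  case (pCons a p)
  then obtain r where r: "F dvd p - r" "degree r < degree F" by blast
  let ?c = "coeff (pCons a r) (degree F)"
  let ?r = "pCons a r - smult ?c F"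
  have "degree (pCons a r) \<le> degree F" using r by (simp add: degree_pCons_eq_if)
  then have "degree ?r \<le> degree F" by (intro degree_diff_le) (auto intro: degree_smult_le)
  moreover have "coeff ?r (degree F) = 0" using assms by simp
  ultimately have "degree ?r < degree F"
    using assms by (metis degree_0 leading_coeff_0_iff le_neq_implies_less)
  moreover have "pCons a p - ?r = [:0, 1:] * (p - r) + [:?c:] * F" by simp
  then have "F dvd pCons a p - ?r" using r by (metis dvd_add dvd_mult dvd_refl)
  ultimately show ?case by blast
qed

lemma (in subring_ideal) sum_D: "(\<And>i. i \<in> A \<Longrightarrow> f i \<in> D) \<Longrightarrow> sum f A \<in> D"
  by (induction A rule: infinite_finite_induct) auto

subsection \<open>Points of the affine plane\<close>

definition eval2 :: "'k::comm_ring_1 \<Rightarrow> 'k \<Rightarrow> 'k poly poly \<Rightarrow> 'k" where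
  "eval2 x c g = poly (poly g [:x:]) c"

lemma eval2_simps [simp]:
  "eval2 x c 0 = 0" "eval2 x c 1 = 1"
  "eval2 x c (a + b) = eval2 x c a + eval2 x c b"
  "eval2 x c (a - b) = eval2 x c a - eval2 x c b"
  "eval2 x c (- a) = - eval2 x c a"
  "eval2 x c (a * b) = eval2 x c a * eval2 x c b"
  "eval2 x c (a ^ i) = eval2 x c a ^ i"
  "eval2 x c [:r:] = poly r c"
  "eval2 x c (pCons r a) = poly r c + x * eval2 x c a"
  by (simp_all add: eval2_def)

lemma eval2_sum [simp]: "eval2 x c (sum f A) = (\<Sum>i\<in>A. eval2 x c (f i))"
  by (simp add: eval2_def poly_sum)

lemma eval2_prod [simp]: "eval2 x c (prod f A) = (\<Prod>i\<in>A. eval2 x c (f i))"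
  by (simp add: eval2_def poly_prod)

lemma eval2_dvd: "F dvd g \<Longrightarrow> eval2 x c F = 0 \<Longrightarrow> eval2 x c g = 0"
  by (auto elim!: dvdE)

lemma eval2_pcompose: "eval2 x c (pcompose g f) = eval2 (eval2 x c f) c g"
  by (induction g) (simp_all add: pcompose_pCons)

text \<open>The factor theorem is applied in the outer variable and then in the inner one. For a
  polynomial that vanishes at the point this writes it in the two linear generators of the maximal
  ideal.\<close>

lemma maximal_ideal_generators:
  fixes x c :: "'k::field"
  shows "\<exists>a b. g = [:[:eval2 x c g:]:] + [:[:-x:], 1:] * a + [:[:-c, 1:]:] * b"
proof -
  have "poly (g - [:poly g [:x:]:]) [:x:] = 0" by simp
  then obtain a where a: "g - [:poly g [:x:]:] = [:-[:x:], 1:] * a"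
    unfolding poly_eq_0_iff_dvd dvd_def by blast
  have "poly (poly g [:x:] - [:eval2 x c g:]) c = 0" by (simp add: eval2_def)
  then obtain b where b: "poly g [:x:] - [:eval2 x c g:] = [:-c, 1:] * b"
    unfolding poly_eq_0_iff_dvd dvd_def by blast
  have "g = [:poly g [:x:]:] + [:[:-x:], 1:] * a" using a by (simp add: algebra_simps)
  also have "[:poly g [:x:]:] = [:[:eval2 x c g:]:] + [:[:-c, 1:]:] * [:b:]"
    using b by (simp add: algebra_simps)
  also have "\<dots> + [:[:-x:], 1:] * a = [:[:eval2 x c g:]:] + [:[:-x:], 1:] * a + [:[:-c, 1:]:] * [:b:]"
    by (simp only: ac_simps)
  finally show ?thesis by blast
qed

lemma prime_in_prime_factor:
  fixes f :: "'a::{factorial_semiring, comm_ring_1}"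
  assumes Q: "prime_in UNIV Q"
  shows "f \<in> Q \<Longrightarrow> f \<noteq> 0 \<Longrightarrow> \<exists>g. prime_elem g \<and> g dvd f \<and> g \<in> Q"
proof (induction f rule: prime_divisors_induct)
  case (unit x)
  then obtain y where "1 = x * y" by (auto elim!: dvdE)
  then have "1 \<in> Q" using unit ideal_inD(5)[OF prime_inD(1)[OF Q], of y x] by simp
  then show ?case using prime_inD(2)[OF Q] by blast
next
  case (factor p x)
  then have "p \<in> Q \<or> x \<in> Q" using prime_inD(3)[OF Q] by blast
  then show ?case
  proof
    assume "p \<in> Q"
    then show ?thesis using factor(1) by (intro exI[of _ p]) (auto simp: Factorial_Ring.prime_def)
  next
    assume "x \<in> Q"
    then obtain g where "prime_elem g" "g dvd x" "g \<in> Q" using factor by auto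
    then show ?thesis by (intro exI[of _ g]) auto
  qed
qed auto

lemma prime_in_eval2: "prime_in UNIV {g. eval2 x c g = (0::'k::field)}"
  by (auto simp: prime_in_def ideal_in_def)

text \<open>\<open>e\<close> stands for an embedding of polynomials in one variable; it is
  instantiated once for the variable c and once for x. The polynomial \<open>w\<close> splits, and a
  prime ideal contains the image of one of its linear factors.\<close>

lemma prime_in_linear_factor:
  fixes e :: "'k::alg_closed_field poly \<Rightarrow> 'b::comm_ring_1"
  assumes Q: "prime_in UNIV Q"
    and mult: "\<And>a b. e (a * b) = e a * e b" and one: "e 1 = 1"
  shows "w \<noteq> 0 \<Longrightarrow> e w \<in> Q \<Longrightarrow> \<exists>z. e [:-z, 1:] \<in> Q"
proof (induction "degree w" arbitrary: w rule: less_induct)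
  case less
  show ?case
  proof (cases "degree w = 0")
    case True
    then obtain a where a: "w = [:a:]" by (auto elim: degree_eq_zeroE)
    then have "[:inverse a:] * w = 1" using less by (simp add: one_pCons)
    then have "e [:inverse a:] * e w = 1" using mult one by metis
    then have "1 \<in> Q" using less ideal_inD(4)[OF prime_inD(1)[OF Q], of "e [:inverse a:]" "e w"] by simp
    then show ?thesis using prime_inD(2)[OF Q] by blast
  next
    case False
    then obtain z where "poly w z = 0" using alg_closed_imp_poly_has_root by blast
    then obtain w' where w': "w = [:-z, 1:] * w'" by (auto simp: poly_eq_0_iff_dvd elim!: dvdE)
    then have "w' \<noteq> 0" using less by auto
    then have "degree w' < degree w" using w' by (simp add: degree_mult_eq del: mult_pCons_left)
    moreover have "e [:-z, 1:] * e w' \<in> Q" using less.prems(2) w' mult by metis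
    then have "e [:-z, 1:] \<in> Q \<or> e w' \<in> Q" using prime_inD(3)[OF Q] by blast
    ultimately show ?thesis using less.hyps \<open>w' \<noteq> 0\<close> by blast
  qed
qed

subsection \<open>Plane curves that are monic in the first coordinate\<close>

locale monic_curve =
  fixes F :: "'k::{alg_closed_field, field_gcd} poly poly"
  assumes F_monic: "lead_coeff F = 1" and F_degree: "degree F > 0"
begin

abbreviation I :: "'k poly poly set" where "I \<equiv> {g. F dvd g}"

lemma F_nonzero: "F \<noteq> 0"
  using F_degree by auto

lemma factor_degree:
  assumes "g dvd F" "\<not> is_unit g"
  shows "degree g > 0" "is_unit (lead_coeff g)"
proof -
  obtain h where h: "F = g * h" using assms by blast
  have "lead_coeff g * lead_coeff h = 1" using F_monic by (simp add: h lead_coeff_mult)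
  then show u: "is_unit (lead_coeff g)" by (metis dvd_triv_left)
  show "degree g > 0"
  proof (rule ccontr)
    assume "\<not> degree g > 0"
    then obtain a where "g = [:a:]" by (auto elim: degree_eq_zeroE)
    then show False using u assms by (auto simp: is_unit_const_poly_iff)
  qed
qed

text \<open>A factor of a monic polynomial has positive degree in x, so no nonzero polynomial in c
  alone vanishes on a component; in particular no component is a vertical line.\<close>

lemma factor_not_dvd_const:
  assumes "g dvd F" "\<not> is_unit g" "r \<noteq> 0"
  shows "\<not> g dvd [:r:]"
proof
  assume "g dvd [:r:]"
  then have "degree g \<le> degree [:r:]" using assms(3) by (intro dvd_imp_degree_le) auto
  then show False using factor_degree[OF assms(1,2)] by simp
qed

text \<open>The leading coefficient is a unit, so the degree stays positive after setting c = 0.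
  This supplies a point on every component.\<close>

lemma factor_has_point:
  assumes "g dvd F" "\<not> is_unit g"
  shows "\<exists>x. eval2 x 0 g = 0"
proof -
  let ?g = "map_poly (\<lambda>r. poly r 0) g"
  have "poly (lead_coeff g) 0 \<noteq> 0"
    using factor_degree(2)[OF assms] unfolding dvd_def by (metis mult_zero_left poly_1 poly_mult zero_neq_one)
  then have "coeff ?g (degree g) \<noteq> 0" by (simp add: coeff_map_poly)
  then have "degree ?g > 0" using factor_degree(1)[OF assms] le_degree by (metis gr0I le_zero_eq)
  then obtain x where "poly ?g x = 0" using alg_closed_imp_poly_has_root by blast
  moreover have "poly (map_poly (\<lambda>r. poly r 0) f) x = eval2 x 0 f" for f
    by (induction f) (simp_all add: map_poly_pCons)
  ultimately show ?thesis by metis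
qed

text \<open>The polynomial \<open>r\<close> in c splits, which puts some c - c_0 into
  \<open>Q\<close>. Modulo it \<open>F\<close> becomes a monic polynomial in x, which splits in turn
  and gives some x - x_0. These two generate a maximal ideal.\<close>

lemma prime_over_constant:
  assumes Q: "prime_in UNIV Q" "F \<in> Q" and r: "[:r:] \<in> Q" "r \<noteq> 0"
  shows "\<exists>x c. eval2 x c F = 0 \<and> Q = {g. eval2 x c g = 0}"
proof -
  note Qi = prime_inD(1)[OF Q(1)]
  obtain c where c: "[:[:-c, 1:]:] \<in> Q"
    using prime_in_linear_factor[OF Q(1), of "\<lambda>r. [:r:]" r] r by (auto simp: one_pCons)
  have "comm_ring_hom (\<lambda>a :: 'k. [:a:])" by unfold_locales (auto simp: one_pCons)
  then interpret e: map_poly_comm_ring_hom "\<lambda>a :: 'k. [:a:]"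
    by (simp add: map_poly_comm_ring_hom_def)
  let ?e = "map_poly (\<lambda>a. [:a:]) :: 'k poly \<Rightarrow> 'k poly poly"
  let ?F = "map_poly (\<lambda>r. poly r c) F"
  have "[:-c, 1:] dvd coeff (F - ?e ?F) i" for i
    using poly_eq_0_iff_dvd[of "coeff F i - [:poly (coeff F i) c:]" c] by (simp add: coeff_map_poly)
  then have "[:[:-c, 1:]:] dvd F - ?e ?F" by (simp add: const_poly_dvd_iff)
  then obtain h where h: "F - ?e ?F = [:[:-c, 1:]:] * h" by (auto elim!: dvdE)
  have "?e ?F = F + (- h) * [:[:-c, 1:]:]" using h by (simp add: algebra_simps)
  moreover have "F + (- h) * [:[:-c, 1:]:] \<in> Q"
    using Q(2) c ideal_inD(3,4)[OF Qi] by blast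
  ultimately have eQ: "?e ?F \<in> Q" by simp
  have "coeff ?F (degree F) = 1" using F_monic by (simp add: coeff_map_poly)
  then have F0: "?F \<noteq> 0" by (metis coeff_0 zero_neq_one)
  obtain x where x: "?e [:-x, 1:] \<in> Q"
    using prime_in_linear_factor[OF Q(1) e.hom_mult e.hom_one F0 eQ] by blast
  then have x': "[:[:-x:], 1:] \<in> Q" by (simp add: map_poly_pCons flip: one_pCons)
  have sub: "g - [:[:eval2 x c g:]:] \<in> Q" for g
  proof -
    define e where "e = eval2 x c g"
    obtain a b where "g = [:[:e:]:] + [:[:-x:], 1:] * a + [:[:-c, 1:]:] * b"
      unfolding e_def using maximal_ideal_generators by blast
    then have "g - [:[:e:]:] = [:[:-x:], 1:] * a + [:[:-c, 1:]:] * b"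
      by (simp only: add.assoc add_diff_cancel_left')
    moreover have "[:[:-x:], 1:] * a + [:[:-c, 1:]:] * b \<in> Q"
      using x' c ideal_inD(3,5)[OF Qi] by blast
    ultimately show ?thesis by (simp only: e_def)
  qed
  have "g \<in> Q \<longleftrightarrow> eval2 x c g = 0" for g
  proof
    assume "g \<in> Q"
    then have "g + (- 1) * (g - [:[:eval2 x c g:]:]) \<in> Q"
      using sub[of g] ideal_inD(3,4)[OF Qi] by blast
    then have k: "[:[:eval2 x c g:]:] \<in> Q" by simp
    show "eval2 x c g = 0"
    proof (rule ccontr)
      assume "eval2 x c g \<noteq> 0"
      then have "[:[:inverse (eval2 x c g):]:] * [:[:eval2 x c g:]:] = 1" by (simp flip: one_pCons)
      then show False
        using prime_inD(2)[OF Q(1)] ideal_inD(4)[OF Qi UNIV_I k, of "[:[:inverse (eval2 x c g):]:]"] by simp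
    qed
  next
    assume "eval2 x c g = 0"
    then show "g \<in> Q" using sub[of g] by simp
  qed
  then show ?thesis using Q(2) by blast
qed

text \<open>Modulo \<open>F\<close> each element is algebraic over K[c]. Take a relation for an
  element \<open>a\<close> of \<open>q1\<close> outside \<open>q0\<close>: factors \<open>a\<close>
  are cancelled modulo \<open>q0\<close> until the constant term is nonzero, and this term then lies
  in \<open>q1\<close>. This bounds the dimension by one.\<close>

lemma larger_prime_meets_constants:
  assumes sub: "subring_ideal D I" and const: "\<And>r. [:r:] \<in> D"
    and q0: "prime_in D q0" "I \<subseteq> q0" and q1: "prime_in D q1" "q0 \<subset> q1"
  shows "\<exists>r. r \<noteq> 0 \<and> [:r:] \<in> q1"
proof -
  interpret subring_ideal D I by (rule sub)
  obtain a where a: "a \<in> q1" "a \<notin> q0" using q1 by blast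
  have aD: "a \<in> D" using a(1) ideal_inD(1)[OF prime_inD(1)[OF q1(1)]] by blast
  have powD: "a ^ i \<in> D" for i using aD by (induction i) auto
  have sumD: "(\<Sum>i\<le>N. [:r i:] * a ^ i) \<in> D" for r and N :: nat
    by (rule sum_D) (use const powD D_mult in blast)
  have *: "\<exists>s. s \<noteq> 0 \<and> [:s:] \<in> q1"
    if "\<exists>i\<le>N. r i \<noteq> 0" "(\<Sum>i\<le>N. [:r i:] * a ^ i) \<in> q0" for N :: nat and r
    using that
  proof (induction N arbitrary: r)
    case 0
    then show ?case using q1 by auto
  next
    case (Suc N)
    let ?t = "\<Sum>i\<le>N. [:r (Suc i):] * a ^ i"
    have eq: "(\<Sum>i\<le>Suc N. [:r i:] * a ^ i) = [:r 0:] + a * ?t"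
      by (simp only: sum.atMost_Suc_shift sum_distrib_left) (simp add: algebra_simps)
    show ?case
    proof (cases "r 0 = 0")
      case False
      have "a * ?t \<in> q1" by (rule ideal_inD(5)[OF prime_inD(1)[OF q1(1)] sumD a(1)])
      moreover have "[:r 0:] + a * ?t \<in> q1" using Suc.prems eq q1 by auto
      ultimately have "[:r 0:] + a * ?t - a * ?t \<in> q1"
        using ideal_in_diff[OF prime_inD(1)[OF q1(1)]] by blast
      then show ?thesis using False by auto
    next
      case True
      then have "a * ?t \<in> q0" using Suc.prems eq by simp
      then have "a \<in> q0 \<or> ?t \<in> q0" by (rule prime_inD(3)[OF q0(1) aD sumD])
      then have "?t \<in> q0" using a(2) by blast
      moreover have "\<exists>i\<le>N. r (Suc i) \<noteq> 0"
        using Suc.prems(1) True by (metis Suc_le_mono not0_implies_Suc)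
      ultimately show ?thesis using Suc.IH[of "\<lambda>i. r (Suc i)"] by blast
    qed
  qed
  have "\<forall>i. \<exists>r. F dvd a ^ i - r \<and> degree r < degree F"
    using monic_remainder[OF F_monic F_degree] by blast
  then obtain \<rho> where \<rho>: "\<And>i. F dvd a ^ i - \<rho> i" "\<And>i. degree (\<rho> i) < degree F" by metis
  \<comment> \<open>The \<open>degree F + 1\<close> remainders live in a free K[c]-module of rank
    \<open>degree F\<close>, so they are dependent.\<close>
  obtain r where r: "\<exists>i\<in>{..degree F}. r i \<noteq> 0"
    "\<forall>j\<in>{..<degree F}. (\<Sum>i\<in>{..degree F}. r i * coeff (\<rho> i) j) = 0"
    using linear_dependence[of "{..degree F}" "{..<degree F}" "\<lambda>i j. coeff (\<rho> i) j"] by auto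
  have "(\<Sum>i\<le>degree F. [:r i:] * \<rho> i) = 0"
  proof (rule poly_eqI)
    fix j
    show "coeff (\<Sum>i\<le>degree F. [:r i:] * \<rho> i) j = coeff 0 j"
    proof (cases "j < degree F")
      case True
      then show ?thesis using r(2) by (simp add: coeff_sum)
    next
      case False
      then have "coeff (\<rho> i) j = 0" for i using \<rho>(2)[of i] by (intro coeff_eq_0) linarith
      then show ?thesis by (simp add: coeff_sum)
    qed
  qed
  moreover have "F dvd (\<Sum>i\<le>degree F. [:r i:] * (a ^ i - \<rho> i))"
    by (rule dvd_sum, rule dvd_mult, rule \<rho>(1))
  ultimately have "F dvd (\<Sum>i\<le>degree F. [:r i:] * a ^ i)"
    by (simp only: right_diff_distrib sum_subtractf diff_zero)
  then have "(\<Sum>i\<le>degree F. [:r i:] * a ^ i) \<in> q0" using q0 by blast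
  then show ?thesis using *[where r = r and N = "degree F"] r(1) by blast
qed

lemma subring_UNIV: "subring_ideal UNIV I"
  by unfold_locales (auto simp: ideal_in_def)

lemma prime_in_multiples: "prime_elem g \<Longrightarrow> prime_in UNIV {a. g dvd a}"
  using prime_elem_not_unit by (auto simp: prime_in_def ideal_in_def prime_elem_dvd_mult_iff)

text \<open>A prime over \<open>F\<close> contains a prime factor of \<open>F\<close>; if it is
  strictly larger than the ideal of that factor, it meets K[c] and belongs to a point.\<close>

lemma primes_over_F:
  assumes Q: "prime_in UNIV Q" "F \<in> Q"
  shows "(\<exists>g. prime_elem g \<and> g dvd F \<and> Q = {a. g dvd a}) \<or>
    (\<exists>x c. eval2 x c F = 0 \<and> Q = {g. eval2 x c g = 0})"
proof -
  note Qi = prime_inD(1)[OF Q(1)]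
  obtain g where g: "prime_elem g" "g dvd F" "g \<in> Q"
    using prime_in_prime_factor[OF Q(1) Q(2) F_nonzero] by blast
  have sub: "{a. g dvd a} \<subseteq> Q" using g(3) ideal_inD(5)[OF Qi] by (auto elim!: dvdE)
  show ?thesis
  proof (cases "Q = {a. g dvd a}")
    case True
    then show ?thesis using g by blast
  next
    case False
    have "I \<subseteq> {a. g dvd a}" using g by auto
    then obtain r where "r \<noteq> 0" "[:r:] \<in> Q"
      using larger_prime_meets_constants[OF subring_UNIV _ prime_in_multiples[OF g(1)] _ Q(1)] False sub by blast
    then show ?thesis using prime_over_constant[OF Q] by blast
  qed
qed

lemma point_prime_factor:
  assumes "eval2 x c F = 0"
  shows "\<exists>g. prime_elem g \<and> g dvd F \<and> eval2 x c g = 0"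
  using prime_in_prime_factor[OF prime_in_eval2, of F x c] assms F_nonzero by blast

end

lemma ideal_set_iff: "ideal_set J \<longleftrightarrow> ideal_in UNIV J"
  by (auto simp: ideal_in_def self_module.subspace_def)

lemma pcompose_diff_dvd: "a - b dvd pcompose g a - pcompose g (b :: 'a::comm_ring_1 poly)"
proof (induction g)
  case (pCons r g)
  have "pcompose (pCons r g) a - pcompose (pCons r g) b =
      (a - b) * pcompose g a + b * (pcompose g a - pcompose g b)"
    by (simp add: pcompose_pCons algebra_simps)
  then show ?case using pCons by simp
qed simp

section \<open>Regularity at a point of the curve\<close>

context monic_curve
begin

text \<open>The criterion of \<open>regular_one_iff\<close> for the ideal of a point in E/(F), where
  \<open>E\<close> is the full polynomial ring or the ring of invariants.\<close>

definition regular_at :: "'k poly poly set \<Rightarrow> 'k \<Rightarrow> 'k \<Rightarrow> bool" where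
  "regular_at E x c \<longleftrightarrow> (\<exists>\<pi>\<in>E. eval2 x c \<pi> = 0 \<and>
     (\<forall>a\<in>E. eval2 x c a = 0 \<longrightarrow> (\<exists>u\<in>E. \<exists>r\<in>E. eval2 x c u \<noteq> 0 \<and> F dvd u * a - r * \<pi>)))"

text \<open>x - x_0 and \<open>\<psi>\<close> generate the maximal ideal. Since \<open>w\<close> is
  a local unit, the equation of the curve expresses x - x_0 as a multiple of \<open>\<psi>\<close>,
  which is therefore a uniformiser.\<close>

lemma regular_at_transversal:
  assumes "eval2 x c \<psi> = 0" "eval2 x c w \<noteq> 0" "F = [:[:-x:], 1:] * w + \<psi> * z"
    and gen: "\<And>g. eval2 x c g = 0 \<Longrightarrow> \<exists>a b. g = [:[:-x:], 1:] * a + \<psi> * b"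
  shows "regular_at UNIV x c"
  unfolding regular_at_def
proof (rule bexI[of _ \<psi>], intro conjI ballI impI)
  fix g assume "eval2 x c g = 0"
  then obtain a b where g: "g = [:[:-x:], 1:] * a + \<psi> * b" using gen by blast
  define y where "y = [:[:-x:], 1:]"
  have "w * g - (w * b - a * z) * \<psi> = a * F"
    unfolding g assms(3) y_def[symmetric] by (simp add: algebra_simps)
  then have "F dvd w * g - (w * b - a * z) * \<psi>" by simp
  then show "\<exists>u\<in>UNIV. \<exists>r\<in>UNIV. eval2 x c u \<noteq> 0 \<and> F dvd u * g - r * \<psi>" using assms(2) by blast
qed (use assms in auto)

text \<open>A regular point lies on a single component, with multiplicity one. Write
  \<open>u * g\<close> as \<open>r * \<pi>\<close> modulo \<open>F\<close>; since \<open>g\<close>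
  does not divide \<open>\<pi>\<close>, it divides \<open>r\<close> and can be cancelled, and
  evaluating what remains shows that the cofactor \<open>F2\<close> is nonzero at the point.\<close>

lemma regular_at_factor:
  assumes V: "eval2 x c F = 0" and p: "eval2 x c \<pi> = 0"
    and gen: "\<And>a. eval2 x c a = 0 \<Longrightarrow> \<exists>u r. eval2 x c u \<noteq> 0 \<and> F dvd u * a - r * \<pi>"
  shows "\<exists>g F2. prime_elem g \<and> F = g * F2 \<and> eval2 x c g = 0 \<and> eval2 x c F2 \<noteq> 0 \<and> \<not> g dvd \<pi>"
proof -
  obtain g where g: "prime_elem g" "g dvd F" "eval2 x c g = 0" using point_prime_factor[OF V] by blast
  obtain F2 where F2: "F = g * F2" using g by blast
  have g0: "g \<noteq> 0" using g by auto
  \<comment> \<open>Otherwise \<open>g\<close> would divide \<open>u\<close> times c - c_0, although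
    it divides neither factor: \<open>u\<close> is nonzero at the point, and no component is a
    vertical line.\<close>
  have nd: "\<not> g dvd \<pi>"
  proof
    assume "g dvd \<pi>"
    obtain u r where u: "eval2 x c u \<noteq> 0" "F dvd u * [:[:-c, 1:]:] - r * \<pi>"
      using gen[of "[:[:-c, 1:]:]"] by auto
    have "g dvd u * [:[:-c, 1:]:] - r * \<pi>" by (rule dvd_trans[OF g(2) u(2)])
    moreover have "g dvd r * \<pi>" using \<open>g dvd \<pi>\<close> by simp
    ultimately have "g dvd u * [:[:-c, 1:]:]" using dvd_diff_left_iff by blast
    then have "g dvd u \<or> g dvd [:[:-c, 1:]:]" by (rule prime_elem_dvd_multD[OF g(1)])
    moreover have "\<not> g dvd [:[:-c, 1:]:]"
      using factor_not_dvd_const[OF g(2) prime_elem_not_unit[OF g(1)]] by simp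
    moreover have "\<not> g dvd u" using u(1) g(3) eval2_dvd by blast
    ultimately show False by blast
  qed
  obtain u r where u: "eval2 x c u \<noteq> 0" "F dvd u * g - r * \<pi>" using gen[OF g(3)] by blast
  then obtain h where h: "u * g - r * \<pi> = g * F2 * h" unfolding F2 dvd_def by blast
  then have "r * \<pi> = g * (u - F2 * h)" by (simp add: algebra_simps)
  then have "g dvd r" using g(1) nd by (metis dvd_triv_left prime_elem_dvd_mult_iff)
  then obtain r' where r': "r = g * r'" by blast
  have "g * (u - r' * \<pi>) = g * (F2 * h)" using h by (simp add: r' algebra_simps)
  then have "u - r' * \<pi> = F2 * h" using g0 by simp
  then have "eval2 x c (u - r' * \<pi>) = eval2 x c (F2 * h)" by simp
  then have "eval2 x c F2 \<noteq> 0" using u(1) p by auto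
  then show ?thesis using g F2 nd by blast
qed

end

section \<open>Cyclic actions by substitution, and averaging\<close>

text \<open>Substituting \<open>\<phi>\<close> for x is an endomorphism of the polynomial ring that
  becomes an action of order dividing \<open>n\<close> only modulo \<open>F\<close>; hence the facts
  below are divisibilities by \<open>F\<close>. The field is arbitrary because the action is
  considered both before and after base change.\<close>

locale poly_action =
  fixes F :: "'k::field poly poly" and \<phi> :: "'k poly poly" and n :: nat
  assumes F_action: "F dvd pcompose F \<phi>"
    and n_pos: "n > 0" and n_unit: "of_nat n \<noteq> (0 :: 'k)"
    and action_order: "F dvd ((\<lambda>g. pcompose g \<phi>) ^^ n) [:0, 1:] - [:0, 1:]"
begin

definition \<sigma> :: "'k poly poly \<Rightarrow> 'k poly poly" where "\<sigma> g = pcompose g \<phi>"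

lemma \<sigma>_simps [simp]:
  "\<sigma> (a + b) = \<sigma> a + \<sigma> b" "\<sigma> (a - b) = \<sigma> a - \<sigma> b" "\<sigma> (- a) = - \<sigma> a" "\<sigma> (a * b) = \<sigma> a * \<sigma> b"
  "\<sigma> [:r:] = [:r:]" "\<sigma> 0 = 0" "\<sigma> 1 = 1"
  by (simp_all add: \<sigma>_def pcompose_add pcompose_diff pcompose_uminus pcompose_mult pcompose_1)

lemma \<sigma>_sum: "\<sigma> (sum f A) = (\<Sum>i\<in>A. \<sigma> (f i))"
  by (induction A rule: infinite_finite_induct) auto

lemma \<sigma>_pow_simps [simp]:
  "(\<sigma> ^^ i) (a + b) = (\<sigma> ^^ i) a + (\<sigma> ^^ i) b" "(\<sigma> ^^ i) (a - b) = (\<sigma> ^^ i) a - (\<sigma> ^^ i) b"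
  "(\<sigma> ^^ i) (a * b) = (\<sigma> ^^ i) a * (\<sigma> ^^ i) b"
  "(\<sigma> ^^ i) [:r:] = [:r:]" "(\<sigma> ^^ i) 0 = 0" "(\<sigma> ^^ i) 1 = 1"
  by (induction i) auto

definition iterate :: "nat \<Rightarrow> 'k poly poly" where "iterate i = (\<sigma> ^^ i) [:0, 1:]"

lemma \<sigma>_pow: "(\<sigma> ^^ i) g = pcompose g (iterate i)"
proof (induction i)
  case 0
  show ?case by (simp add: iterate_def pcompose_idR)
next
  case (Suc i)
  have "(\<sigma> ^^ Suc i) g = \<sigma> ((\<sigma> ^^ i) g)" by simp
  also have "\<dots> = pcompose (pcompose g (iterate i)) \<phi>" by (simp only: Suc) (simp only: \<sigma>_def)
  also have "\<dots> = pcompose g (pcompose (iterate i) \<phi>)" by (simp add: pcompose_assoc)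
  also have "pcompose (iterate i) \<phi> = iterate (Suc i)" by (simp add: iterate_def \<sigma>_def)
  finally show ?case .
qed

lemma \<sigma>_order: "F dvd (\<sigma> ^^ n) g - g"
proof -
  have "iterate n - [:0, 1:] dvd (\<sigma> ^^ n) g - g"
    using pcompose_diff_dvd[of "iterate n" "[:0, 1:]" g] by (simp add: \<sigma>_pow pcompose_idR)
  moreover have "F dvd iterate n - [:0, 1:]"
    using action_order by (simp add: iterate_def \<sigma>_def[abs_def])
  ultimately show ?thesis by (rule dvd_trans[rotated])
qed

lemma \<sigma>_dvd: "F dvd g \<Longrightarrow> F dvd \<sigma> g"
  using F_action by (auto elim!: dvdE simp: \<sigma>_def pcompose_mult)

lemma \<sigma>_pow_dvd: "F dvd g \<Longrightarrow> F dvd (\<sigma> ^^ i) g"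
  by (induction i) (auto simp: \<sigma>_dvd)

text \<open>The preimage of the invariants of the quotient by \<open>F\<close>: its elements are
  invariant only modulo \<open>F\<close>.\<close>

definition D :: "'k poly poly set" where "D = {g. F dvd \<sigma> g - g}"

lemma D_iff: "g \<in> D \<longleftrightarrow> F dvd \<sigma> g - g"
  by (simp add: D_def)

lemma subring_D: "subring_ideal D {g. F dvd g}"
proof
  show "a + b \<in> D" "a * b \<in> D" if "a \<in> D" "b \<in> D" for a b
  proof -
    have "\<sigma> (a + b) - (a + b) = (\<sigma> a - a) + (\<sigma> b - b)"
      "\<sigma> (a * b) - a * b = (\<sigma> a - a) * \<sigma> b + a * (\<sigma> b - b)"
      by (simp_all add: algebra_simps)
    then show "a + b \<in> D" "a * b \<in> D" using that unfolding D_iff by (metis dvd_add dvd_mult dvd_mult2)+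
  qed
  show "- a \<in> D" if "a \<in> D" for a
  proof -
    have "\<sigma> (- a) - (- a) = - (\<sigma> a - a)" by simp
    then show ?thesis using that unfolding D_iff by (metis dvd_minus_iff)
  qed
  have "{g. F dvd g} \<subseteq> D" using \<sigma>_dvd dvd_diff unfolding D_def by blast
  then show "ideal_in D {g. F dvd g}" by (simp add: ideal_in_def)
qed (simp add: D_iff)

sublocale D: subring_ideal D "{g. F dvd g}" by (rule subring_D)

lemma const_D: "[:r:] \<in> D"
  by (simp add: D_iff)

lemma D_pow: "g \<in> D \<Longrightarrow> F dvd (\<sigma> ^^ i) g - g"
proof (induction i)
  case (Suc i)
  have "(\<sigma> ^^ Suc i) g - g = \<sigma> ((\<sigma> ^^ i) g - g) + (\<sigma> g - g)" by simp
  then show ?case using Suc \<sigma>_dvd unfolding D_iff by (metis dvd_add)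
qed simp

definition tr :: "'k poly poly \<Rightarrow> 'k poly poly" where "tr g = (\<Sum>i<n. (\<sigma> ^^ i) g)"

text \<open>The Reynolds operator; modulo \<open>F\<close> it is a \<open>D\<close>-linear
  projection onto \<open>D\<close>.\<close>

definition rey :: "'k poly poly \<Rightarrow> 'k poly poly" where
  "rey g = [:[:inverse (of_nat n):]:] * tr g"

text \<open>Applying \<open>\<sigma>\<close> shifts the sum by one index, so the difference
  telescopes to \<open>(\<sigma> ^^ n) g - g\<close>.\<close>

lemma tr_D: "tr g \<in> D"
proof -
  have "\<sigma> (tr g) - tr g = (\<Sum>i<n. (\<sigma> ^^ Suc i) g - (\<sigma> ^^ i) g)"
    by (simp add: tr_def \<sigma>_sum sum_subtractf)
  also have "\<dots> = (\<sigma> ^^ n) g - g"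
    by (subst sum_lessThan_telescope) simp
  finally show ?thesis using \<sigma>_order by (simp add: D_iff)
qed

lemma tr_mult: "d \<in> D \<Longrightarrow> F dvd tr (d * g) - d * tr g"
proof -
  assume d: "d \<in> D"
  have "tr (d * g) - d * tr g = (\<Sum>i<n. ((\<sigma> ^^ i) d - d) * (\<sigma> ^^ i) g)"
    by (simp add: tr_def sum_distrib_left sum_subtractf left_diff_distrib)
  also have "F dvd \<dots>" by (rule dvd_sum, rule dvd_mult2, rule D_pow[OF d])
  finally show ?thesis .
qed

lemma rey_D: "rey g \<in> D"
  unfolding rey_def using const_D tr_D by (rule D.D_mult)

lemma rey_mult:
  assumes "d \<in> D" shows "F dvd rey (d * g) - d * rey g"
proof -
  have "rey (d * g) - d * rey g = [:[:inverse (of_nat n):]:] * (tr (d * g) - d * tr g)"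
    by (simp only: rey_def right_diff_distrib mult.left_commute)
  then show ?thesis using tr_mult[OF assms] by (metis dvd_mult)
qed

lemma rey_one: "rey 1 = 1"
proof -
  have "tr 1 = [:[:of_nat n:]:]" by (simp add: tr_def of_nat_poly)
  then have "rey 1 = [:[:inverse (of_nat n) * of_nat n:]:]" by (simp add: rey_def)
  then show ?thesis using n_unit by (simp flip: one_pCons)
qed

lemma rey_fix: "d \<in> D \<Longrightarrow> F dvd rey d - d"
  using rey_mult[of d 1] by (simp add: rey_one)

lemma rey_add: "rey (a + b) = rey a + rey b"
  by (simp only: rey_def tr_def \<sigma>_pow_simps sum.distrib distrib_left)

lemma rey_dvd: "F dvd g \<Longrightarrow> F dvd rey g"
  unfolding rey_def tr_def by (intro dvd_mult dvd_sum \<sigma>_pow_dvd)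

lemma rey_zero: "rey 0 = 0"
  by (simp add: rey_def tr_def)

end

section \<open>Finiteness and lying over for the ring of invariants\<close>

locale curve_action = monic_curve F + poly_action F \<phi> n
  for F :: "'k::{alg_closed_field, field_gcd} poly poly" and \<phi> :: "'k poly poly" and n :: nat
begin

text \<open>Averaging a multiple of an invariant averages only the coefficient. So averaging takes
  the ideal generated upstairs by elements of \<open>J\<close> back into \<open>J\<close>.\<close>

lemma rey_span:
  assumes J: "ideal_in D J" "I \<subseteq> J" and G: "G \<subseteq> J" and x: "x \<in> ideal_gen G"
  shows "rey x \<in> J"
  using x
proof (induction rule: self_module.span_induct_alt)
  case base
  show ?case using ideal_inD(2)[OF J(1)] by (simp add: rey_zero)
next
  case (step r g y)
  have g: "g \<in> J" "g \<in> D" using step G ideal_inD(1)[OF J(1)] by auto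
  have "rey (r * g) - g * rey r \<in> J" using rey_mult[OF g(2), of r] J(2) by (auto simp: mult.commute)
  moreover have "g * rey r \<in> J" by (rule ideal_inD(5)[OF J(1) rey_D g(1)])
  ultimately have "(rey (r * g) - g * rey r) + g * rey r \<in> J" by (rule ideal_inD(3)[OF J(1)])
  then have "rey (r * g) \<in> J" by simp
  then show ?case using step(2) ideal_inD(3)[OF J(1)] by (simp only: rey_add)
qed

lemma rey_mem:
  assumes J: "ideal_in D J" "I \<subseteq> J" and a: "a \<in> D"
  shows "rey a \<in> J \<longleftrightarrow> a \<in> J"
proof -
  have d: "rey a - a \<in> J" using rey_fix[OF a] J by blast
  show ?thesis
    using D.ideal_in_diff[OF J(1) _ d, of "rey a"] ideal_inD(3)[OF J(1) d, of a] by auto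
qed

text \<open>Hilbert's finiteness argument: the extension of \<open>J\<close> to all polynomials is
  finitely generated by elements of \<open>J\<close>, and averaging an expression in these
  generators makes its coefficients invariant.\<close>

lemma noetherian_D: "noetherian_over D I"
  unfolding noetherian_over_def
proof (intro allI impI)
  fix J assume "ideal_in D J \<and> I \<subseteq> J"
  then have J: "ideal_in D J" "I \<subseteq> J" by auto
  have "noetherian_type TYPE('k poly poly)" by (intro noetherian_poly noetherian_field)
  then obtain H where H: "finite H" "H \<subseteq> ideal_gen J" "ideal_gen J \<subseteq> ideal_gen H"
    unfolding noetherian_type_def using self_module.subspace_span by metis
  \<comment> \<open>The generators \<open>H\<close> of the extended ideal need not lie in
    \<open>J\<close>; each is replaced by finitely many elements of \<open>J\<close> of which it is
    a combination.\<close>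
  have "\<forall>f\<in>H. \<exists>t. finite t \<and> t \<subseteq> J \<and> f \<in> ideal_gen t"
  proof
    fix f assume "f \<in> H"
    then have "f \<in> ideal_gen J" using H by blast
    then obtain t r where t: "finite t" "t \<subseteq> J" "f = (\<Sum>a\<in>t. r a * a)"
      unfolding self_module.span_explicit by blast
    have "(\<Sum>a\<in>t. r a * a) \<in> ideal_gen t"
      by (rule self_module.span_sum, rule self_module.span_scale, rule self_module.span_base)
    then have "f \<in> ideal_gen t" using t by simp
    then show "\<exists>t. finite t \<and> t \<subseteq> J \<and> f \<in> ideal_gen t" using t by blast
  qed
  then obtain t where t: "\<And>f. f \<in> H \<Longrightarrow> finite (t f) \<and> t f \<subseteq> J \<and> f \<in> ideal_gen (t f)" by metis
  define G where "G = (\<Union>f\<in>H. t f)"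
  have G: "finite G" "G \<subseteq> J" using H t by (auto simp: G_def)
  have "f \<in> ideal_gen G" if "f \<in> H" for f
    using t[OF that] self_module.span_mono[of "t f" G] that by (auto simp: G_def)
  then have JG: "J \<subseteq> ideal_gen G"
    using H(3) self_module.span_superset[of J] self_module.span_minimal[OF _ self_module.subspace_span, of H G]
    by blast
  have "J \<subseteq> J'" if J': "ideal_in D J'" "I \<subseteq> J'" "G \<subseteq> J'" for J'
  proof
    fix a assume a: "a \<in> J"
    then have "rey a \<in> J'" using rey_span[OF J'] JG by blast
    then show "a \<in> J'" using rey_mem[OF J'(1,2)] a ideal_inD(1)[OF J(1)] by blast
  qed
  then show "\<exists>F. finite F \<and> F \<subseteq> J \<and> (\<forall>J'. ideal_in D J' \<and> I \<subseteq> J' \<and> F \<subseteq> J' \<longrightarrow> J \<subseteq> J')"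
    using G by (intro exI[of _ G]) simp
qed

text \<open>\<open>Q\<close> is maximal among the ideals that contain \<open>q\<close> and meet
  \<open>D\<close> inside \<open>q\<close>; by averaging, the extension of \<open>q\<close> is one
  of them. For \<open>a\<close> and \<open>b\<close> outside \<open>Q\<close>, maximality gives
  elements \<open>s\<close>, \<open>t\<close> of \<open>D\<close> outside \<open>q\<close> that are
  multiples of \<open>a\<close> and \<open>b\<close> modulo \<open>Q\<close>, so
  \<open>a * b\<close> in \<open>Q\<close> would force \<open>s * t\<close> into
  \<open>q\<close>.\<close>

lemma lying_over:
  assumes q: "prime_in D q" "I \<subseteq> q"
  shows "\<exists>Q. prime_in UNIV Q \<and> F \<in> Q \<and> Q \<inter> D = q"
proof -
  note qi = prime_inD(1)[OF q(1)]
  define Z where "Z = {J. ideal_set J \<and> q \<subseteq> J \<and> J \<inter> D \<subseteq> q}"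
  have "ideal_gen q \<in> Z"
    using rey_span[OF qi q(2) subset_refl] rey_mem[OF qi q(2)] self_module.span_superset
    by (auto simp: Z_def)
  then have ne: "Z \<noteq> {}" by blast
  have "\<Union>C \<in> Z" if C: "C \<noteq> {}" "subset.chain Z C" for C
  proof -
    have CZ: "J \<in> C \<Longrightarrow> J \<in> Z" for J using C(2) by (auto simp: subset.chain_def)
    have "ideal_set (\<Union>C)"
    proof (rule self_module.subspaceI)
      show "0 \<in> \<Union>C" using C(1) CZ self_module.subspace_0 unfolding Z_def by blast
      show "x + y \<in> \<Union>C" if xy: "x \<in> \<Union>C" "y \<in> \<Union>C" for x y
      proof -
        obtain J1 J2 where *: "J1 \<in> C" "x \<in> J1" "J2 \<in> C" "y \<in> J2" using xy by blast
        then have "J1 \<subseteq> J2 \<or> J2 \<subseteq> J1" using C(2) by (simp add: subset_chain_def)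
        then obtain J where "J \<in> C" "x \<in> J" "y \<in> J" using * by blast
        then show ?thesis using CZ self_module.subspace_add unfolding Z_def by blast
      qed
      show "r * x \<in> \<Union>C" if "x \<in> \<Union>C" for r x
        using that CZ self_module.subspace_scale unfolding Z_def by blast
    qed
    then show ?thesis using C(1) CZ unfolding Z_def by blast
  qed
  then obtain Q where Q: "Q \<in> Z" "\<And>J. J \<in> Z \<Longrightarrow> Q \<subseteq> J \<Longrightarrow> J = Q"
    using subset_Zorn_nonempty[OF ne] by blast
  have Qs: "ideal_set Q" "q \<subseteq> Q" "Q \<inter> D \<subseteq> q" using Q(1) by (auto simp: Z_def)
  have Qi: "ideal_in UNIV Q" using Qs(1) by (simp add: ideal_set_iff)
  have QD: "Q \<inter> D = q" using Qs ideal_inD(1)[OF qi] by blast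
  have meet: "\<exists>s k. s \<in> D \<and> s \<notin> q \<and> s - k * a \<in> Q" if "a \<notin> Q" for a
  proof -
    have "ideal_gen (insert a Q) \<notin> Z"
      using Q(2)[of "ideal_gen (insert a Q)"] self_module.span_superset[of "insert a Q"] that by blast
    then obtain s where "s \<in> D" "s \<notin> q" "s \<in> ideal_gen (insert a Q)"
      using self_module.subspace_span[of "insert a Q"] self_module.span_superset[of "insert a Q"] Qs(2)
      unfolding Z_def by blast
    moreover then obtain k where "s - k * a \<in> ideal_gen Q" using self_module.span_breakdown_eq by blast
    moreover have "ideal_gen Q = Q" using Qs(1) self_module.span_eq_iff by blast
    ultimately show ?thesis by blast
  qed
  have "prime_in UNIV Q"
    unfolding prime_in_def
  proof (intro conjI ballI impI Qi)
    show "1 \<notin> Q" using QD prime_inD(2)[OF q(1)] D.D_one by blast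
    fix a b assume ab: "a * b \<in> Q"
    show "a \<in> Q \<or> b \<in> Q"
    proof (rule ccontr)
      assume "\<not> (a \<in> Q \<or> b \<in> Q)"
      then obtain s k t l where s: "s \<in> D" "s \<notin> q" "s - k * a \<in> Q" "t \<in> D" "t \<notin> q" "t - l * b \<in> Q"
        using meet by metis
      have "t * (s - k * a) + k * a * (t - l * b) + k * l * (a * b) \<in> Q"
        by (rule ideal_inD(3)[OF Qi ideal_inD(3)[OF Qi]]; rule ideal_inD(4)[OF Qi UNIV_I]; fact)
      moreover have "t * (s - k * a) + k * a * (t - l * b) + k * l * (a * b) = s * t"
        by (simp add: algebra_simps)
      ultimately have "s * t \<in> q" using QD s D.D_mult by auto
      then show False using prime_inD(3)[OF q(1)] s by blast
    qed
  qed
  moreover have "F \<in> Q" using subsetD[OF q(2), of F] Qs(2) by auto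
  ultimately show ?thesis using QD by blast
qed

lemma prime_restrict: "prime_in UNIV Q \<Longrightarrow> prime_in D (Q \<inter> D)"
  by (auto simp: prime_in_def ideal_in_def)

lemma dvd_in_prime: "ideal_in UNIV Q \<Longrightarrow> F \<in> Q \<Longrightarrow> I \<subseteq> Q"
  using ideal_inD(5)[of UNIV Q _ F] by (auto elim!: dvdE)

subsection \<open>Orbits of points\<close>

definition orb :: "'k \<Rightarrow> 'k \<Rightarrow> nat \<Rightarrow> 'k" where "orb x c i = eval2 x c (iterate i)"

lemma eval2_\<sigma>_pow: "eval2 x c ((\<sigma> ^^ i) g) = eval2 (orb x c i) c g"
  by (simp add: \<sigma>_pow eval2_pcompose orb_def)

lemma orb_0 [simp]: "orb x c 0 = x"
  by (simp add: orb_def iterate_def)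

lemma orb_eq: "orb x c i = ((\<lambda>x. eval2 x c \<phi>) ^^ i) x"
proof (induction i)
  case (Suc i)
  have "orb x c (Suc i) = eval2 x c ((\<sigma> ^^ i) (\<sigma> [:0, 1:]))"
    by (simp add: orb_def iterate_def funpow_swap1)
  also have "\<dots> = eval2 (orb x c i) c \<phi>" by (simp only: eval2_\<sigma>_pow) (simp add: \<sigma>_def pcompose_pCons)
  finally show ?case using Suc by simp
qed simp

lemma orb_n: "eval2 x c F = 0 \<Longrightarrow> orb x c n = x"
  using eval2_dvd[OF \<sigma>_order[of "[:0, 1:]"], of x c] by (simp add: orb_def iterate_def)

text \<open>The point is fixed by the action, or its orbit does not return before time
  \<open>n\<close>. These are the two situations in which an invariant nonzero at the point can be
  produced by a trace.\<close>

definition separated :: "'k \<Rightarrow> 'k \<Rightarrow> bool" where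
  "separated x c \<longleftrightarrow> (\<forall>i<n. orb x c i = x) \<or> (\<forall>i. 0 < i \<and> i < n \<longrightarrow> orb x c i \<noteq> x)"

lemma separator:
  assumes "\<forall>i. 0 < i \<and> i < n \<longrightarrow> orb x c i \<noteq> x"
  shows "\<exists>e. eval2 x c e \<noteq> 0 \<and> (\<forall>i. 0 < i \<and> i < n \<longrightarrow> eval2 x c ((\<sigma> ^^ i) e) = 0)"
proof (intro exI conjI allI impI)
  let ?e = "\<Prod>i\<in>{1..<n}. [:[:- orb x c i:], 1:]"
  have "orb x c i \<noteq> x" if "i \<in> {1..<n}" for i using assms that by simp
  then show "eval2 x c ?e \<noteq> 0" by fastforce
  show "eval2 x c ((\<sigma> ^^ i) ?e) = 0" if "0 < i \<and> i < n" for i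
    using that by (auto simp: eval2_\<sigma>_pow)
qed

lemma tr_split: "tr g = g + (\<Sum>i\<in>{1..<n}. (\<sigma> ^^ i) g)"
proof -
  have "{..<n} = insert 0 {1..<n}" using n_pos by auto
  then show ?thesis by (simp add: tr_def)
qed

text \<open>At a fixed point the trace of \<open>s\<close> takes the value of \<open>s\<close>
  multiplied by \<open>n\<close>, which is nonzero in the field. On a free orbit \<open>s\<close> is
  first multiplied by a function vanishing on the rest of the orbit, so that only one term of the
  trace survives. Stability of \<open>J\<close> keeps the trace inside \<open>J\<close>.\<close>

lemma invariant_nonvanishing:
  assumes sep: "separated x c" and J: "ideal_in UNIV J" "\<And>g. g \<in> J \<Longrightarrow> \<sigma> g \<in> J"
    and s: "s \<in> J" "eval2 x c s \<noteq> 0"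
  shows "\<exists>t\<in>J \<inter> D. eval2 x c t \<noteq> 0"
proof -
  have powJ: "g \<in> J \<Longrightarrow> (\<sigma> ^^ i) g \<in> J" for g i using J(2) by (induction i) auto
  interpret J: subring_ideal UNIV J by unfold_locales (use J in auto)
  have trJ: "tr g \<in> J" if "g \<in> J" for g
  proof -
    have "(\<Sum>i\<in>A. (\<sigma> ^^ i) g) \<in> J" for A
      by (induction A rule: infinite_finite_induct) (use powJ[OF that] ideal_inD[OF J(1)] in auto)
    then show ?thesis by (simp add: tr_def)
  qed
  from sep show ?thesis unfolding separated_def
  proof
    assume "\<forall>i<n. orb x c i = x"
    then have "eval2 x c (tr s) = of_nat n * eval2 x c s"
      by (simp add: tr_def eval2_\<sigma>_pow)
    then show ?thesis using trJ[OF s(1)] tr_D s(2) n_unit by (intro bexI[of _ "tr s"]) auto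
  next
    assume *: "\<forall>i. 0 < i \<and> i < n \<longrightarrow> orb x c i \<noteq> x"
    obtain e where e: "eval2 x c e \<noteq> 0" "\<And>i. 0 < i \<and> i < n \<Longrightarrow> eval2 x c ((\<sigma> ^^ i) e) = 0"
      using separator[OF *] by blast
    have "eval2 x c (tr (s * e)) = eval2 x c s * eval2 x c e"
      using e(2) by (simp add: tr_split)
    moreover have "s * e \<in> J" using ideal_inD(5)[OF J(1)] s(1) by simp
    ultimately show ?thesis using trJ tr_D s(2) e(1) by (intro bexI[of _ "tr (s * e)"]) auto
  qed
qed

end

section \<open>Transfer of regularity between a curve and its quotient\<close>

context curve_action
begin

text \<open>On the line c = c_0 the polynomial \<open>F\<close> is a power of x - x_0 times a factor
  \<open>w0\<close> that is nonzero at x_0, and \<open>p\<close> is divisible by x - x_0 there. So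
  \<open>w0\<close> times that power of \<open>p\<close> is a multiple of \<open>F\<close> on the
  line: locally on the curve a power of \<open>p\<close> is a multiple of c - c_0.\<close>

lemma power_in_fiber:
  assumes V: "eval2 x c F = 0" and p: "eval2 x c p = 0"
  shows "\<exists>e w a b. eval2 x c w \<noteq> 0 \<and> w * p ^ e = F * a + [:[:-c, 1:]:] * b"
proof -
  have h1: "comm_ring_hom (\<lambda>r :: 'k poly. poly r c)" by unfold_locales auto
  have h2: "comm_ring_hom (\<lambda>a :: 'k. [:a:])" by unfold_locales (auto simp: one_pCons)
  interpret r: map_poly_comm_ring_hom "\<lambda>r :: 'k poly. poly r c"
    using h1 by (simp add: map_poly_comm_ring_hom_def)
  interpret e: map_poly_comm_ring_hom "\<lambda>a :: 'k. [:a:]"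
    using h2 by (simp add: map_poly_comm_ring_hom_def)
  define \<rho> where "\<rho> = map_poly (\<lambda>r :: 'k poly. poly r c)"
  define \<epsilon> where "\<epsilon> = map_poly (\<lambda>a :: 'k. [:a:])"
  have eval: "poly (\<rho> g) x = eval2 x c g" for g
    unfolding \<rho>_def by (induction g) (simp_all add: map_poly_pCons)
  have re: "\<rho> (\<epsilon> g) = g" for g
    unfolding \<rho>_def \<epsilon>_def by (rule poly_eqI) (simp add: coeff_map_poly)
  have "coeff (\<rho> F) (degree F) = 1" using F_monic by (simp add: \<rho>_def coeff_map_poly)
  then have "\<rho> F \<noteq> 0" by (metis coeff_0 zero_neq_one)
  then obtain w0 where w0: "\<rho> F = [:-x, 1:] ^ order x (\<rho> F) * w0" "\<not> [:-x, 1:] dvd w0"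
    using order_decomp by blast
  define k where "k = order x (\<rho> F)"
  have "poly (\<rho> p) x = 0" using p eval by simp
  then obtain p1 where p1: "\<rho> p = [:-x, 1:] * p1" unfolding poly_eq_0_iff_dvd dvd_def by blast
  have w0k: "[:-x, 1:] ^ k * w0 = \<rho> F" unfolding k_def by (rule w0(1)[symmetric])
  have "w0 * \<rho> p ^ k = ([:-x, 1:] ^ k * w0) * p1 ^ k"
    unfolding p1 power_mult_distrib by (simp only: mult_ac)
  then have "w0 * \<rho> p ^ k = \<rho> F * p1 ^ k" by (simp only: w0k)
  moreover have "\<rho> (\<epsilon> w0 * p ^ k - F * \<epsilon> (p1 ^ k)) = \<rho> (\<epsilon> w0) * \<rho> p ^ k - \<rho> F * \<rho> (\<epsilon> (p1 ^ k))"
    unfolding \<rho>_def by (simp only: r.hom_minus r.hom_mult r.hom_power)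
  ultimately have z: "\<rho> (\<epsilon> w0 * p ^ k - F * \<epsilon> (p1 ^ k)) = 0" by (simp only: re) simp
  have "[:[:-c, 1:]:] dvd \<epsilon> w0 * p ^ k - F * \<epsilon> (p1 ^ k)" (is "_ dvd ?g")
  proof -
    have "poly (coeff ?g i) c = coeff (\<rho> ?g) i" for i by (simp add: \<rho>_def coeff_map_poly)
    then have "poly (coeff ?g i) c = 0" for i by (simp only: z coeff_0)
    then have "[:-c, 1:] dvd coeff ?g i" for i using poly_eq_0_iff_dvd by blast
    then show ?thesis unfolding const_poly_dvd_iff by blast
  qed
  then obtain b where "?g = [:[:-c, 1:]:] * b" unfolding dvd_def by blast
  then have "\<epsilon> w0 * p ^ k = F * \<epsilon> (p1 ^ k) + [:[:-c, 1:]:] * b" by (metis add.commute diff_add_cancel)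
  moreover have "poly w0 x \<noteq> 0" using w0(2) poly_eq_0_iff_dvd by blast
  then have "eval2 x c (\<epsilon> w0) \<noteq> 0" using eval[of "\<epsilon> w0"] unfolding re by simp
  ultimately show ?thesis by blast
qed

text \<open>\<open>E k\<close> consists of the functions of order at least \<open>k\<close> along
  the uniformiser \<open>p\<close>. Let \<open>k\<close> be the least order of an invariant
  vanishing at the point, attained by \<open>a0\<close>. Every such invariant is locally a multiple
  of \<open>a0\<close> upstairs, and both denominator and multiplier can be made invariant.
  Ramification at a fixed point may make \<open>k\<close> larger than 1.\<close>

lemma regular_descends:
  assumes V: "eval2 x c F = 0" and sep: "separated x c" and reg: "regular_at UNIV x c"
  shows "regular_at D x c"
proof -
  obtain p where p: "eval2 x c p = 0"
    and gen: "\<And>a. eval2 x c a = 0 \<Longrightarrow> \<exists>u r. eval2 x c u \<noteq> 0 \<and> F dvd u * a - r * p"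
    using reg unfolding regular_at_def by blast
  obtain g F2 where g: "prime_elem g" "F = g * F2" "eval2 x c g = 0" "\<not> g dvd p"
    using regular_at_factor[OF V p gen] by blast
  define c1 where "c1 = [:[:-c, 1:]:]"
  have c1: "c1 \<in> D" "eval2 x c c1 = 0" by (simp_all add: c1_def const_D)
  define E where "E k = {a. \<exists>u r. eval2 x c u \<noteq> 0 \<and> F dvd u * a - r * p ^ k}" for k
  obtain e w \<alpha> \<beta> where w: "eval2 x c w \<noteq> 0" "w * p ^ e = F * \<alpha> + c1 * \<beta>"
    unfolding c1_def using power_in_fiber[OF V p] by blast
  \<comment> \<open>If c - c_0 had order above \<open>e\<close>, then since \<open>p ^ e\<close> is
    locally a multiple of it, \<open>p ^ e\<close> would locally be divisible by its own product
    with \<open>p\<close>. As \<open>g\<close> does not divide \<open>p ^ e\<close>, it would divide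
    a function that is nonzero at the point.\<close>
  have "c1 \<notin> E (Suc e)"
  proof
    assume "c1 \<in> E (Suc e)"
    then obtain u r where u: "eval2 x c u \<noteq> 0" "F dvd u * c1 - r * p ^ Suc e" by (auto simp: E_def)
    then obtain y where y: "u * c1 - r * p ^ Suc e = F * y" by blast
    have "p ^ e * (u * w - \<beta> * r * p) = u * (w * p ^ e) - \<beta> * (r * p ^ Suc e)"
      by (simp add: algebra_simps)
    also have "\<dots> = u * (F * \<alpha> + c1 * \<beta>) - \<beta> * (u * c1 - F * y)"
      unfolding w(2) using y by (simp add: algebra_simps)
    also have "\<dots> = F * (u * \<alpha> + \<beta> * y)" by (simp add: algebra_simps)
    finally have "g dvd p ^ e * (u * w - \<beta> * r * p)" unfolding g(2) by (simp add: mult.assoc)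
    then have "g dvd p ^ e \<or> g dvd u * w - \<beta> * r * p" by (rule prime_elem_dvd_multD[OF g(1)])
    moreover have "\<not> g dvd p ^ e" using g(1,4) prime_elem_dvd_power by blast
    ultimately have "eval2 x c (u * w - \<beta> * r * p) = 0" using g(3) eval2_dvd by blast
    then show False using u(1) w(1) p by simp
  qed
  moreover have "a \<in> E 0" for a unfolding E_def by (intro CollectI exI[of _ 1] exI[of _ a]) simp
  ultimately obtain k where k: "\<And>a. a \<in> D \<Longrightarrow> eval2 x c a = 0 \<Longrightarrow> a \<in> E k"
    "\<exists>a\<in>D. eval2 x c a = 0 \<and> a \<notin> E (Suc k)"
  proof -
    have "\<exists>k. (\<forall>a\<in>D. eval2 x c a = 0 \<longrightarrow> a \<in> E k) \<and> \<not> (\<forall>a\<in>D. eval2 x c a = 0 \<longrightarrow> a \<in> E (Suc k))"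
    proof (rule ccontr)
      assume *: "\<not> ?thesis"
      have "\<forall>a\<in>D. eval2 x c a = 0 \<longrightarrow> a \<in> E k" for k
        by (induction k) (use * \<open>\<And>a. a \<in> E 0\<close> in blast)+
      then show False using \<open>c1 \<notin> E (Suc e)\<close> c1 by blast
    qed
    then show thesis using that by blast
  qed
  obtain a0 where a0: "a0 \<in> D" "eval2 x c a0 = 0" "a0 \<notin> E (Suc k)" using k(2) by blast
  obtain u0 r0 where u0: "eval2 x c u0 \<noteq> 0" "F dvd u0 * a0 - r0 * p ^ k"
    using k(1)[OF a0(1,2)] by (auto simp: E_def)
  \<comment> \<open>The order of \<open>a0\<close> is exactly \<open>k\<close>: if \<open>r0\<close>
    vanished at the point it would be a further multiple of \<open>p\<close>.\<close>
  have r0: "eval2 x c r0 \<noteq> 0"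
  proof
    assume "eval2 x c r0 = 0"
    then obtain u r where u: "eval2 x c u \<noteq> 0" "F dvd u * r0 - r * p" using gen by blast
    have "u * u0 * a0 - r * p ^ Suc k = u * (u0 * a0 - r0 * p ^ k) + p ^ k * (u * r0 - r * p)"
      by (simp add: algebra_simps)
    then have "F dvd u * u0 * a0 - r * p ^ Suc k" using u u0 by simp
    moreover have "eval2 x c (u * u0) \<noteq> 0" using u u0 by simp
    ultimately show False using a0(3) unfolding E_def by blast
  qed
  have "\<exists>t\<in>D. \<exists>s\<in>D. eval2 x c t \<noteq> 0 \<and> F dvd t * a - s * a0" if a: "a \<in> D" "eval2 x c a = 0" for a
  proof -
    obtain u r where u: "eval2 x c u \<noteq> 0" "F dvd u * a - r * p ^ k"
      using k(1)[OF a] by (auto simp: E_def)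
    \<comment> \<open>The denominators with which \<open>a\<close> becomes a multiple of
      \<open>a0\<close> modulo \<open>F\<close>. As \<open>a\<close> and \<open>a0\<close> are
      invariant, this ideal is stable, so it contains an invariant denominator once it contains
      \<open>r0 * u\<close>.\<close>
    define J where "J = {s. \<exists>b. F dvd s * a - b * a0}"
    have J: "ideal_in UNIV J" unfolding ideal_in_def
    proof (intro conjI ballI subset_UNIV)
      show "0 \<in> J" unfolding J_def by (intro CollectI exI[of _ 0]) simp
      fix s assume "s \<in> J"
      then obtain b where b: "F dvd s * a - b * a0" by (auto simp: J_def)
      have "r * s * a - r * b * a0 = r * (s * a - b * a0)" for r by (simp add: algebra_simps)
      then have "F dvd r * s * a - r * b * a0" for r using b by simp
      then show "r * s \<in> J" for r unfolding J_def by blast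
      fix s' assume "s' \<in> J"
      then obtain b' where b': "F dvd s' * a - b' * a0" by (auto simp: J_def)
      have "(s + s') * a - (b + b') * a0 = (s * a - b * a0) + (s' * a - b' * a0)"
        by (simp add: algebra_simps)
      then have "F dvd (s + s') * a - (b + b') * a0" using b b' by simp
      then show "s + s' \<in> J" unfolding J_def by blast
    qed
    have stable: "\<sigma> s \<in> J" if "s \<in> J" for s
    proof -
      obtain b where b: "F dvd s * a - b * a0" using \<open>s \<in> J\<close> by (auto simp: J_def)
      have f: "F dvd \<sigma> s * (\<sigma> a - a)" "F dvd \<sigma> b * (\<sigma> a0 - a0)"
        using a(1) a0(1) unfolding D_iff by (simp_all only: dvd_mult)
      have "\<sigma> s * a - \<sigma> b * a0 = \<sigma> (s * a - b * a0) - \<sigma> s * (\<sigma> a - a) + \<sigma> b * (\<sigma> a0 - a0)"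
        by (simp add: algebra_simps)
      also have "F dvd \<dots>"
        by (rule dvd_add[OF dvd_diff[OF \<sigma>_dvd[OF b] f(1)] f(2)])
      finally show ?thesis unfolding J_def by blast
    qed
    have "r0 * u * a - r * u0 * a0 = r0 * (u * a - r * p ^ k) - r * (u0 * a0 - r0 * p ^ k)"
      by (simp add: algebra_simps)
    then have "F dvd r0 * u * a - r * u0 * a0" using u u0 by simp
    then have "r0 * u \<in> J" unfolding J_def by blast
    moreover have "eval2 x c (r0 * u) \<noteq> 0" using r0 u by simp
    ultimately obtain t where t: "t \<in> J" "t \<in> D" "eval2 x c t \<noteq> 0"
      using invariant_nonvanishing[OF sep J stable] by blast
    then obtain b where b: "F dvd t * a - b * a0" by (auto simp: J_def)
    \<comment> \<open>Everything in the relation except \<open>b\<close> is invariant, so averaging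
      the relation replaces \<open>b\<close> by \<open>rey b\<close> modulo
      \<open>F\<close>.\<close>
    have "t * a - rey b * a0 = rey (t * a - b * a0) - (rey (t * a) - t * a) + (rey (a0 * b) - a0 * rey b)"
    proof -
      have "rey (t * a) = rey (t * a - b * a0) + rey (a0 * b)"
        by (simp add: mult.commute flip: rey_add)
      then show ?thesis by (simp add: algebra_simps)
    qed
    also have "F dvd \<dots>"
      by (rule dvd_add[OF dvd_diff[OF rey_dvd[OF b] rey_fix[OF D.D_mult[OF t(2) a(1)]]] rey_mult[OF a0(1)]])
    finally show ?thesis using t rey_D by blast
  qed
  then show ?thesis unfolding regular_at_def using a0 by blast
qed

text \<open>c - c_0 is invariant, hence locally a multiple of \<open>p\<close>. For x - x_0, let
  \<open>e\<close> vanish on the rest of the orbit: the trace of \<open>x1 * e ^ 2\<close> is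
  invariant, hence a multiple of \<open>p\<close>, and modulo c - c_0 it is a local unit times x -
  x_0.\<close>

lemma regular_ascends:
  assumes V: "eval2 x c F = 0" and dist: "\<forall>i. 0 < i \<and> i < n \<longrightarrow> orb x c i \<noteq> x"
    and reg: "regular_at D x c"
  shows "regular_at UNIV x c"
proof -
  obtain p where p: "eval2 x c p = 0"
    and gen: "\<And>a. a \<in> D \<Longrightarrow> eval2 x c a = 0 \<Longrightarrow> \<exists>u r. eval2 x c u \<noteq> 0 \<and> F dvd u * a - r * p"
    using reg unfolding regular_at_def by blast
  define c1 where "c1 = [:[:-c, 1:]:]"
  define x1 where "x1 = [:[:-x:], 1:]"
  have xc: "eval2 x c x1 = 0" "eval2 x c c1 = 0" by (simp_all add: x1_def c1_def)
  have split: "\<exists>a b. g = x1 * a + c1 * b" if "eval2 x c g = 0" for g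
    using maximal_ideal_generators[of g x c] that by (simp add: x1_def c1_def)
  obtain u1 r1 where u1: "eval2 x c u1 \<noteq> 0" "F dvd u1 * c1 - r1 * p"
    using gen[of c1] xc by (auto simp: c1_def const_D)
  obtain e where e: "eval2 x c e \<noteq> 0" "\<And>i. 0 < i \<and> i < n \<Longrightarrow> eval2 x c ((\<sigma> ^^ i) e) = 0"
    using separator[OF dist] by blast
  \<comment> \<open>This is why \<open>e\<close> is squared: one conjugate of \<open>e\<close> is
    expanded in the generators of the maximal ideal, and the other makes the coefficient
    \<open>\<alpha>\<close> vanish at the point.\<close>
  have "\<exists>\<alpha> \<beta>. (\<sigma> ^^ i) (x1 * e ^ 2) = \<alpha> * x1 + \<beta> * c1 \<and> eval2 x c \<alpha> = 0" if "i \<in> {1..<n}" for i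
  proof -
    have z: "eval2 x c ((\<sigma> ^^ i) e) = 0" using e(2) that by simp
    then obtain a b where ab: "(\<sigma> ^^ i) e = x1 * a + c1 * b" using split by blast
    have "(\<sigma> ^^ i) (x1 * e ^ 2) = (\<sigma> ^^ i) x1 * (\<sigma> ^^ i) e * (\<sigma> ^^ i) e"
      by (simp add: power2_eq_square mult.assoc)
    also have "\<dots> = (\<sigma> ^^ i) x1 * (\<sigma> ^^ i) e * (x1 * a + c1 * b)" by (simp only: ab)
    also have "\<dots> = ((\<sigma> ^^ i) x1 * (\<sigma> ^^ i) e * a) * x1 + ((\<sigma> ^^ i) x1 * (\<sigma> ^^ i) e * b) * c1"
      by (simp only: distrib_left mult_ac)
    finally show ?thesis
      using z by (intro exI[of _ "(\<sigma> ^^ i) x1 * (\<sigma> ^^ i) e * a"] exI[of _ "(\<sigma> ^^ i) x1 * (\<sigma> ^^ i) e * b"] conjI) simp_all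
  qed
  then obtain \<alpha> \<beta> where ab: "\<And>i. i \<in> {1..<n} \<Longrightarrow> (\<sigma> ^^ i) (x1 * e ^ 2) = \<alpha> i * x1 + \<beta> i * c1"
    "\<And>i. i \<in> {1..<n} \<Longrightarrow> eval2 x c (\<alpha> i) = 0" by metis
  define A where "A = (\<Sum>i\<in>{1..<n}. \<alpha> i)"
  define B where "B = (\<Sum>i\<in>{1..<n}. \<beta> i)"
  have A: "eval2 x c A = 0" using ab(2) by (simp add: A_def)
  have t: "tr (x1 * e ^ 2) = (e ^ 2 + A) * x1 + B * c1"
  proof -
    have "(\<Sum>i\<in>{1..<n}. (\<sigma> ^^ i) (x1 * e ^ 2)) = (\<Sum>i\<in>{1..<n}. \<alpha> i * x1 + \<beta> i * c1)"
      by (rule sum.cong[OF refl ab(1)])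
    also have "\<dots> = A * x1 + B * c1" by (simp add: A_def B_def sum.distrib sum_distrib_right)
    finally have "(\<Sum>i\<in>{1..<n}. (\<sigma> ^^ i) (x1 * e ^ 2)) = A * x1 + B * c1" .
    then show ?thesis by (simp add: tr_split algebra_simps)
  qed
  have "eval2 x c (tr (x1 * e ^ 2)) = 0" using xc by (simp add: t)
  then obtain u r where u: "eval2 x c u \<noteq> 0" "F dvd u * tr (x1 * e ^ 2) - r * p"
    using gen[OF tr_D] by blast
  define U where "U = u1 * u * (e ^ 2 + A)"
  define R where "R = u1 * r - u * B * r1"
  have "U * x1 - R * p = u1 * (u * tr (x1 * e ^ 2) - r * p) - u * B * (u1 * c1 - r1 * p)"
    by (simp add: t U_def R_def algebra_simps)
  then have U: "F dvd U * x1 - R * p" using u(2) u1(2) by simp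
  have U0: "eval2 x c U \<noteq> 0" using u(1) u1(1) e(1) A by (simp add: U_def)
  have "\<exists>v s. eval2 x c v \<noteq> 0 \<and> F dvd v * g - s * p" if g: "eval2 x c g = 0" for g
  proof -
    obtain a b where "g = x1 * a + c1 * b" using split[OF g] by blast
    then have "U * u1 * g - (u1 * a * R + U * b * r1) * p
        = u1 * a * (U * x1 - R * p) + U * b * (u1 * c1 - r1 * p)"
      by (simp add: algebra_simps)
    then have "F dvd U * u1 * g - (u1 * a * R + U * b * r1) * p" using U u1(2) by simp
    moreover have "eval2 x c (U * u1) \<noteq> 0" using U0 u1(1) by simp
    ultimately show ?thesis by blast
  qed
  then show ?thesis unfolding regular_at_def using p by blast
qed

subsection \<open>Prime ideals of the ring of invariants\<close>

definition point_ideal :: "'k \<Rightarrow> 'k \<Rightarrow> 'k poly poly set" where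
  "point_ideal x c = {g \<in> D. eval2 x c g = 0}"

lemma point_ideal_prime: "eval2 x c F = 0 \<Longrightarrow> prime_in D (point_ideal x c) \<and> I \<subseteq> point_ideal x c"
proof -
  assume V: "eval2 x c F = 0"
  have "point_ideal x c = {g. eval2 x c g = 0} \<inter> D" by (auto simp: point_ideal_def)
  then have "prime_in D (point_ideal x c)" using prime_restrict[OF prime_in_eval2] by simp
  moreover have "I \<subseteq> point_ideal x c"
    using eval2_dvd[OF _ V] D.I_D unfolding point_ideal_def by blast
  ultimately show ?thesis by blast
qed

text \<open>Such a prime contains a nonzero polynomial in c; a prime lying over it does so too and
  is therefore the ideal of a point.\<close>

lemma nonminimal_prime_is_point:
  assumes q0: "prime_in D q0" "I \<subseteq> q0" and q1: "prime_in D q1" "q0 \<subset> q1"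
  shows "\<exists>x c. eval2 x c F = 0 \<and> q1 = point_ideal x c"
proof -
  obtain r where r: "r \<noteq> 0" "[:r:] \<in> q1"
    using larger_prime_meets_constants[OF subring_D const_D q0 q1] by blast
  obtain Q where Q: "prime_in UNIV Q" "F \<in> Q" "Q \<inter> D = q1"
    using lying_over[OF q1(1)] q0(2) q1(2) by blast
  then have "[:r:] \<in> Q" using r by blast
  then obtain x c where "eval2 x c F = 0" "Q = {g. eval2 x c g = 0}"
    using prime_over_constant[OF Q(1,2) _ r(1)] by blast
  then show ?thesis using Q(3) by (auto simp: point_ideal_def)
qed

lemma factor_prime:
  assumes "prime_elem g" "g dvd F"
  shows "prime_in D {d \<in> D. g dvd d}" "I \<subseteq> {d \<in> D. g dvd d}"
proof -
  have "{d \<in> D. g dvd d} = {d. g dvd d} \<inter> D" by blast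
  then show "prime_in D {d \<in> D. g dvd d}" using prime_restrict[OF prime_in_multiples[OF assms(1)]] by simp
  show "I \<subseteq> {d \<in> D. g dvd d}" using assms(2) D.I_D dvd_trans by blast
qed

text \<open>A component through the point gives a smaller prime: c - c_0 vanishes at the point but
  on no component.\<close>

lemma point_ideal_nonminimal:
  assumes V: "eval2 x c F = 0"
  shows "\<exists>P0. prime_in D P0 \<and> I \<subseteq> P0 \<and> P0 \<subset> point_ideal x c"
proof -
  obtain g where g: "prime_elem g" "g dvd F" "eval2 x c g = 0" using point_prime_factor[OF V] by blast
  have "[:[:-c, 1:]:] \<in> point_ideal x c" by (simp add: point_ideal_def const_D)
  moreover have "\<not> g dvd [:[:-c, 1:]:]"
    using factor_not_dvd_const[OF g(2) prime_elem_not_unit[OF g(1)]] by simp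
  moreover have "{d \<in> D. g dvd d} \<subseteq> point_ideal x c"
    using eval2_dvd[OF _ g(3)] by (auto simp: point_ideal_def)
  ultimately have "{d \<in> D. g dvd d} \<subset> point_ideal x c" by blast
  then show ?thesis using factor_prime[OF g(1,2)] by blast
qed

text \<open>Constants belong to \<open>D\<close>: an element \<open>d\<close> minus its value at the
  point (x', c') lies in both ideals, so its values at the two points agree.\<close>

lemma point_ideal_maximal:
  assumes "point_ideal x' c' \<subseteq> point_ideal x c"
  shows "point_ideal x' c' = point_ideal x c"
proof
  show "point_ideal x c \<subseteq> point_ideal x' c'"
  proof
    fix d assume d: "d \<in> point_ideal x c"
    then have "d - [:[:eval2 x' c' d:]:] \<in> point_ideal x' c'"
      using D.D_diff[OF _ const_D] by (simp add: point_ideal_def)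
    then have "d - [:[:eval2 x' c' d:]:] \<in> point_ideal x c" using assms by blast
    then have "eval2 x' c' d = 0" using d by (simp add: point_ideal_def)
    then show "d \<in> point_ideal x' c'" using d by (simp add: point_ideal_def)
  qed
qed fact

text \<open>Such a prime comes from a component \<open>g\<close>. At a point of \<open>g\<close>,
  regularity writes \<open>F\<close> as \<open>g' * F2\<close> with \<open>g'\<close> associated to
  \<open>g\<close> and \<open>F2\<close> nonzero there, so \<open>F2\<close> annihilates
  \<open>a\<close> modulo \<open>F\<close>. The annihilator of \<open>a\<close> is stable, so it
  also contains an invariant that is nonzero at the point and hence outside
  \<open>q\<close>.\<close>

lemma minimal_prime_local_zero:
  assumes reg: "\<And>x c. eval2 x c F = 0 \<Longrightarrow> regular_at UNIV x c \<and> separated x c"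
    and q: "prime_in D q" "I \<subseteq> q" and np: "\<And>x c. eval2 x c F = 0 \<Longrightarrow> q \<noteq> point_ideal x c"
    and a: "a \<in> q"
  shows "\<exists>u\<in>D - q. u * a \<in> I"
proof -
  obtain Q where Q: "prime_in UNIV Q" "F \<in> Q" "Q \<inter> D = q" using lying_over[OF q] by blast
  obtain g where g: "prime_elem g" "g dvd F" "Q = {a. g dvd a}"
    using primes_over_F[OF Q(1,2)] np Q(3) unfolding point_ideal_def by blast
  obtain x where x: "eval2 x 0 g = 0" using factor_has_point[OF g(2) prime_elem_not_unit[OF g(1)]] by blast
  have V: "eval2 x 0 F = 0" by (rule eval2_dvd[OF g(2) x])
  obtain p where p: "eval2 x 0 p = 0"
    and gen: "\<And>a. eval2 x 0 a = 0 \<Longrightarrow> \<exists>u r. eval2 x 0 u \<noteq> 0 \<and> F dvd u * a - r * p"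
    using reg[OF V] unfolding regular_at_def by blast
  obtain g' F2 where g': "prime_elem g'" "F = g' * F2" "eval2 x 0 g' = 0" "eval2 x 0 F2 \<noteq> 0"
    using regular_at_factor[OF V p gen] by blast
  have "\<not> g dvd F2" using eval2_dvd[OF _ x] g'(4) by blast
  then have "g dvd g'" using g(1,2) g'(2) prime_elem_dvd_multD by blast
  then have "g' dvd g"
    using g'(1) g(1) by (metis dvdE dvd_mult_unit_iff irreducibleD prime_elem_imp_irreducible
        prime_elem_not_unit dvd_refl)
  moreover have "g dvd a" using a Q(3) g(3) by blast
  ultimately have "g' dvd a" by (rule dvd_trans)
  then have Fa: "F dvd F2 * a" unfolding g'(2) by (auto elim!: dvdE)
  define J where "J = {s. F dvd s * a}"
  have aD: "a \<in> D" using a Q(3) by blast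
  have J: "ideal_in UNIV J" by (auto simp: ideal_in_def J_def distrib_right mult.assoc)
  have stable: "\<sigma> s \<in> J" if "s \<in> J" for s
  proof -
    have "F dvd \<sigma> s * (\<sigma> a - a)" using aD unfolding D_iff by (rule dvd_mult)
    moreover have "F dvd \<sigma> (s * a)" using that \<sigma>_dvd unfolding J_def by blast
    ultimately have "F dvd \<sigma> (s * a) - \<sigma> s * (\<sigma> a - a)" by (rule dvd_diff[rotated])
    also have "\<sigma> (s * a) - \<sigma> s * (\<sigma> a - a) = \<sigma> s * a" by (simp add: algebra_simps)
    finally show ?thesis by (simp add: J_def)
  qed
  have "F2 \<in> J" using Fa by (simp add: J_def)
  then obtain t where t: "t \<in> J" "t \<in> D" "eval2 x 0 t \<noteq> 0"
    using invariant_nonvanishing[OF _ J stable _ g'(4)] reg[OF V] by blast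
  have "t \<notin> q" using t(3) Q(3) g(3) eval2_dvd[OF _ x] by blast
  then show ?thesis using t by (auto simp: J_def)
qed

subsection \<open>Regularity and irreducibility of a ring presented as the invariants\<close>

lemma regular_at_point_iff:
  assumes pres: "presented_ring A D I h" and V: "eval2 x c F = 0"
  shows "regular_local_ring (localization A (h ` point_ideal x c)) \<longleftrightarrow> regular_at D x c"
proof -
  interpret presented_ring A D I h by (rule pres)
  interpret presented_prime A D I h "point_ideal x c"
    by unfold_locales (use point_ideal_prime[OF V] in auto)
  obtain P0 where P0: "prime_in D P0" "I \<subseteq> P0" "P0 \<subset> point_ideal x c"
    using point_ideal_nonminimal[OF V] by blast
  have max: "P' = point_ideal x c"
    if "prime_in D P" "I \<subseteq> P" "prime_in D P'" "P \<subset> P'" "P' \<subseteq> point_ideal x c" for P P'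
    using nonminimal_prime_is_point[OF that(1-4)] point_ideal_maximal that(5) by blast
  have "regular_local_ring L \<longleftrightarrow>
      (\<exists>\<pi>\<in>point_ideal x c. \<forall>a\<in>point_ideal x c. \<exists>u\<in>S. \<exists>r\<in>D. u * a - r * \<pi> \<in> I)"
    by (rule regular_one_iff[OF noetherian_D P0 max])
  also have "\<dots> \<longleftrightarrow> regular_at D x c"
    unfolding regular_at_def point_ideal_def Bex_def Ball_def by (simp add: conj_ac) metis
  finally show ?thesis .
qed

lemma regular_spec_imp:
  assumes pres: "presented_ring A D I h"
    and reg: "\<forall>P\<in>spec A. regular_local_ring (localization A P)" and V: "eval2 x c F = 0"
  shows "regular_at D x c"
proof -
  interpret presented_ring A D I h by (rule pres)
  have "h ` point_ideal x c \<in> spec A" using point_ideal_prime[OF V] by (auto simp: spec_eq)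
  then show ?thesis using reg regular_at_point_iff[OF pres V] by blast
qed

text \<open>Points are settled by descent, and every other prime is minimal. For the trivial action
  this is the passage from the points of Y_1 to its whole spectrum.\<close>

lemma regular_spec:
  assumes pres: "presented_ring A D I h"
    and reg: "\<And>x c. eval2 x c F = 0 \<Longrightarrow> regular_at UNIV x c \<and> separated x c"
  shows "\<forall>P\<in>spec A. regular_local_ring (localization A P)"
proof
  interpret presented_ring A D I h by (rule pres)
  fix P assume "P \<in> spec A"
  then obtain q where q: "prime_in D q" "I \<subseteq> q" "P = h ` q" by (auto simp: spec_eq)
  show "regular_local_ring (localization A P)"
  proof (cases "\<exists>x c. eval2 x c F = 0 \<and> q = point_ideal x c")
    case True
    then obtain x c where V: "eval2 x c F = 0" "q = point_ideal x c" by blast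
    then show ?thesis
      using regular_at_point_iff[OF pres V(1)] regular_descends[OF V(1)] reg[OF V(1)] q(3) by blast
  next
    case False
    interpret presented_prime A D I h q by unfold_locales (use q in auto)
    have "regular_local_ring L"
    proof (rule regular_minimal[OF noetherian_D])
      show "P' = q" if "prime_in D P'" "I \<subseteq> P'" "P' \<subseteq> q" for P'
        using nonminimal_prime_is_point[OF that(1,2) q(1)] that(3) False by blast
      show "\<exists>u\<in>S. u * a \<in> I" if "a \<in> q" for a
        using minimal_prime_local_zero[OF reg q(1,2) _ that] False by blast
    qed
    then show ?thesis using q(3) by simp
  qed
qed

section \<open>Transfer of irreducibility\<close>

definition irreducible_primes :: "'k poly poly set \<Rightarrow> bool" where
  "irreducible_primes E \<longleftrightarrow> (\<exists>P. prime_in E P \<and> I \<subseteq> P) \<and>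
     (\<forall>a\<in>E. \<forall>b\<in>E. (\<forall>P. prime_in E P \<and> I \<subseteq> P \<longrightarrow> a \<in> P \<or> b \<in> P) \<longrightarrow>
        (\<forall>P. prime_in E P \<and> I \<subseteq> P \<longrightarrow> a \<in> P) \<or> (\<forall>P. prime_in E P \<and> I \<subseteq> P \<longrightarrow> b \<in> P))"

lemma irreducible_primesD:
  assumes "irreducible_primes E"
  shows "\<exists>P. prime_in E P \<and> I \<subseteq> P"
    "a \<in> E \<Longrightarrow> b \<in> E \<Longrightarrow> (\<And>P. prime_in E P \<Longrightarrow> I \<subseteq> P \<Longrightarrow> a \<in> P \<or> b \<in> P) \<Longrightarrow>
      (\<forall>P. prime_in E P \<and> I \<subseteq> P \<longrightarrow> a \<in> P) \<or> (\<forall>P. prime_in E P \<and> I \<subseteq> P \<longrightarrow> b \<in> P)"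
  using assms unfolding irreducible_primes_def by simp_all

text \<open>By lying over, restricting primes to \<open>D\<close> is onto, so the spectrum of the
  invariants is the image of an irreducible one.\<close>

lemma irreducible_descends:
  assumes "irreducible_primes UNIV"
  shows "irreducible_primes D"
proof -
  let ?U = "\<lambda>Q. prime_in UNIV Q \<and> I \<subseteq> Q" and ?D = "\<lambda>P. prime_in D P \<and> I \<subseteq> P"
  have up: "\<exists>Q. ?U Q \<and> Q \<inter> D = P" if "?D P" for P
    using lying_over[of P] dvd_in_prime prime_inD(1) that by blast
  have down: "?D (Q \<inter> D)" if "?U Q" for Q using prime_restrict that D.I_D by blast
  show ?thesis unfolding irreducible_primes_def
  proof (intro conjI ballI impI)
    obtain Q where "?U Q" using irreducible_primesD(1)[OF assms] by blast
    then show "\<exists>P. ?D P" using down by blast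
    fix a b assume ab: "a \<in> D" "b \<in> D" and or: "\<forall>P. ?D P \<longrightarrow> a \<in> P \<or> b \<in> P"
    have "a \<in> Q \<or> b \<in> Q" if "prime_in UNIV Q" "I \<subseteq> Q" for Q using or down that by blast
    then have "(\<forall>Q. ?U Q \<longrightarrow> a \<in> Q) \<or> (\<forall>Q. ?U Q \<longrightarrow> b \<in> Q)"
      by (rule irreducible_primesD(2)[OF assms UNIV_I UNIV_I])
    then show "(\<forall>P. ?D P \<longrightarrow> a \<in> P) \<or> (\<forall>P. ?D P \<longrightarrow> b \<in> P)"
    proof (elim disj_forward, intro allI impI)
      fix P assume "\<forall>Q. ?U Q \<longrightarrow> a \<in> Q" "?D P"
      then show "a \<in> P" using up[of P] ab by blast
    next
      assume *: "\<forall>Q. ?U Q \<longrightarrow> b \<in> Q"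
      show "\<forall>P. ?D P \<longrightarrow> b \<in> P"
      proof (intro allI impI)
        fix P assume "?D P"
        then show "b \<in> P" using up[of P] * ab by blast
      qed
    qed
  qed
qed

text \<open>The norm over the group: on the curve it vanishes exactly on the translates of the zeros
  of \<open>g\<close>.\<close>

definition nrm :: "'k poly poly \<Rightarrow> 'k poly poly" where "nrm g = (\<Prod>i<n. (\<sigma> ^^ i) g)"

lemma \<sigma>_prod: "\<sigma> (prod f A) = (\<Prod>i\<in>A. \<sigma> (f i))"
  by (induction A rule: infinite_finite_induct) auto

lemma nrm_D: "nrm g \<in> D"
proof -
  obtain m where m: "n = Suc m" using n_pos by (cases n) auto
  have "\<sigma> (nrm g) = (\<Prod>i<n. (\<sigma> ^^ Suc i) g)" by (simp add: nrm_def \<sigma>_prod)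
  also have "\<dots> = (\<Prod>i<m. (\<sigma> ^^ Suc i) g) * (\<sigma> ^^ n) g"
    unfolding m by (rule prod.lessThan_Suc)
  finally have "\<sigma> (nrm g) = (\<Prod>i<m. (\<sigma> ^^ Suc i) g) * (\<sigma> ^^ n) g" .
  moreover have "nrm g = g * (\<Prod>i<m. (\<sigma> ^^ Suc i) g)"
    unfolding nrm_def unfolding m prod.lessThan_Suc_shift by simp
  ultimately have "\<sigma> (nrm g) - nrm g = (\<Prod>i<m. (\<sigma> ^^ Suc i) g) * ((\<sigma> ^^ n) g - g)"
    by (simp only: algebra_simps)
  then show ?thesis unfolding D_iff using \<sigma>_order by (metis dvd_mult)
qed

lemma dvd_nrm: "g dvd nrm g"
proof -
  have "{..<n} = insert 0 {1..<n}" using n_pos by auto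
  then show ?thesis by (simp add: nrm_def)
qed

text \<open>\<open>q\<close> is the component through the fixed point. Each prime of
  \<open>D\<close> over \<open>F\<close> contains the norm of \<open>q\<close> or of
  \<open>h\<close>, so by irreducibility one norm vanishes on the whole quotient; the norm of
  \<open>h\<close> is nonzero at the fixed point, so it is that of \<open>q\<close>. A prime factor
  of \<open>h\<close> would then be a translate of \<open>q\<close> and pass through the fixed
  point, where \<open>h\<close> is nonzero. Hence \<open>h\<close> is a unit.\<close>

lemma irreducible_ascends:
  assumes irr: "irreducible_primes D"
    and V: "eval2 x c F = 0" and fixed: "\<And>i. orb x c i = x"
    and F: "F = q * h" "prime_elem q" "eval2 x c q = 0" "eval2 x c h \<noteq> 0"
  shows "irreducible_primes UNIV"
proof -
  let ?D = "\<lambda>P. prime_in D P \<and> I \<subseteq> P"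
  have "nrm q \<in> P \<or> nrm h \<in> P" if P: "?D P" for P
  proof -
    obtain Q where Q: "prime_in UNIV Q" "F \<in> Q" "Q \<inter> D = P" using lying_over P by blast
    then have "q \<in> Q \<or> h \<in> Q" using prime_inD(3)[OF Q(1)] F(1) by blast
    then have "nrm q \<in> Q \<or> nrm h \<in> Q"
      using ideal_inD(5)[OF prime_inD(1)[OF Q(1)]] dvd_nrm by (metis UNIV_I dvdE)
    then show ?thesis using Q(3) nrm_D by blast
  qed
  then have "(\<forall>P. ?D P \<longrightarrow> nrm q \<in> P) \<or> (\<forall>P. ?D P \<longrightarrow> nrm h \<in> P)"
    using irreducible_primesD(2)[OF irr nrm_D nrm_D, of q h] by simp
  moreover have "nrm h \<notin> point_ideal x c"
    using F(4) by (simp add: point_ideal_def nrm_def eval2_\<sigma>_pow fixed)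
  ultimately have nq: "nrm q \<in> P" if "?D P" for P using point_ideal_prime[OF V] that by blast
  have unit: "is_unit h"
  proof (rule ccontr)
    assume nu: "\<not> is_unit h"
    have "h \<noteq> 0" using F(4) by auto
    then obtain r where rp: "prime r" "r dvd h" using nu prime_divisor_exists by blast
    then have r: "prime_elem r" "r dvd h" by auto
    have rF: "r dvd F" using r(2) F(1) by simp
    have "r dvd nrm q" using nq factor_prime[OF r(1) rF] by blast
    then have "\<exists>i\<in>{..<n}. r dvd (\<sigma> ^^ i) q"
      unfolding nrm_def by (simp only: prime_dvd_prod_iff[OF finite_lessThan rp(1)])
    then obtain i where i: "i < n" "r dvd (\<sigma> ^^ i) q" by blast
    define j where "j = n - i"
    \<comment> \<open>\<open>\<sigma>\<close> is invertible only modulo \<open>F\<close>, so the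
      inverse translate of \<open>q\<close> is found as a prime factor \<open>s\<close> of
      \<open>F\<close> inside the preimage of the ideal of \<open>q\<close> under
      \<open>\<sigma> ^^ j\<close>.\<close>
    have "prime_in UNIV {g. q dvd (\<sigma> ^^ j) g}"
      using prime_elem_not_unit[OF F(2)] prime_elem_dvd_multD[OF F(2)]
      by (auto simp: prime_in_def ideal_in_def)
    moreover have "F \<in> {g. q dvd (\<sigma> ^^ j) g}"
      using \<sigma>_pow_dvd[of F j] F(1) by (auto intro: dvd_trans)
    ultimately obtain s where s: "prime_elem s" "s dvd F" "q dvd (\<sigma> ^^ j) s"
      using prime_in_prime_factor F_nonzero by blast
    have "(\<sigma> ^^ i) q dvd (\<sigma> ^^ i) ((\<sigma> ^^ j) s)" using s(3) by (auto elim!: dvdE)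
    also have "(\<sigma> ^^ i) ((\<sigma> ^^ j) s) = (\<sigma> ^^ n) s"
      using i(1) by (simp add: j_def flip: funpow_add comp_apply[of "\<sigma> ^^ i"])
    finally have "r dvd (\<sigma> ^^ n) s" using i(2) dvd_trans by blast
    moreover have "r dvd (\<sigma> ^^ n) s - s" using rF \<sigma>_order dvd_trans by blast
    ultimately have "r dvd s" using dvd_diff[of r "(\<sigma> ^^ n) s" "(\<sigma> ^^ n) s - s"] by simp
    then have "s dvd r"
      using r(1) s(1) by (metis dvdE dvd_mult_unit_iff irreducibleD prime_elem_imp_irreducible
        prime_elem_not_unit dvd_refl)
    have "eval2 x c s = 0" using eval2_dvd[OF s(3) F(3)] by (simp add: eval2_\<sigma>_pow fixed)
    then have "eval2 x c h = 0" using eval2_dvd \<open>s dvd r\<close> r(2) dvd_trans by blast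
    then show False using F(4) by simp
  qed
  have qP: "q \<in> P" if "prime_in UNIV P" "I \<subseteq> P" for P
  proof -
    obtain h' where "1 = h * h'" using unit by (auto elim: dvdE)
    then have "q = F * h'" using F(1) by (metis mult.assoc mult.right_neutral)
    then show ?thesis using that(2) by auto
  qed
  have qprime: "prime_in UNIV {g. q dvd g}" "I \<subseteq> {g. q dvd g}"
    using prime_in_multiples[OF F(2)] F(1) by (auto elim: dvd_mult_left)
  have mult: "a \<in> P" if "q dvd a" "prime_in UNIV P" "I \<subseteq> P" for a P
    using qP[OF that(2,3)] that(1) ideal_inD(5)[OF prime_inD(1)[OF that(2)]] by (auto elim!: dvdE)
  show ?thesis unfolding irreducible_primes_def
  proof (intro conjI ballI impI)
    show "\<exists>P. prime_in UNIV P \<and> I \<subseteq> P" using qprime by blast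
    fix a b assume "\<forall>P. prime_in UNIV P \<and> I \<subseteq> P \<longrightarrow> a \<in> P \<or> b \<in> P"
    then have "q dvd a \<or> q dvd b" using qprime by blast
    then show "(\<forall>P. prime_in UNIV P \<and> I \<subseteq> P \<longrightarrow> a \<in> P) \<or> (\<forall>P. prime_in UNIV P \<and> I \<subseteq> P \<longrightarrow> b \<in> P)"
      using mult by blast
  qed
qed

end

subsection \<open>The Moebius function\<close>

lemma moebius_prime_mult:
  assumes "prime (p::nat)" "\<not> p dvd k"
  shows "moebius (p * k) = - moebius k"
proof (cases "k = 0")
  case False
  have cop: "coprime p k" using assms by (rule prime_imp_coprime)
  have sq: "squarefree (p * k) \<longleftrightarrow> squarefree k"
    using squarefree_mult_coprime[OF cop] squarefree_multD assms(1) squarefree_prime by blast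
  have "prime_factors (p * k) = insert p (prime_factors k)"
    using assms False by (simp add: prime_factors_product prime_gt_0_nat prime_prime_factors)
  moreover have "p \<notin> prime_factors k" using assms by auto
  ultimately show ?thesis by (simp add: moebius_def sq)
qed (use assms in auto)

lemma moebius_square_mult:
  assumes "prime (p::nat)" "p dvd k"
  shows "moebius (p * k) = 0"
proof -
  have "p ^ 2 dvd p * k" using assms by (simp add: power2_eq_square mult_dvd_mono)
  then have "\<not> squarefree (p * k)" using assms(1) by (auto simp: squarefree_def dest!: spec[of _ p])
  then show ?thesis by (simp add: moebius_def)
qed

text \<open>For a prime \<open>p\<close> dividing \<open>N\<close>, a squarefree divisor prime to
  \<open>p\<close> cancels against \<open>p\<close> times it; divisors containing \<open>p\<close>
  twice contribute zero.\<close>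

lemma sum_moebius:
  assumes "N > 0"
  shows "(\<Sum>k | k dvd N. moebius k) = (if N = 1 then 1 else 0)"
proof (cases "N = 1")
  case True
  then show ?thesis by (simp add: moebius_def)
next
  case False
  then obtain p where p: "prime p" "p dvd N" using prime_factor_nat by blast
  let ?A = "{k. k dvd N \<and> \<not> p dvd k}" and ?B = "{k. k dvd N \<and> p dvd k}"
  have fin: "finite {k. k dvd N}" using assms by simp
  have "(\<Sum>k\<in>?B. moebius k) = (\<Sum>k\<in>(*) p ` ?A. moebius k)"
  proof (rule sum.mono_neutral_right)
    show "finite ?B" using fin by (rule rev_finite_subset) auto
    show "(*) p ` ?A \<subseteq> ?B"
      using p by (auto intro: divides_mult prime_imp_coprime)
    show "\<forall>k\<in>?B - (*) p ` ?A. moebius k = 0"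
    proof
      fix k assume k: "k \<in> ?B - (*) p ` ?A"
      then obtain j where j: "k = p * j" by auto
      have "j dvd N" using k j by (auto dest: dvd_mult_right)
      then have "p dvd j" using k j by auto
      then show "moebius k = 0" using moebius_square_mult[OF p(1)] j by simp
    qed
  qed
  also have "\<dots> = (\<Sum>k\<in>?A. moebius (p * k))"
    using prime_gt_0_nat[OF p(1)] by (subst sum.reindex) (auto simp: inj_on_def)
  also have "\<dots> = - (\<Sum>k\<in>?A. moebius k)"
    using moebius_prime_mult[OF p(1)] by (simp add: sum_negf)
  finally have "(\<Sum>k\<in>?A. moebius k) + (\<Sum>k\<in>?B. moebius k) = 0" by simp
  moreover have "finite ?A" "finite ?B" using fin by (rule rev_finite_subset; blast)+
  then have "(\<Sum>k\<in>?A \<union> ?B. moebius k) = (\<Sum>k\<in>?A. moebius k) + (\<Sum>k\<in>?B. moebius k)"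
    by (rule sum.union_disjoint) blast
  moreover have "?A \<union> ?B = {k. k dvd N}" by blast
  ultimately show ?thesis using False by simp
qed

text \<open>Passing from d to n/d turns this into the full Moebius sum over the divisors of
  n/e.\<close>

lemma sum_moebius_interval:
  assumes n: "n > 0" and e: "e dvd (n::nat)"
  shows "(\<Sum>d | d dvd n \<and> e dvd d. moebius (n div d)) = (if e = n then 1 else 0)"
proof -
  obtain N where N: "n = e * N" using e by blast
  have pos: "e > 0" "N > 0" using n N by auto
  have "(\<Sum>d | d dvd n \<and> e dvd d. moebius (n div d)) = (\<Sum>k | k dvd N. moebius k)"
  proof (rule sum.reindex_bij_witness[where i = "\<lambda>k. n div k" and j = "\<lambda>d. n div d"])
    fix d assume "d \<in> {d. d dvd n \<and> e dvd d}"
    then have "e dvd d" "d dvd n" by auto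
    then obtain j k where d: "d = e * j" "n = d * k" unfolding dvd_def by blast
    then have "N = j * k" using N pos by simp
    moreover have "d > 0" "k > 0" using d n by auto
    ultimately show "n div (n div d) = d" "n div d \<in> {k. k dvd N}" using d(2) by auto
  next
    fix k assume "k \<in> {k. k dvd N}"
    then obtain j where j: "N = k * j" by auto
    have "k > 0" "j > 0" using j pos by auto
    have "n = k * (e * j)" using N j by simp
    then have "n div k = e * j" using \<open>k > 0\<close> by simp
    then show "n div (n div k) = k" "n div k \<in> {d. d dvd n \<and> e dvd d}"
      using \<open>n = k * (e * j)\<close> pos \<open>j > 0\<close> by auto
  qed auto
  also have "\<dots> = (if e = n then 1 else 0)"
    using sum_moebius[OF pos(2)] N pos by simp
  finally show ?thesis .
qed

subsection \<open>Iterates of the unicritical polynomial\<close>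

text \<open>Defined over every coefficient ring, so that iterates can be compared before and after
  reduction.\<close>

definition iter :: "nat \<Rightarrow> nat \<Rightarrow> 'r::comm_ring_1 poly poly" where
  "iter m n = ((\<lambda>q. pcompose (unicritical m) q) ^^ n) var_x"

definition period :: "nat \<Rightarrow> nat \<Rightarrow> 'r::comm_ring_1 poly poly" where
  "period m n = iter m n - var_x"

lemma period_poly_eq: "period_poly m n = period m n"
  by (simp add: period_poly_def period_def iter_def)

lemma pcompose_var_x [simp]: "pcompose var_x q = (q :: 'r::comm_ring_1 poly poly)" "pcompose q var_x = q"
  by (simp_all add: var_x_def pcompose_pCons pcompose_idR)

lemma pcompose_power: "pcompose (p ^ i) q = pcompose p q ^ i" for p :: "'r::comm_ring_1 poly"
  by (induction i) (simp_all add: pcompose_mult pcompose_1)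

lemma pcompose_unicritical: "pcompose (unicritical m) q = q ^ m + var_c"
  by (simp add: unicritical_def pcompose_add pcompose_power var_c_def)

lemma iter_0 [simp]: "iter m 0 = var_x"
  by (simp add: iter_def)

lemma iter_Suc: "iter m (Suc n) = iter m n ^ m + var_c"
  by (simp add: iter_def pcompose_unicritical)

lemma iter_1: "iter m (Suc 0) = unicritical m"
  by (simp add: iter_Suc unicritical_def)

lemma iter_add: "iter m (a + b) = pcompose (iter m a) (iter m b)"
  by (induction a) (simp_all add: iter_Suc pcompose_add pcompose_power var_c_def)

lemma iter_right: "((\<lambda>g. pcompose g (unicritical m)) ^^ n) var_x = (iter m n :: 'a::comm_ring_1 poly poly)"
proof (induction n)
  case (Suc n)
  have "iter m (Suc n) = pcompose (iter m n) (unicritical m :: 'a poly poly)"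
    using iter_add[of m n "Suc 0"] by (simp add: iter_1)
  then show ?case using Suc by (simp only: funpow.simps comp_apply)
qed simp

lemma period_0 [simp]: "period m 0 = 0"
  by (simp add: period_def)

text \<open>Applying the a-th iterate to f^b(x) and to x gives values whose difference is divisible
  by f^b(x) - x.\<close>

lemma period_add: "(period m b :: 'r::comm_ring_1 poly poly) dvd period m (a + b) - period m a"
proof -
  have "iter m b - var_x dvd pcompose (iter m a) (iter m b) - pcompose (iter m a) (var_x :: 'r poly poly)"
    by (rule pcompose_diff_dvd)
  then show ?thesis by (simp add: period_def iter_add)
qed

lemma period_dvd:
  assumes "d dvd n"
  shows "(period m d :: 'r::comm_ring_1 poly poly) dvd period m n"
proof -
  obtain k where "n = d * k" using assms by blast
  moreover have "(period m d :: 'r poly poly) dvd period m (d * k)"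
  proof (induction k)
    case (Suc k)
    have "(period m d :: 'r poly poly) dvd (period m (d * k + d) - period m (d * k)) + period m (d * k)"
      by (rule dvd_add[OF period_add Suc])
    then show ?case by (simp add: add.commute)
  qed simp
  ultimately show ?thesis by simp
qed

text \<open>Euclid's algorithm on the indices: modulo \<open>period m b\<close> the polynomial
  \<open>period m a\<close> depends only on \<open>a mod b\<close>.\<close>

lemma dvd_period_gcd:
  fixes q :: "'r::comm_ring_1 poly poly"
  assumes "q dvd period m a" "q dvd period m b"
  shows "q dvd period m (gcd a b)"
  using assms
proof (induction a b rule: gcd_nat_induct)
  case (step a b)
  have "(period m b :: 'r poly poly) dvd period m (b * (a div b))" by (rule period_dvd) simp
  then have "(period m b :: 'r poly poly) dvd period m (a mod b + b * (a div b)) - period m (a mod b)"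
  proof -
    have "(period m b :: 'r poly poly) dvd period m (b * (a div b))" by (rule period_dvd) simp
    then show ?thesis using period_add by (rule dvd_trans)
  qed
  then have "(period m b :: 'r poly poly) dvd period m a - period m (a mod b)" by simp
  then have "q dvd period m a - period m (a mod b)" by (rule dvd_trans[OF step(4)])
  then have "q dvd period m a - (period m a - period m (a mod b))" using step(3) by (rule dvd_diff[rotated])
  then have "q dvd period m (a mod b)" by simp
  then have "q dvd period m (gcd b (a mod b))" using step by blast
  then show ?case by (simp add: gcd_red_nat[of a b])
qed simp

lemma degree_unicritical:
  assumes "m \<ge> 2"
  shows "degree (unicritical m :: 'r::idom poly poly) = m" "lead_coeff (unicritical m :: 'r poly poly) = 1"
proof -
  have x: "degree (var_x :: 'r poly poly) = 1" "lead_coeff (var_x :: 'r poly poly) = 1"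
    by (simp_all add: var_x_def)
  have d: "degree (var_x ^ m :: 'r poly poly) = m" by (simp add: degree_power_eq x(1) var_x_def)
  have l: "lead_coeff (var_x ^ m :: 'r poly poly) = 1" by (simp only: lead_coeff_power x(2) power_one)
  have c: "degree (var_c :: 'r poly poly) < degree (var_x ^ m :: 'r poly poly)"
    using d assms by (simp add: var_c_def)
  show "degree (unicritical m :: 'r poly poly) = m"
    unfolding unicritical_def degree_add_eq_left[OF c] by (rule d)
  then show "lead_coeff (unicritical m :: 'r poly poly) = 1"
    using l c d by (simp add: unicritical_def coeff_eq_0)
qed

lemma degree_iter:
  assumes "m \<ge> 2"
  shows "degree (iter m n :: 'r::idom poly poly) = m ^ n \<and> lead_coeff (iter m n :: 'r poly poly) = 1"
proof (induction n)
  case 0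
  show ?case by (simp add: var_x_def)
next
  case (Suc n)
  have eq: "(iter m (Suc n) :: 'r poly poly) = pcompose (unicritical m) (iter m n)"
    by (simp add: iter_def)
  have "degree (iter m n :: 'r poly poly) > 0" using Suc assms by simp
  then have "lead_coeff (pcompose (unicritical m) (iter m n) :: 'r poly poly) = 1"
    by (simp only: lead_coeff_comp power_one mult_1_right conjunct2[OF Suc] degree_unicritical(2)[OF assms])
  moreover have "degree (pcompose (unicritical m) (iter m n) :: 'r poly poly) = m ^ Suc n"
    using Suc degree_unicritical(1)[OF assms, where 'r = 'r] by (simp add: degree_pcompose)
  ultimately show ?case unfolding eq by blast
qed

lemma degree_period:
  assumes "m \<ge> 2" "n \<ge> 1"
  shows "degree (period m n :: 'r::idom poly poly) = m ^ n" "lead_coeff (period m n :: 'r poly poly) = 1"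
proof -
  have "m ^ 1 \<le> m ^ n" using assms by (intro power_increasing) auto
  then have lt: "degree (var_x :: 'r poly poly) < m ^ n" using assms by (simp add: var_x_def)
  have i: "degree (iter m n :: 'r poly poly) = m ^ n" "coeff (iter m n :: 'r poly poly) (m ^ n) = 1"
    using degree_iter[OF assms(1), of n, where 'r = 'r] by auto
  have "degree (iter m n + (- var_x) :: 'r poly poly) = degree (iter m n :: 'r poly poly)"
    by (rule degree_add_eq_left) (use lt i in simp)
  then show d: "degree (period m n :: 'r poly poly) = m ^ n" by (simp add: period_def i)
  show "lead_coeff (period m n :: 'r poly poly) = 1"
    unfolding d using i(2) lt by (simp add: period_def coeff_eq_0)
qed

text \<open>Specialising \<open>c\<close> to \<open>0\<close> gives \<open>x ^ (m ^ n) - x\<close>, which has only simple complex roots.\<close>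

lemma period_squarefree:
  fixes q :: "int poly poly"
  assumes m: "m \<ge> 2" and n: "n \<ge> 1" and q: "q * q dvd period m n"
  shows "is_unit q"
proof (rule ccontr)
  assume nu: "\<not> is_unit q"
  obtain r where r: "period m n = q * q * r" using q by blast
  have lead: "lead_coeff q * (lead_coeff q * lead_coeff r) = 1"
    using degree_period(2)[OF m n, where 'r = int] by (simp add: r lead_coeff_mult mult.assoc)
  then have u: "is_unit (lead_coeff q)" by (metis dvd_triv_left)
  have deg: "degree q > 0"
  proof (rule ccontr)
    assume "\<not> degree q > 0"
    then obtain a where "q = [:a:]" by (auto elim: degree_eq_zeroE)
    then show False using u nu by (auto simp: is_unit_const_poly_iff)
  qed
  have "comm_ring_hom (\<lambda>r. of_int (poly r 0) :: complex)" by unfold_locales auto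
  then interpret h: map_poly_comm_ring_hom "\<lambda>r. of_int (poly r 0) :: complex"
    by (simp add: map_poly_comm_ring_hom_def)
  let ?h = "map_poly (\<lambda>r. of_int (poly r 0) :: complex)"
  define N where "N = m ^ n"
  have N: "N \<ge> 2" using m n self_le_power[of m n] unfolding N_def by linarith
  have hx: "?h var_x = [:0, 1:]" by (simp add: var_x_def map_poly_pCons)
  have hc: "?h var_c = 0" by (simp add: var_c_def map_poly_pCons)
  have "?h (iter m k) = [:0, 1:] ^ (m ^ k)" for k
    by (induction k) (simp_all add: hx hc iter_Suc h.hom_add h.hom_power mult.commute flip: power_mult)
  then have hp: "?h (period m n) = [:0, 1:] ^ N - [:0, 1:]"
    by (simp add: period_def h.hom_minus hx N_def)
  \<comment> \<open>The unit leading coefficient keeps \<open>q\<close> nonconstant after the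
    specialisation, so it acquires a complex root \<open>z\<close>.\<close>
  have "poly (lead_coeff q) 0 \<noteq> 0" using u unfolding dvd_def by (metis mult_zero_left poly_1 poly_mult zero_neq_one)
  then have "coeff (?h q) (degree q) \<noteq> 0" by (simp add: coeff_map_poly)
  then have "degree (?h q) > 0" using deg le_degree by (metis gr0I le_zero_eq)
  then obtain z where z: "poly (?h q) z = 0" using alg_closed_imp_poly_has_root by blast
  have eq: "[:0, 1:] ^ N - [:0, 1:] = ?h q * ?h q * ?h r"
    unfolding hp[symmetric] r by (simp add: h.hom_mult)
  have "poly ([:0, 1:] ^ N - [:0, 1:]) z = 0" unfolding eq using z by simp
  then have 1: "z ^ N = z" by simp
  \<comment> \<open>A double root satisfies z^N = z and N z^(N-1) = 1. Multiplying the second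
    equation by z gives N z = z, so z = 0, which contradicts it.\<close>
  have "poly (pderiv ([:0, 1:] ^ N - [:0, 1:])) z = 0" unfolding eq using z by (simp add: pderiv_mult)
  then have 2: "of_nat N * z ^ (N - 1) = 1"
    using N by (simp add: pderiv_diff pderiv_power pderiv_pCons)
  have "of_nat N * z ^ N = z * (of_nat N * z ^ (N - 1))"
    using N by (cases N) (simp_all add: mult_ac)
  then have "of_nat N * z = z" by (simp only: 1 2 mult_1_right)
  then have "z = 0" using N by simp
  have zp: "(0::complex) ^ (N - 1) = 0" using N by (intro zero_power) simp
  show False using 2 unfolding \<open>z = 0\<close> zp by simp
qed

subsection \<open>Dynatomic polynomials\<close>

text \<open>The factorisation of the period polynomial over the divisors of its index, solved for
  the last factor. That \<open>div\<close> is exact is proved in \<open>period_eq_prod_dyn\<close>;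
  the range of \<open>d\<close> keeps the recursive calls below \<open>n\<close>.\<close>

fun dyn :: "nat \<Rightarrow> nat \<Rightarrow> int poly poly" where
  "dyn m n = period m n div (\<Prod>d\<in>{1..<n}. if d dvd n then dyn m d else 1)"

declare dyn.simps [simp del]

lemma prod_pairwise_coprime_dvd:
  fixes f :: "'i \<Rightarrow> 'a::semiring_gcd"
  assumes "finite A" "\<And>i. i \<in> A \<Longrightarrow> f i dvd x"
    "\<And>i j. i \<in> A \<Longrightarrow> j \<in> A \<Longrightarrow> i \<noteq> j \<Longrightarrow> coprime (f i) (f j)"
  shows "prod f A dvd x"
  using assms
proof (induction A)
  case (insert a A)
  have "coprime (f a) (prod f A)" by (rule prod_coprime_right) (use insert in auto)
  then show ?case using insert by (auto intro: divides_mult)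
qed simp

lemma coprimeI_prime:
  fixes a b :: "'a::factorial_semiring_gcd"
  assumes "a \<noteq> 0" "\<And>p. prime_elem p \<Longrightarrow> p dvd a \<Longrightarrow> p dvd b \<Longrightarrow> False"
  shows "coprime a b"
proof (rule ccontr)
  assume "\<not> coprime a b"
  then have "\<not> is_unit (gcd a b)" by (simp add: coprime_iff_gcd_eq_1 is_unit_gcd)
  then obtain p where "prime p" "p dvd gcd a b"
    using prime_divisor_exists[of "gcd a b"] assms(1) by auto
  then show False using assms(2)[of p] by auto
qed

lemma proper_divisors:
  fixes n :: nat
  assumes "n > 0"
  shows "{d. d dvd n} = insert n {d\<in>{1..<n}. d dvd n}"
proof (intro equalityI subsetI)
  fix d assume "d \<in> {d. d dvd n}"
  then have "d dvd n" "d \<le> n" "d > 0"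
    using assms dvd_imp_le dvd_pos_nat by auto
  then show "d \<in> insert n {d\<in>{1..<n}. d dvd n}" by auto
qed auto

context
  fixes m :: nat assumes m: "m \<ge> 2"
begin

abbreviation \<Psi> :: "nat \<Rightarrow> int poly poly" where "\<Psi> \<equiv> period m"

text \<open>A common prime would divide the squarefree period polynomial of index \<open>n\<close>
  twice: once through \<open>dyn m n\<close> and once through the factors for the divisors of
  \<open>g\<close>. The factorisation enters as the hypothesis \<open>prod\<close> so that the lemma
  is available inside the induction that proves it.\<close>

lemma dyn_primitive:
  assumes prod: "\<And>k. k dvd n \<Longrightarrow> k > 0 \<Longrightarrow> \<Psi> k = (\<Prod>d | d dvd k. dyn m d)"
    and n: "n > 0" and g: "g dvd n" "g < n" and q: "prime_elem q" "q dvd \<Psi> g" "q dvd dyn m n"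
  shows False
proof -
  have "{d. d dvd n} = insert n {d\<in>{1..<n}. d dvd n}" by (rule proper_divisors[OF n])
  then have "\<Psi> n = dyn m n * (\<Prod>d\<in>{d\<in>{1..<n}. d dvd n}. dyn m d)"
    using prod[of n] n by simp
  moreover have g0: "g > 0" using g n by (auto intro!: Nat.gr0I)
  have "{d. d dvd g} \<subseteq> {d\<in>{1..<n}. d dvd n}"
    using g g0 dvd_trans by (auto simp: Suc_le_eq intro!: Nat.gr0I dest: dvd_imp_le)
  then have "(\<Prod>d | d dvd g. dyn m d) dvd (\<Prod>d\<in>{d\<in>{1..<n}. d dvd n}. dyn m d)"
    by (intro prod_dvd_prod_subset) auto
  then have "\<Psi> g dvd (\<Prod>d\<in>{d\<in>{1..<n}. d dvd n}. dyn m d)" using prod[OF g(1) g0] by simp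
  with q(2) have "q dvd (\<Prod>d\<in>{d\<in>{1..<n}. d dvd n}. dyn m d)" by (rule dvd_trans)
  ultimately have "q * q dvd \<Psi> n" using q(3) by (simp add: mult_dvd_mono)
  moreover have "n \<ge> 1" using n by simp
  ultimately have "is_unit q" by (intro period_squarefree[OF m])
  then show False using q(1) by simp
qed

text \<open>The factors for the proper divisors divide the period polynomial and are pairwise
  coprime, so their product divides it. A common prime of two of them divides the period polynomial
  of the gcd of their indices, against primitivity of the larger one.\<close>

lemma period_eq_prod_dyn: "n > 0 \<Longrightarrow> \<Psi> n = (\<Prod>d | d dvd n. dyn m d) \<and> lead_coeff (dyn m n) = 1"
proof (induction n rule: less_induct)
  case (less n)
  let ?A = "{d\<in>{1..<n}. d dvd n}"
  have IH: "\<Psi> k = (\<Prod>d | d dvd k. dyn m d)" "lead_coeff (dyn m k) = 1" if "k < n" "k > 0" for k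
    using less that by auto
  have "(\<Prod>d\<in>?A. dyn m d) dvd \<Psi> n"
  proof (rule prod_pairwise_coprime_dvd)
    show "dyn m d dvd \<Psi> n" if d: "d \<in> ?A" for d
    proof -
      have "dyn m d dvd \<Psi> d"
        using IH(1)[of d] d by (auto intro!: dvd_prodI)
      also have "\<dots> dvd \<Psi> n" using d by (auto intro: period_dvd)
      finally show ?thesis .
    qed
    have dd: "dyn m k dvd \<Psi> k" if "k < n" "k > 0" for k
      unfolding IH(1)[OF that] by (rule dvd_prodI) (use that in auto)
    have no_common: False
      if de: "d \<in> ?A" "e \<in> ?A" "e < d" and q: "prime_elem q" "q dvd dyn m d" "q dvd dyn m e" for d e q
    proof (rule dyn_primitive[of d "gcd d e" q])
      have de': "d < n" "d > 0" "e < n" "e > 0" using de by auto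
      show "q dvd \<Psi> (gcd d e)"
        by (rule dvd_period_gcd; rule dvd_trans[OF _ dd]) (use q de' in auto)
      show "gcd d e < d" using gcd_le2_nat[of e d] de' de(3) by linarith
      show "\<Psi> k = (\<Prod>d | d dvd k. dyn m d)" if "k dvd d" "k > 0" for k
        using IH(1)[of k] that dvd_imp_le[of k d] de' by simp
    qed (use de q in auto)
    show "coprime (dyn m d) (dyn m e)" if "d \<in> ?A" "e \<in> ?A" "d \<noteq> e" for d e
    proof (rule coprimeI_prime)
      show "dyn m d \<noteq> 0" using IH(2)[of d] that by auto
      show False if "prime_elem q" "q dvd dyn m d" "q dvd dyn m e" for q
        using no_common[of d e q] no_common[of e d q] that \<open>d \<in> ?A\<close> \<open>e \<in> ?A\<close> \<open>d \<noteq> e\<close> by linarith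
    qed
  qed simp
  moreover have "(\<Prod>d\<in>{1..<n}. if d dvd n then dyn m d else 1) = (\<Prod>d\<in>?A. dyn m d)"
    by (rule prod.inter_filter[symmetric]) simp
  ultimately have eq: "\<Psi> n = dyn m n * (\<Prod>d\<in>?A. dyn m d)" by (simp add: dyn.simps[of m n])
  then have 1: "\<Psi> n = (\<Prod>d | d dvd n. dyn m d)" using proper_divisors[OF less.prems] by simp
  have "lead_coeff (\<Prod>d\<in>?A. dyn m d) = 1"
    unfolding lead_coeff_prod by (rule prod.neutral) (use IH(2) in auto)
  moreover have "lead_coeff (\<Psi> n) = 1"
    using degree_period(2)[OF m, of n] less.prems by simp
  ultimately have "lead_coeff (dyn m n) = 1" unfolding eq lead_coeff_mult by simp
  then show ?case using 1 by blast
qed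

lemmas period_prod = conjunct1[OF period_eq_prod_dyn] and dyn_monic = conjunct2[OF period_eq_prod_dyn]

lemma dyn_nonzero: "n > 0 \<Longrightarrow> dyn m n \<noteq> 0"
  using dyn_monic[of n] by auto

lemma dyn_dvd_period: "n > 0 \<Longrightarrow> dyn m n dvd \<Psi> n"
  unfolding period_prod by (rule dvd_prodI) auto

text \<open>The period polynomial divides its composite with f_c, so \<open>dyn m n\<close> divides
  the product of the composed factors. It is coprime to those of proper divisors, hence divides its
  own composite.\<close>

lemma dyn_dvd_compose:
  assumes n: "n > 0"
  shows "dyn m n dvd pcompose (dyn m n) (unicritical m)"
proof -
  let ?f = "unicritical m :: int poly poly"
  let ?A = "{d\<in>{1..<n}. d dvd n}"
  have comm: "pcompose (iter m k) ?f = pcompose ?f (iter m k)" for k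
    using iter_add[of m k "Suc 0", where 'a = int] iter_add[of m "Suc 0" k, where 'a = int]
    by (simp add: iter_1)
  have comp: "pcompose (\<Psi> k) ?f = pcompose ?f (iter m k) - pcompose ?f var_x" for k
    by (simp add: period_def pcompose_diff comm)
  have "\<Psi> n dvd pcompose (\<Psi> n) ?f"
    unfolding comp unfolding period_def by (rule pcompose_diff_dvd)
  then have "dyn m n dvd pcompose (\<Psi> n) ?f" using dyn_dvd_period[OF n] dvd_trans by blast
  also have "pcompose (\<Psi> n) ?f = pcompose (dyn m n) ?f * (\<Prod>d\<in>?A. pcompose (dyn m d) ?f)"
    using proper_divisors[OF n] by (simp add: period_prod[OF n] pcompose_mult pcompose_prod)
  finally have dvd: "dyn m n dvd pcompose (dyn m n) ?f * (\<Prod>d\<in>?A. pcompose (dyn m d) ?f)" .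
  have "coprime (dyn m n) (pcompose (dyn m d) ?f)" if d: "d \<in> ?A" for d
  proof (rule coprimeI_prime[OF dyn_nonzero[OF n]])
    fix q assume q: "prime_elem q" "q dvd dyn m n" "q dvd pcompose (dyn m d) ?f"
    have "pcompose (dyn m d) ?f dvd pcompose (\<Psi> d) ?f"
      using dyn_dvd_period[of d] d by (auto elim!: dvdE simp: pcompose_mult)
    then have "q dvd pcompose (\<Psi> d) ?f" using q(3) dvd_trans by blast
    moreover have "iter m (Suc d) = pcompose ?f (iter m d)" by (simp add: iter_def)
    ultimately have 1: "q dvd iter m (Suc d) - iter m (Suc 0)" by (simp add: comp iter_1)
    have "(iter m (Suc d) :: int poly poly) - iter m (Suc 0) dvd
        pcompose (iter m (n - 1)) (iter m (Suc d)) - pcompose (iter m (n - 1)) (iter m (Suc 0))"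
      by (rule pcompose_diff_dvd)
    \<comment> \<open>Modulo \<open>q\<close> the n-th iterate is x, so n - 1 further applications
      undo the substitution of f_c: the congruence of the iterates d + 1 and 1 becomes one of d and
      0.\<close>
    then have "q dvd iter m (n - 1 + Suc d) - iter m (n - 1 + Suc 0)"
      unfolding iter_add using 1 dvd_trans by blast
    then have 2: "q dvd \<Psi> (d + n) - \<Psi> n"
      using n by (simp add: period_def add.commute)
    have qn: "q dvd \<Psi> n" using q(2) dyn_dvd_period[OF n] dvd_trans by blast
    have "q dvd \<Psi> (d + n) - \<Psi> d" by (rule dvd_trans[OF qn period_add])
    then have "q dvd (\<Psi> (d + n) - \<Psi> n) + \<Psi> n - (\<Psi> (d + n) - \<Psi> d)"
      by (rule dvd_diff[OF dvd_add[OF 2 qn]])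
    then have "q dvd \<Psi> d" by simp
    then show False
      using dyn_primitive[of n d q] period_prod n d q(1,2) by auto
  qed
  then have "coprime (dyn m n) (\<Prod>d\<in>?A. pcompose (dyn m d) ?f)" by (rule prod_coprime_right)
  then show ?thesis using dvd by (simp add: coprime_dvd_mult_left_iff)
qed

lemma prod_power_int: "finite A \<Longrightarrow> x \<noteq> 0 \<Longrightarrow> (\<Prod>i\<in>A. x powi f i) = (x :: 'a::field) powi (\<Sum>i\<in>A. f i)"
  by (induction A rule: finite_induct) (simp_all add: power_int_add)

lemma prod_power_int_distrib: "(\<Prod>i\<in>A. f i) powi k = (\<Prod>i\<in>A. (f i :: 'a::field) powi k)"
  by (induction A rule: infinite_finite_induct) (simp_all add: power_int_mult_distrib)

lemma to_fract_prod: "to_fract (prod f A) = (\<Prod>i\<in>A. to_fract (f i))"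
  by (induction A rule: infinite_finite_induct) simp_all

text \<open>Moebius inversion in multiplicative form; it also shows that the definite description is
  satisfied by a polynomial.\<close>

lemma dynatomic_eq_dyn:
  assumes n: "n > 0"
  shows "dynatomic m n = dyn m n"
proof -
  have fin: "finite {d. d dvd n}" using n by simp
  have pos: "d > 0" if "d dvd n" for d using that n by (auto intro!: Nat.gr0I)
  have "(\<Prod>d | d dvd n. to_fract (period_poly m d) powi moebius (n div d))
      = (\<Prod>d\<in>{d. d dvd n}. \<Prod>e\<in>{e\<in>{e. e dvd n}. e dvd d}. to_fract (dyn m e) powi moebius (n div d))"
  proof (rule prod.cong[OF refl])
    fix d assume "d \<in> {d. d dvd n}"
    then have d: "d dvd n" by simp
    have "{e\<in>{e. e dvd n}. e dvd d} = {e. e dvd d}" using d dvd_trans by auto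
    then show "to_fract (period_poly m d) powi moebius (n div d)
        = (\<Prod>e\<in>{e\<in>{e. e dvd n}. e dvd d}. to_fract (dyn m e) powi moebius (n div d))"
      by (simp add: period_poly_eq period_prod[OF pos[OF d]] to_fract_prod prod_power_int_distrib)
  qed
  \<comment> \<open>After the exchange the exponent of each factor \<open>dyn m e\<close> is the
    Moebius sum over the d between e and n, which is 0 unless e = n.\<close>
  also have "\<dots> = (\<Prod>e\<in>{e. e dvd n}. \<Prod>d\<in>{d\<in>{d. d dvd n}. e dvd d}. to_fract (dyn m e) powi moebius (n div d))"
    by (rule prod.swap_restrict[OF fin fin])
  also have "\<dots> = (\<Prod>e\<in>{e. e dvd n}. if e = n then to_fract (dyn m n) else 1)"
  proof (rule prod.cong[OF refl])
    fix e assume "e \<in> {e. e dvd n}"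
    then have e: "e dvd n" by simp
    have "(\<Prod>d\<in>{d\<in>{d. d dvd n}. e dvd d}. to_fract (dyn m e) powi moebius (n div d))
        = to_fract (dyn m e) powi (\<Sum>d\<in>{d\<in>{d. d dvd n}. e dvd d}. moebius (n div d))"
      using dyn_nonzero[OF pos[OF e]] fin by (intro prod_power_int) auto
    also have "(\<Sum>d\<in>{d\<in>{d. d dvd n}. e dvd d}. moebius (n div d)) = (if e = n then 1 else 0)"
      using sum_moebius_interval[OF n e] by simp
    finally show "(\<Prod>d\<in>{d\<in>{d. d dvd n}. e dvd d}. to_fract (dyn m e) powi moebius (n div d))
        = (if e = n then to_fract (dyn m n) else 1)" by simp
  qed
  also have "\<dots> = to_fract (dyn m n)" using fin by simp
  finally have "(\<Prod>d | d dvd n. to_fract (period_poly m d) powi moebius (n div d)) = to_fract (dyn m n)" .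
  then show ?thesis unfolding dynatomic_def by simp
qed

end

subsection \<open>Reduction of the dynatomic polynomial\<close>

lemma map_poly_pCons_zero: "f 0 = 0 \<Longrightarrow> map_poly f (pCons a p) = pCons (f a) (map_poly f p)"
  by (rule poly_eqI) (simp add: coeff_map_poly coeff_pCons split: nat.split)

definition red :: "int poly poly \<Rightarrow> 'r::comm_ring_1 poly poly" where
  "red = map_poly (map_poly of_int)"

lemma red_hom: "comm_ring_hom (red :: int poly poly \<Rightarrow> 'r::comm_ring_1 poly poly)"
proof -
  have "comm_ring_hom (of_int :: int \<Rightarrow> 'r)" by unfold_locales auto
  then interpret a: map_poly_comm_ring_hom "of_int :: int \<Rightarrow> 'r"
    by (simp add: map_poly_comm_ring_hom_def)
  have "comm_ring_hom (map_poly (of_int :: int \<Rightarrow> 'r))" by unfold_locales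
  then interpret b: map_poly_comm_ring_hom "map_poly (of_int :: int \<Rightarrow> 'r)"
    by (simp add: map_poly_comm_ring_hom_def)
  show ?thesis unfolding red_def by unfold_locales
qed

interpretation red: comm_ring_hom red
  by (rule red_hom)

lemma red_pCons: "red (pCons a g) = pCons (map_poly of_int a) (red g)"
  by (simp add: red_def map_poly_pCons_zero)

lemma red_var [simp]: "red var_x = var_x" "red var_c = var_c"
  by (simp_all add: var_x_def var_c_def red_def map_poly_pCons)

lemma red_iter: "red (iter m n) = iter m n"
  by (induction n) (simp_all add: iter_Suc red.hom_add red.hom_power)

lemma red_period: "red (period m n) = period m n"
  by (simp add: period_def red.hom_minus red_iter)

lemma red_pcompose: "(red (pcompose a b) :: 'r::comm_ring_1 poly poly) = pcompose (red a) (red b)"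
proof (induction a)
  case (pCons c a)
  have "(red (pcompose (pCons c a) b) :: 'r poly poly) = red [:c:] + red b * red (pcompose a b)"
    by (simp add: pcompose_pCons red.hom_add red.hom_mult)
  also have "(red [:c:] :: 'r poly poly) = [:map_poly of_int c:]" by (simp add: red_pCons)
  finally show ?case by (simp only: pCons.IH red_pCons pcompose_pCons)
qed simp

lemma red_unicritical: "red (unicritical m) = unicritical m"
  by (simp add: unicritical_def red.hom_add red.hom_power)

lemma red_monic:
  assumes "lead_coeff g = 1"
  shows "lead_coeff (red g :: 'r::comm_ring_1 poly poly) = 1" "degree (red g :: 'r poly poly) = degree g"
proof -
  have c: "coeff (red g :: 'r poly poly) (degree g) = 1" using assms by (simp add: red_def coeff_map_poly)
  then have "degree (red g :: 'r poly poly) \<ge> degree g" by (intro le_degree) simp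
  moreover have "degree (red g :: 'r poly poly) \<le> degree g" unfolding red_def by (rule degree_map_poly_le)
  ultimately show d: "degree (red g :: 'r poly poly) = degree g" by simp
  show "lead_coeff (red g :: 'r poly poly) = 1" unfolding d by (rule c)
qed

lemma poly_action_dyn:
  assumes m: "m \<ge> 2" and n: "n \<ge> 1" "of_nat n \<noteq> (0 :: 'k::field)"
  shows "poly_action (red (dyn m n) :: 'k poly poly) (unicritical m) n"
proof
  have "red (dyn m n) dvd (red (pcompose (dyn m n) (unicritical m)) :: 'k poly poly)"
    using dyn_dvd_compose[OF m, of n] n by (auto elim!: dvdE simp: red.hom_mult)
  then show "red (dyn m n) dvd pcompose (red (dyn m n)) (unicritical m :: 'k poly poly)"
    by (simp add: red_pcompose red_unicritical)
  have "red (dyn m n) dvd (red (period m n) :: 'k poly poly)"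
    using dyn_dvd_period[OF m, of n] n by (auto elim!: dvdE simp: red.hom_mult)
  moreover have "(red (period m n) :: 'k poly poly) = period m n" by (rule red_period)
  moreover have "((\<lambda>g. pcompose g (unicritical m)) ^^ n) [:0, 1:] - [:0, 1:] = (period m n :: 'k poly poly)"
    using iter_right[of n m, where 'a = 'k] by (simp add: period_def var_x_def)
  ultimately show "red (dyn m n) dvd
      ((\<lambda>g. pcompose g (unicritical m)) ^^ n) [:0, 1:] - [:0, 1 :: 'k poly:]" by (simp only:)
qed (use n in auto)

text \<open>The trivial group puts Y_1 into the same framework as Y_0.\<close>

lemma poly_action_trivial: "poly_action F [:0, 1:] (Suc 0)"
  by unfold_locales (simp_all add: pcompose_idR)

text \<open>Where f_c(x) = x, the quotient of period polynomials is the geometric sum of the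
  multiplier. The quotients satisfy h_(n+1) = h_n S + 1, where S comes from the factorisation of y^m
  - x^m and is congruent to m x^(m-1), because y, the n-th iterate, is congruent to x.\<close>

lemma period_quotient:
  "\<exists>h :: 'r::comm_ring_1 poly poly. period m n = period m 1 * h \<and>
     period m 1 dvd h - (\<Sum>i<n. (of_nat m * var_x ^ (m - 1)) ^ i)"
proof (induction n)
  case 0
  show ?case by (intro exI[of _ 0]) simp
next
  case (Suc n)
  let ?P = "period m 1 :: 'r poly poly" and ?x = "var_x :: 'r poly poly" and ?y = "iter m n :: 'r poly poly"
  let ?l = "of_nat m * ?x ^ (m - 1)"
  obtain h where h: "period m n = ?P * h" "?P dvd h - (\<Sum>i<n. ?l ^ i)" using Suc by blast
  define S where "S = (\<Sum>i<m. ?x ^ (m - Suc i) * ?y ^ i)"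
  have "period m (Suc n) = (?y ^ m - ?x ^ m) + ?P"
    by (simp add: period_def iter_Suc)
  also have "?y ^ m - ?x ^ m = (?y - ?x) * S" unfolding S_def by (rule power_diff_sumr2)
  also have "?y - ?x = ?P * h" using h(1) by (simp add: period_def)
  finally have 1: "period m (Suc n) = ?P * (h * S + 1)" by (simp add: algebra_simps)
  have "S - ?l = (\<Sum>i<m. ?x ^ (m - Suc i) * (?y ^ i - ?x ^ i))"
  proof -
    have "(\<Sum>i<m. ?x ^ (m - Suc i) * ?x ^ i) = (\<Sum>i<m. ?x ^ (m - 1))"
      by (rule sum.cong) (auto simp flip: power_add)
    then show ?thesis by (simp add: S_def right_diff_distrib sum_subtractf)
  qed
  moreover have "?P dvd ?y ^ i - ?x ^ i" for i
  proof -
    have "?P dvd ?y - ?x" using h(1) by (simp add: period_def)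
    then show ?thesis by (simp add: power_diff_sumr2)
  qed
  ultimately have "?P dvd S - ?l" by (auto intro!: dvd_sum)
  moreover have "h * S + 1 - (\<Sum>i<Suc n. ?l ^ i) = h * (S - ?l) + ?l * (h - (\<Sum>i<n. ?l ^ i))"
    by (simp add: sum.lessThan_Suc_shift sum_distrib_left algebra_simps del: sum.lessThan_Suc)
  ultimately have "?P dvd h * S + 1 - (\<Sum>i<Suc n. ?l ^ i)" using h(2) by simp
  then show ?case using 1 by blast
qed

subsection \<open>Restriction to the curve of fixed points\<close>

text \<open>The equation f_c(x) = x solved for c.\<close>

definition fixed_curve :: "nat \<Rightarrow> 'k::comm_ring_1 poly" where
  "fixed_curve m = [:0, 1:] - [:0, 1:] ^ m"

text \<open>Pullback along the parametrisation of the curve of fixed points by x.\<close>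

definition restr :: "nat \<Rightarrow> 'k::comm_ring_1 poly poly \<Rightarrow> 'k poly" where
  "restr m g = poly (map_poly (\<lambda>r. pcompose r (fixed_curve m)) g) [:0, 1:]"

lemma restr_hom: "comm_ring_hom (restr m :: 'k::comm_ring_1 poly poly \<Rightarrow> 'k poly)"
proof -
  have "comm_ring_hom (\<lambda>r :: 'k poly. pcompose r (fixed_curve m))"
    by unfold_locales (auto simp: pcompose_add pcompose_mult pcompose_1)
  then interpret a: map_poly_comm_ring_hom "\<lambda>r :: 'k poly. pcompose r (fixed_curve m)"
    by (simp add: map_poly_comm_ring_hom_def)
  show ?thesis
    by unfold_locales (simp_all add: restr_def a.hom_add a.hom_mult)
qed

interpretation restr: comm_ring_hom "restr m"
  by (rule restr_hom)

lemma restr_pCons: "restr m (pCons r g) = pcompose r (fixed_curve m) + [:0, 1:] * restr m g"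
  by (simp add: restr_def map_poly_pCons_zero)

lemma restr_var: "restr m var_x = [:0, 1:]" "restr m var_c = fixed_curve m"
  by (simp_all add: var_x_def var_c_def restr_pCons pcompose_pCons)

lemma restr_period_1: "restr m (period m 1) = 0"
  by (simp add: period_def iter_1 unicritical_def restr.hom_add restr.hom_minus restr.hom_power
      restr_var fixed_curve_def)

lemma poly_restr: "poly (restr m g) x = eval2 x (x - x ^ m) g"
proof (induction g)
  case 0
  show ?case by (simp add: restr.hom_zero)
next
  case (pCons r g)
  then show ?case by (simp add: restr_pCons poly_pcompose fixed_curve_def)
qed

definition lift_x :: "'k::comm_ring_1 poly \<Rightarrow> 'k poly poly" where
  "lift_x = map_poly (\<lambda>a. [:a:])"

lemma lift_x_hom: "comm_ring_hom (lift_x :: 'k::comm_ring_1 poly \<Rightarrow> 'k poly poly)"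
proof -
  have "comm_ring_hom (\<lambda>a :: 'k. [:a:])" by unfold_locales (auto simp: one_pCons)
  then interpret a: map_poly_comm_ring_hom "\<lambda>a :: 'k. [:a:]"
    by (simp add: map_poly_comm_ring_hom_def)
  show ?thesis unfolding lift_x_def by unfold_locales
qed

interpretation lift_x: comm_ring_hom lift_x
  by (rule lift_x_hom)

lemma lift_x_pCons: "lift_x (pCons a g) = pCons [:a:] (lift_x g)"
  by (simp add: lift_x_def map_poly_pCons_zero)

lemma eval2_lift_x: "eval2 x c (lift_x g) = poly g x"
  by (induction g) (simp_all add: lift_x_pCons lift_x.hom_zero)

text \<open>\<open>period m 1\<close> is c - (x - x^m), so modulo it c can be eliminated in favour
  of x.\<close>

lemma restr_decomp:
  fixes g :: "'k::comm_ring_1 poly poly"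
  shows "period m 1 dvd g - lift_x (restr m g)"
proof -
  let ?P = "period m 1 :: 'k poly poly" and ?s = "fixed_curve m :: 'k poly"
  have P: "?P = var_c - lift_x ?s"
    by (simp add: period_def iter_1 unicritical_def fixed_curve_def lift_x.hom_minus lift_x.hom_power
        lift_x_pCons lift_x.hom_zero var_x_def flip: one_pCons)
  have const: "?P dvd [:r:] - lift_x (pcompose r ?s)" for r
  proof (induction r)
    case 0
    show ?case by (simp add: lift_x.hom_zero)
  next
    case (pCons a r)
    have "lift_x (pcompose (pCons a r) ?s) = [:[:a:]:] + lift_x ?s * lift_x (pcompose r ?s)"
      by (simp add: pcompose_pCons lift_x.hom_add lift_x.hom_mult lift_x_pCons lift_x.hom_zero)
    moreover have "[:pCons a r:] = [:[:a:]:] + var_c * [:r:]" by (simp add: var_c_def)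
    ultimately have "[:pCons a r:] - lift_x (pcompose (pCons a r) ?s)
        = ?P * [:r:] + lift_x ?s * ([:r:] - lift_x (pcompose r ?s))"
      unfolding P by (simp only: algebra_simps)
    then show ?case using dvd_add[OF dvd_triv_left dvd_mult[OF pCons.IH]] by (simp only:)
  qed
  show ?thesis
  proof (induction g)
    case 0
    show ?case by (simp add: lift_x.hom_zero restr.hom_zero)
  next
    case (pCons r g)
    have "lift_x (restr m (pCons r g)) = lift_x (pcompose r ?s) + var_x * lift_x (restr m g)"
      by (simp add: restr_pCons lift_x.hom_add lift_x_pCons var_x_def flip: one_pCons)
    moreover have "pCons r g = [:r:] + var_x * g" by (simp add: var_x_def)
    ultimately have "pCons r g - lift_x (restr m (pCons r g))
        = ([:r:] - lift_x (pcompose r ?s)) + var_x * (g - lift_x (restr m g))"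
      by (simp only: algebra_simps)
    then show ?case using pCons const by simp
  qed
qed

context
  fixes m :: nat and TK :: "'k::{alg_closed_field, field_gcd} itself"
  assumes m: "m \<ge> 2" and mK: "of_nat m \<noteq> (0 :: 'k)" and m1K: "of_nat (m - 1) \<noteq> (0 :: 'k)"
begin

abbreviation multiplier :: "'k poly" where "multiplier \<equiv> of_nat m * [:0, 1:] ^ (m - 1)"

abbreviation dynK :: "nat \<Rightarrow> 'k poly poly" where "dynK n \<equiv> red (dyn m n)"

lemma multiplier_degree: "degree multiplier = m - 1"
proof -
  have "multiplier = smult (of_nat m) ([:0, 1:] ^ (m - 1))" by (simp add: of_nat_poly)
  then show ?thesis using mK by (simp add: degree_power_eq)
qed

text \<open>The factor \<open>dynK 1\<close> equals \<open>period m 1\<close> and vanishes on the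
  curve of fixed points. It is cancelled before restricting, which leaves the geometric sum of
  \<open>period_quotient\<close>.\<close>

lemma prod_restr_dynK:
  assumes n: "n > 1"
  shows "(\<Prod>d\<in>{d. d dvd n} - {1}. restr m (dynK d)) = (\<Sum>i<n. multiplier ^ i)"
proof -
  obtain h :: "'k poly poly" where h: "period m n = period m 1 * h"
    "period m 1 dvd h - (\<Sum>i<n. (of_nat m * var_x ^ (m - 1)) ^ i)"
    using period_quotient by blast
  have P: "(period m k :: 'k poly poly) = (\<Prod>d | d dvd k. dynK d)" if "k > 0" for k
    using arg_cong[OF period_prod[OF m that], of red] by (simp add: red_period red.hom_prod)
  have P1: "(period m 1 :: 'k poly poly) = dynK 1" using P[of 1] by simp
  have "{d. d dvd n} = insert 1 ({d. d dvd n} - {1})" by auto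
  then have "(period m n :: 'k poly poly) = dynK 1 * (\<Prod>d\<in>{d. d dvd n} - {1}. dynK d)"
    using P[of n] n by (metis (no_types, lifting) finite_Diff finite_divisors_nat gr_implies_not0
        insert_Diff_single prod.insert_remove zero_less_iff_neq_zero)
  moreover have "lead_coeff (period m 1 :: 'k poly poly) = 1" by (rule degree_period(2)[OF m]) simp
  then have "(period m 1 :: 'k poly poly) \<noteq> 0" by auto
  ultimately have "h = (\<Prod>d\<in>{d. d dvd n} - {1}. dynK d)" using h(1) P1 by simp
  then have "restr m h = (\<Prod>d\<in>{d. d dvd n} - {1}. restr m (dynK d))" by (simp add: restr.hom_prod)
  moreover obtain z where "h - (\<Sum>i<n. (of_nat m * var_x ^ (m - 1)) ^ i) = period m 1 * z"
    using h(2) by blast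
  then have "restr m (h - (\<Sum>i<n. (of_nat m * var_x ^ (m - 1)) ^ i)) = 0"
    by (simp only: restr.hom_mult restr_period_1 mult_zero_left)
  then have "restr m h = (\<Sum>i<n. multiplier ^ i)"
    by (simp add: restr.hom_minus restr.hom_sum restr.hom_power restr.hom_mult restr.hom_of_nat restr_var)
  ultimately show ?thesis by simp
qed

lemma geometric_sum: "(multiplier - 1) * (\<Sum>i<n. multiplier ^ i) = multiplier ^ n - 1"
  by (rule power_diff_1_eq[symmetric])

lemma degree_power_diff_one:
  assumes "n > 0" shows "degree (multiplier ^ n - 1) = n * (m - 1)"
proof -
  have "degree multiplier \<noteq> 0" unfolding multiplier_degree using m by simp
  then have "multiplier \<noteq> 0" by (metis degree_0)
  from degree_power_eq[OF this, of n] have "degree (multiplier ^ n) = n * (m - 1)"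
    by (simp only: multiplier_degree mult.commute)
  moreover have "n * (m - 1) > 0" using assms m by simp
  ultimately show ?thesis using degree_add_eq_left[of "-1" "multiplier ^ n"] by simp
qed

lemma degree_geometric_sum:
  assumes "n > 0"
  shows "degree (\<Sum>i<n. multiplier ^ i) = (n - 1) * (m - 1)" "(\<Sum>i<n. multiplier ^ i) \<noteq> 0"
proof -
  have d1: "degree (multiplier - 1) = m - 1" using degree_power_diff_one[of 1] by simp
  have "multiplier ^ n - 1 \<noteq> 0" using degree_power_diff_one[OF assms] assms m by auto
  then show nz: "(\<Sum>i<n. multiplier ^ i) \<noteq> 0" using geometric_sum[of n] by auto
  have "multiplier - 1 \<noteq> 0" using d1 m by auto
  then have "n * (m - 1) = (m - 1) + degree (\<Sum>i<n. multiplier ^ i)"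
    using degree_mult_eq[OF _ nz, of "multiplier - 1"] d1 degree_power_diff_one[OF assms] geometric_sum[of n]
    by simp
  then show "degree (\<Sum>i<n. multiplier ^ i) = (n - 1) * (m - 1)"
    using assms by (cases n) auto
qed

text \<open>The degree of the n-th cyclotomic polynomial in the multiplier. It is found by comparing
  degrees in the product formula, since the totients of the divisors of n add up to n.\<close>

lemma degree_restr_dynK: "n > 1 \<Longrightarrow> degree (restr m (dynK n)) = (m - 1) * totient n"
proof (induction n rule: less_induct)
  case (less n)
  let ?A = "{d. d dvd n} - {1}" and ?B = "{d. d dvd n} - {1, n}"
  have finA: "finite ?A" "finite ?B" using less.prems by auto
  have AB: "?A = insert n ?B" "n \<notin> ?B" using less.prems by auto
  have B: "1 < d \<and> d < n" if "d \<in> ?B" for d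
  proof -
    have d: "d dvd n" "d \<noteq> 1" "d \<noteq> n" using that by auto
    have "d \<le> n" "d > 0" using dvd_imp_le[OF d(1)] dvd_pos_nat[OF _ d(1)] less.prems by auto
    then show ?thesis using d by linarith
  qed
  have nz: "\<forall>d\<in>?A. restr m (dynK d) \<noteq> 0"
    using prod_restr_dynK[OF less.prems] degree_geometric_sum(2)[of n] less.prems finA
    by (metis (no_types, lifting) less_trans prod_zero_iff zero_less_one)
  have "(n - 1) * (m - 1) = degree (\<Prod>d\<in>?A. restr m (dynK d))"
    using prod_restr_dynK[OF less.prems] degree_geometric_sum(1)[of n] less.prems by simp
  also have "\<dots> = (\<Sum>d\<in>?A. degree (restr m (dynK d)))"
    by (rule degree_prod_eq_sum_degree) (use nz in blast)
  also have "\<dots> = degree (restr m (dynK n)) + (\<Sum>d\<in>?B. degree (restr m (dynK d)))"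
    using finA AB by simp
  also have "(\<Sum>d\<in>?B. degree (restr m (dynK d))) = (m - 1) * (\<Sum>d\<in>?B. totient d)"
    unfolding sum_distrib_left by (rule sum.cong) (use less.IH B in auto)
  finally have 1: "(n - 1) * (m - 1) = degree (restr m (dynK n)) + (m - 1) * (\<Sum>d\<in>?B. totient d)" .
  have "n = (\<Sum>d | d dvd n. totient d)" by (simp add: totient_divisor_sum)
  also have "{d. d dvd n} = insert 1 (insert n ?B)" by auto
  finally have "n - 1 = totient n + (\<Sum>d\<in>?B. totient d)" using finA less.prems by simp
  then show ?case using 1 by (simp add: distrib_left mult.commute)
qed

lemma restr_dynK_root:
  assumes n: "n > 1" shows "\<exists>x. poly (restr m (dynK n)) x = 0"
proof (rule alg_closed_imp_poly_has_root)
  show "degree (restr m (dynK n)) > 0" using degree_restr_dynK[OF n] m n by simp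
qed

text \<open>The restriction divides L^n - 1, where L is the multiplier. At a root L is nonzero,
  hence so is x, and the derivative n L^(n-1) m (m-1) x^(m-2) does not vanish there.\<close>

lemma restr_dynK_simple_root:
  assumes n: "n > 1" "of_nat n \<noteq> (0 :: 'k)" and root: "poly (restr m (dynK n)) x = 0"
  shows "\<exists>w. restr m (dynK n) = [:-x, 1:] * w \<and> poly w x \<noteq> 0"
proof -
  obtain w where w: "restr m (dynK n) = [:-x, 1:] * w"
    using root unfolding poly_eq_0_iff_dvd dvd_def by blast
  have "restr m (dynK n) dvd (\<Sum>i<n. multiplier ^ i)"
    unfolding prod_restr_dynK[OF n(1), symmetric] by (rule dvd_prodI) (use n in auto)
  then have "restr m (dynK n) dvd multiplier ^ n - 1"
    unfolding geometric_sum[symmetric] by simp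
  then obtain y where y: "multiplier ^ n - 1 = [:-x, 1:] * (w * y)" unfolding w by (metis dvdE mult.assoc)
  have "poly w x \<noteq> 0"
  proof
    assume w0: "poly w x = 0"
    have "poly (multiplier ^ n - 1) x = 0" unfolding y by simp
    then have 1: "poly multiplier x ^ n = 1" by simp
    then have l: "poly multiplier x \<noteq> 0" using n by (auto simp: power_0_left)
    then have x: "x \<noteq> 0" using m by (auto simp: power_0_left)
    have "poly (pderiv (multiplier ^ n - 1)) x = 0"
      unfolding y pderiv_mult by (simp add: w0 pderiv_pCons)
    then have "of_nat n * poly multiplier x ^ (n - 1) * poly (pderiv multiplier) x = 0"
      by (simp add: pderiv_diff pderiv_power mult_ac)
    moreover have "poly (pderiv multiplier) x = of_nat m * (of_nat (m - 1) * x ^ (m - 2))"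
    proof -
      have "multiplier = smult (of_nat m) ([:0, 1:] ^ (m - 1))" by (simp add: of_nat_poly)
      then show ?thesis by (simp add: pderiv_smult pderiv_power pderiv_pCons numeral_2_eq_2)
    qed
    ultimately show False using n l x mK m1K by simp
  qed
  then show ?thesis using w by blast
qed

text \<open>For n > 1 the degree is positive because a monic polynomial of degree zero is 1, which
  has no root on the curve of fixed points.\<close>

lemma monic_curve_dynK:
  assumes n: "n \<ge> 1"
  shows "monic_curve (dynK n)"
proof
  have mon: "lead_coeff (dyn m n) = 1" using dyn_monic[OF m] n by simp
  show lead: "lead_coeff (dynK n) = 1" by (rule red_monic(1)[OF mon])
  show "degree (dynK n) > 0"
  proof (cases "n = 1")
    case True
    have "period m 1 = dyn m 1" using period_prod[OF m, of 1] by simp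
    moreover have "degree (period m 1 :: int poly poly) = m" using degree_period(1)[OF m, of 1] by simp
    ultimately have "degree (dyn m 1) > 0" using m by simp
    then show ?thesis using red_monic(2)[OF mon, where 'r = 'k] True by simp
  next
    case False
    then have n1: "n > 1" using n by simp
    show ?thesis
    proof (rule ccontr)
      assume "\<not> degree (dynK n) > 0"
      then have "degree (dynK n) = 0" by simp
      then obtain a where "dynK n = [:a:]" by (auto elim: degree_eq_zeroE)
      then have "dynK n = 1" using lead by (simp flip: one_pCons)
      then have "restr m (dynK n) = 1" by (simp add: restr.hom_one)
      then show False using restr_dynK_root[OF n1] by simp
    qed
  qed
qed

lemma curve_action_dynK:
  assumes n: "n \<ge> 1" "of_nat n \<noteq> (0 :: 'k)"
  shows "curve_action (dynK n) (unicritical m) n"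
  by (intro curve_action.intro monic_curve_dynK poly_action_dyn m n)

lemma curve_action_trivial:
  assumes n: "n \<ge> 1"
  shows "curve_action (dynK n) [:0, 1:] (Suc 0)"
  by (intro curve_action.intro monic_curve_dynK poly_action_trivial n)

text \<open>The function f_c(x) - x is the uniformiser: modulo it the equation of the curve is x -
  x_0 times a polynomial nonzero at x_0, by simplicity of the root.\<close>

lemma fixed_point_regular:
  assumes n: "n > 1" "of_nat n \<noteq> (0 :: 'k)" and V: "eval2 x c (dynK n) = 0" and fixed: "x ^ m + c = x"
  shows "monic_curve.regular_at (dynK n) UNIV x c"
proof -
  interpret monic_curve "dynK n" by (rule monic_curve_dynK) (use n in simp)
  have c: "c = x - x ^ m" using fixed by (simp add: algebra_simps)
  have "poly (restr m (dynK n)) x = 0" using V by (simp add: poly_restr c)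
  then obtain w where w: "restr m (dynK n) = [:-x, 1:] * w" "poly w x \<noteq> 0"
    using restr_dynK_simple_root[OF n] by blast
  have e1: "lift_x [:-x, 1:] = [:[:-x:], 1:]" by (simp add: lift_x_pCons lift_x.hom_zero flip: one_pCons)
  have decomp: "\<exists>z. g = lift_x (restr m g) + period m 1 * z" for g :: "'k poly poly"
  proof -
    obtain z where "g - lift_x (restr m g) = period m 1 * z" using restr_decomp by blast
    then show ?thesis by (metis add.commute diff_add_cancel)
  qed
  obtain z where z: "dynK n = lift_x (restr m (dynK n)) + period m 1 * z" using decomp by blast
  show ?thesis
  proof (rule regular_at_transversal)
    show "eval2 x c (period m 1) = 0"
      by (simp add: period_def iter_1 unicritical_def var_x_def var_c_def fixed)
    show "eval2 x c (lift_x w) \<noteq> 0" using w(2) by (simp add: eval2_lift_x)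
    have "lift_x (restr m (dynK n)) = [:[:-x:], 1:] * lift_x w" by (simp only: w(1) lift_x.hom_mult e1)
    then show "dynK n = [:[:-x:], 1:] * lift_x w + period m 1 * z" using z by metis
    fix g :: "'k poly poly" assume "eval2 x c g = 0"
    then have "poly (restr m g) x = 0" by (simp add: poly_restr c)
    then obtain a where a: "restr m g = [:-x, 1:] * a" unfolding poly_eq_0_iff_dvd dvd_def by blast
    obtain b where "g = lift_x (restr m g) + period m 1 * b" using decomp by blast
    moreover have "lift_x (restr m g) = [:[:-x:], 1:] * lift_x a" by (simp only: a lift_x.hom_mult e1)
    ultimately show "\<exists>a b. g = [:[:-x:], 1:] * a + period m 1 * b" by metis
  qed
qed

lemma fixed_point_exists:
  assumes n: "n > 1"
  shows "\<exists>x c. eval2 x c (dynK n) = 0 \<and> x ^ m + c = x"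
proof -
  obtain x where "poly (restr m (dynK n)) x = 0" using restr_dynK_root[OF n] by blast
  then have "eval2 x (x - x ^ m) (dynK n) = 0" by (simp add: poly_restr)
  then show ?thesis by (intro exI[of _ x] exI[of _ "x - x ^ m"]) simp
qed

end

subsection \<open>Coordinates of the algebraic closure over the base field\<close>

interpretation ac: vector_space "\<lambda>(r :: 'k::field) (x :: 'k alg_closure). to_ac r * x"
  by unfold_locales (auto simp: algebra_simps)

declare ac.scale_scale [simp del] ac.scale_left_commute [simp del]

text \<open>Coordinates in a fixed basis of the closure over the base field. Being linear, they
  carry divisibility and invariance from the closure down to the base field.\<close>

definition coord :: "'k::field alg_closure \<Rightarrow> 'k alg_closure \<Rightarrow> 'k" where
  "coord t x = ac.representation (ac.extend_basis {}) x t"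

lemma ac_basis: "ac.independent (ac.extend_basis {})" "x \<in> ac.span (ac.extend_basis {})"
  using ac.independent_extend_basis[OF ac.independent_empty] ac.span_extend_basis[OF ac.independent_empty] by auto

lemma coord_add [simp]: "coord t (x + y) = coord t x + coord t y"
  by (simp add: coord_def ac.representation_add ac_basis)

lemma coord_scale [simp]: "coord t (to_ac r * x) = r * coord t x"
  by (simp add: coord_def ac.representation_scale ac_basis)

lemma coord_zero [simp]: "coord t 0 = 0"
  by (simp add: coord_def ac.representation_zero)

lemma coord_sum: "coord t (sum f A) = (\<Sum>i\<in>A. coord t (f i))"
  by (induction A rule: infinite_finite_induct) auto

lemma finite_coord: "finite {t. coord t x \<noteq> 0}"
  unfolding coord_def by (rule ac.finite_representation)

lemma coord_expansion:
  assumes "finite T" "{t. coord t x \<noteq> 0} \<subseteq> T"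
  shows "x = (\<Sum>t\<in>T. to_ac (coord t x) * t)"
proof -
  have "x = (\<Sum>t | coord t x \<noteq> 0. to_ac (coord t x) * t)"
    using ac.sum_nonzero_representation_eq[OF ac_basis, of x] by (simp add: coord_def)
  also have "\<dots> = (\<Sum>t\<in>T. to_ac (coord t x) * t)"
    by (rule sum.mono_neutral_left) (use assms in auto)
  finally show ?thesis .
qed

definition base_lift :: "'k::field poly poly \<Rightarrow> 'k alg_closure poly poly" where
  "base_lift = map_poly (map_poly to_ac)"

lemma base_lift_hom: "comm_ring_hom (base_lift :: 'k::field poly poly \<Rightarrow> 'k alg_closure poly poly)"
proof -
  have "comm_ring_hom (to_ac :: 'k \<Rightarrow> 'k alg_closure)" by unfold_locales auto
  then interpret a: map_poly_comm_ring_hom "to_ac :: 'k \<Rightarrow> 'k alg_closure"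
    by (simp add: map_poly_comm_ring_hom_def)
  have "comm_ring_hom (map_poly (to_ac :: 'k \<Rightarrow> 'k alg_closure))" by unfold_locales
  then interpret b: map_poly_comm_ring_hom "map_poly (to_ac :: 'k \<Rightarrow> 'k alg_closure)"
    by (simp add: map_poly_comm_ring_hom_def)
  show ?thesis unfolding base_lift_def by unfold_locales
qed

interpretation base_lift: comm_ring_hom base_lift
  by (rule base_lift_hom)

lemma base_lift_pCons: "base_lift (pCons a g) = pCons (map_poly to_ac a) (base_lift g)"
  by (simp add: base_lift_def map_poly_pCons_zero)

lemma coeff_base_lift: "coeff (coeff (base_lift g) i) j = to_ac (coeff (coeff g i) j)"
  by (simp add: base_lift_def coeff_map_poly)

lemma base_lift_pcompose: "base_lift (pcompose a b) = pcompose (base_lift a) (base_lift b)"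
proof (induction a)
  case 0
  show ?case by (simp add: base_lift.hom_zero)
next
  case (pCons c a)
  have "base_lift (pcompose (pCons c a) b) = base_lift [:c:] + base_lift b * base_lift (pcompose a b)"
    by (simp add: pcompose_pCons base_lift.hom_add base_lift.hom_mult)
  also have "base_lift [:c:] = [:map_poly to_ac c:]" by (simp add: base_lift_pCons base_lift.hom_zero)
  finally show ?case by (simp only: pCons.IH base_lift_pCons pcompose_pCons)
qed

lemma base_lift_red: "base_lift (red g :: 'k::field poly poly) = red g"
  by (simp add: poly_eq_iff coeff_base_lift red_def coeff_map_poly)

definition pcoord :: "'k::field alg_closure \<Rightarrow> 'k alg_closure poly poly \<Rightarrow> 'k poly poly" where
  "pcoord t = map_poly (map_poly (coord t))"

lemma coeff_pcoord: "coeff (coeff (pcoord t g) i) j = coord t (coeff (coeff g i) j)"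
  by (simp add: pcoord_def coeff_map_poly)

lemma poly_poly_eqI: "(\<And>i j. coeff (coeff a i) j = coeff (coeff b i) j) \<Longrightarrow> a = b"
  by (simp add: poly_eq_iff)

lemma pcoord_add: "pcoord t (a + b) = pcoord t a + pcoord t b"
  by (rule poly_poly_eqI) (simp add: coeff_pcoord)

lemma pcoord_zero [simp]: "pcoord t 0 = 0"
  by (simp add: pcoord_def)

lemma pcoord_diff: "pcoord t (a - b) = pcoord t a - pcoord t b"
  using pcoord_add[of t "a - b" b] by simp

lemma pcoord_mult: "pcoord t (base_lift a * g) = a * pcoord t g"
  by (rule poly_poly_eqI) (simp add: coeff_pcoord coeff_mult coeff_sum coord_sum coeff_base_lift)

lemma pcoord_const: "pcoord t (base_lift a * [:[:b:]:]) = a * [:[:coord t b:]:]"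
  unfolding pcoord_mult by (simp add: pcoord_def map_poly_pCons_zero)

text \<open>The substituted polynomial has coefficients in the base field, so taking coordinates
  commutes with the action.\<close>

lemma pcoord_pcompose: "pcoord t (pcompose g (base_lift f)) = pcompose (pcoord t g) f"
proof (induction g)
  case (pCons r g)
  have "pcoord t (pcompose (pCons r g) (base_lift f)) = pcoord t [:r:] + f * pcoord t (pcompose g (base_lift f))"
    by (simp add: pcompose_pCons pcoord_add pcoord_mult)
  moreover have "pcoord t (pCons r g) = pCons (map_poly (coord t) r) (pcoord t g)" for g
    by (simp add: pcoord_def map_poly_pCons_zero)
  ultimately show ?case by (simp add: pCons.IH pcompose_pCons)
qed simp

lemma pcoord_dvd: "base_lift F dvd g \<Longrightarrow> F dvd pcoord t g"
  by (auto elim!: dvdE simp: pcoord_mult)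

lemma pcoord_expansion:
  "\<exists>T. finite T \<and> g = (\<Sum>t\<in>T. base_lift (pcoord t g) * [:[:t:]:])"
proof -
  define T where "T = (\<Union>i\<le>degree g. \<Union>j\<le>degree (coeff g i). {t. coord t (coeff (coeff g i) j) \<noteq> 0})"
  have fin: "finite T" unfolding T_def using finite_coord by auto
  have sub: "{t. coord t (coeff (coeff g i) j) \<noteq> 0} \<subseteq> T" for i j
  proof (cases "i \<le> degree g \<and> j \<le> degree (coeff g i)")
    case False
    then have "coeff (coeff g i) j = 0" using coeff_eq_0[of g i] coeff_eq_0[of "coeff g i" j] by fastforce
    then show ?thesis by simp
  qed (auto simp: T_def)
  have "g = (\<Sum>t\<in>T. base_lift (pcoord t g) * [:[:t:]:])"
  proof (rule poly_poly_eqI)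
    fix i j
    have "coeff (coeff (\<Sum>t\<in>T. base_lift (pcoord t g) * [:[:t:]:]) i) j
        = (\<Sum>t\<in>T. to_ac (coord t (coeff (coeff g i) j)) * t)"
      by (simp add: coeff_sum coeff_base_lift coeff_pcoord mult.commute)
    also have "\<dots> = coeff (coeff g i) j" using coord_expansion[OF fin sub] by simp
    finally show "coeff (coeff g i) j = coeff (coeff (\<Sum>t\<in>T. base_lift (pcoord t g) * [:[:t:]:]) i) j" by simp
  qed
  then show ?thesis using fin by blast
qed

subsection \<open>The integral monoid ring\<close>

definition frag_mult :: "('x, 'm) monoid_scheme \<Rightarrow> ('x \<Rightarrow>\<^sub>0 int) \<Rightarrow> ('x \<Rightarrow>\<^sub>0 int) \<Rightarrow> ('x \<Rightarrow>\<^sub>0 int)" where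
  "frag_mult M f g = frag_extend (\<lambda>u. frag_extend (\<lambda>v. frag_of (u \<otimes>\<^bsub>M\<^esub> v)) g) f"

lemma frag_cmul_diff: "frag_cmul k (a - b) = frag_cmul k a - frag_cmul k b"
  by (rule poly_mapping_eqI) (simp add: lookup_minus right_diff_distrib)

lemma frag_extend_fun_diff: "frag_extend (\<lambda>x. f x - g x) u = frag_extend f u - frag_extend g u"
  by (simp add: frag_extend_def frag_cmul_diff sum_subtractf)

lemma frag_extend_fun_zero: "frag_extend (\<lambda>x. 0) u = 0"
  by (simp add: frag_extend_def)

lemma frag_mult_diff_left: "frag_mult M (a - b) c = frag_mult M a c - frag_mult M b c"
  by (simp add: frag_mult_def frag_extend_diff)

lemma frag_mult_diff_right: "frag_mult M c (a - b) = frag_mult M c a - frag_mult M c b"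
  by (simp add: frag_mult_def frag_extend_diff frag_extend_fun_diff)

lemma frag_mult_zero: "frag_mult M 0 c = 0" "frag_mult M c 0 = 0"
  by (simp_all add: frag_mult_def frag_extend_fun_zero)

lemma frag_mult_of: "frag_mult M (frag_of x) (frag_of y) = frag_of (x \<otimes>\<^bsub>M\<^esub> y)"
  by (simp add: frag_mult_def)

lemma frag_mult_add: "frag_mult M (a + b) c = frag_mult M a c + frag_mult M b c"
  using frag_mult_diff_left[of M "a + b" b c] by (simp add: algebra_simps)

lemma monoid_ring_simps:
  "carrier (monoid_ring M) = {f. Poly_Mapping.keys f \<subseteq> carrier M}"
  "f \<otimes>\<^bsub>monoid_ring M\<^esub> g = frag_mult M f g" "f \<oplus>\<^bsub>monoid_ring M\<^esub> g = f + g"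
  "\<one>\<^bsub>monoid_ring M\<^esub> = frag_of \<one>\<^bsub>M\<^esub>" "\<zero>\<^bsub>monoid_ring M\<^esub> = 0"
  by (simp_all add: monoid_ring_def frag_mult_def)

lemma keys_closed_diff: "Poly_Mapping.keys (a :: 'x \<Rightarrow>\<^sub>0 int) \<subseteq> S \<Longrightarrow> Poly_Mapping.keys b \<subseteq> S \<Longrightarrow> Poly_Mapping.keys (a - b) \<subseteq> S"
  using keys_diff[of a b] by blast

lemma keys_closed_add: "Poly_Mapping.keys (a :: 'x \<Rightarrow>\<^sub>0 int) \<subseteq> S \<Longrightarrow> Poly_Mapping.keys b \<subseteq> S \<Longrightarrow> Poly_Mapping.keys (a + b) \<subseteq> S"
  using keys_add[of a b] by blast

text \<open>Multiplication is biadditive, so \<open>frag_induction\<close> in each argument reduces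
  the laws to generators, where they are laws of \<open>M\<close>.\<close>

lemma cring_monoid_ring:
  assumes M: "comm_monoid M"
  shows "cring (monoid_ring M)"
proof -
  interpret comm_monoid M by (rule M)
  let ?C = "carrier M"
  have closed: "Poly_Mapping.keys (frag_mult M f g) \<subseteq> ?C"
    if f: "Poly_Mapping.keys f \<subseteq> ?C" and g: "Poly_Mapping.keys g \<subseteq> ?C" for f g
    using f
  proof (induction f rule: frag_induction)
    case (one x)
    show ?case using g
      by (induction g rule: frag_induction)
        (use one in \<open>simp_all add: frag_mult_zero frag_mult_of frag_mult_diff_right keys_closed_diff\<close>)
  next
    case (diff a b)
    then show ?case by (simp add: frag_mult_diff_left keys_closed_diff)
  qed (simp add: frag_mult_zero)
  have comm: "frag_mult M f g = frag_mult M g f"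
    if f: "Poly_Mapping.keys f \<subseteq> ?C" and g: "Poly_Mapping.keys g \<subseteq> ?C" for f g
    using f
  proof (induction f rule: frag_induction)
    case (one x)
    show ?case using g
      by (induction g rule: frag_induction)
        (use one m_comm in \<open>auto simp: frag_mult_zero frag_mult_of frag_mult_diff_left frag_mult_diff_right\<close>)
  qed (simp_all add: frag_mult_zero frag_mult_diff_left frag_mult_diff_right)
  have assoc: "frag_mult M (frag_mult M f g) k = frag_mult M f (frag_mult M g k)"
    if f: "Poly_Mapping.keys f \<subseteq> ?C" and g: "Poly_Mapping.keys g \<subseteq> ?C" and k: "Poly_Mapping.keys k \<subseteq> ?C" for f g k
    using f
  proof (induction f rule: frag_induction)
    case (one x)
    show ?case using g
    proof (induction g rule: frag_induction)
      case (one y)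
      show ?case using k
        by (induction k rule: frag_induction)
          (use one \<open>x \<in> ?C\<close> m_assoc in \<open>auto simp: frag_mult_zero frag_mult_of frag_mult_diff_right\<close>)
    qed (simp_all add: frag_mult_zero frag_mult_diff_left frag_mult_diff_right)
  qed (simp_all add: frag_mult_zero frag_mult_diff_left)
  have unit: "frag_mult M (frag_of \<one>\<^bsub>M\<^esub>) f = f" if f: "Poly_Mapping.keys f \<subseteq> ?C" for f
    using f by (induction f rule: frag_induction) (auto simp: frag_mult_zero frag_mult_of frag_mult_diff_right)
  have cyc: "\<exists>g\<in>carrier (monoid_ring M). g \<oplus>\<^bsub>monoid_ring M\<^esub> f = \<zero>\<^bsub>monoid_ring M\<^esub>"
    if "f \<in> carrier (monoid_ring M)" for f
    using that by (intro bexI[of _ "- f"]) (simp_all add: monoid_ring_simps)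
  show "cring (monoid_ring M)"
  proof (rule cringI_laws)
    show "\<zero>\<^bsub>monoid_ring M\<^esub> \<in> carrier (monoid_ring M)" "\<one>\<^bsub>monoid_ring M\<^esub> \<in> carrier (monoid_ring M)"
      by (simp_all add: monoid_ring_simps)
    show "\<exists>g\<in>carrier (monoid_ring M). g \<oplus>\<^bsub>monoid_ring M\<^esub> f = \<zero>\<^bsub>monoid_ring M\<^esub>"
      if "f \<in> carrier (monoid_ring M)" for f using that by (rule cyc)
    show "f \<otimes>\<^bsub>monoid_ring M\<^esub> g = g \<otimes>\<^bsub>monoid_ring M\<^esub> f"
      if "f \<in> carrier (monoid_ring M)" "g \<in> carrier (monoid_ring M)" for f g
      using that comm by (simp add: monoid_ring_simps)
  qed (simp_all add: monoid_ring_simps add.assoc add.commute frag_mult_add closed assoc unit keys_closed_add)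
qed

lemma ring_of_type_algebra_simps [simp]:
  "carrier ring_of_type_algebra = UNIV" "b \<otimes>\<^bsub>ring_of_type_algebra\<^esub> c = b * c"
  "\<one>\<^bsub>ring_of_type_algebra\<^esub> = 1" "b \<oplus>\<^bsub>ring_of_type_algebra\<^esub> c = b + c"
  by (simp_all add: ring_of_type_algebra_def)

section \<open>Base change of a presented ring to the algebraic closure\<close>

text \<open>\<open>DK\<close> is the candidate for the scalar extension of \<open>E\<close>. The
  last two conditions say that \<open>DK\<close> is spanned by \<open>E\<close> over the closure:
  lifts of \<open>E\<close> lie in it, and the coordinates of its elements lie in
  \<open>E\<close>.\<close>

locale tensor_presented = presented_ring A E "{g. F dvd g}" cl
  for A :: "'a ring" and F :: "'k::field poly poly" and E :: "'k poly poly set" and cl :: "'k poly poly \<Rightarrow> 'a" +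
  fixes DK :: "'k alg_closure poly poly set"
  assumes const_E: "[:[:r:]:] \<in> E"
    and subring_DK: "subring_ideal DK {g. base_lift F dvd g}"
    and const_DK: "[:[:b:]:] \<in> DK"
    and lift_DK: "a \<in> E \<Longrightarrow> base_lift a \<in> DK"
    and coord_E: "g \<in> DK \<Longrightarrow> pcoord t g \<in> E"
begin

interpretation DK: subring_ideal DK "{g. base_lift F dvd g}"
  by (rule subring_DK)

definition smap :: "'k \<Rightarrow> 'a" where "smap r = cl [:[:r:]:]"

abbreviation M :: "('a \<times> 'k alg_closure) monoid" where "M \<equiv> A \<times>\<times> ring_of_type_algebra"

abbreviation MR :: "('a \<times> 'k alg_closure \<Rightarrow>\<^sub>0 int) ring" where "MR \<equiv> monoid_ring M"

abbreviation J :: "('a \<times> 'k alg_closure \<Rightarrow>\<^sub>0 int) set" where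
  "J \<equiv> Idl\<^bsub>MR\<^esub> (tensor_relations A smap ring_of_type_algebra to_ac)"

lemma comm_monoid_M: "comm_monoid M"
proof -
  interpret A: cring A by (rule cring_A)
  show ?thesis
    by (rule comm_monoidI) (auto simp: A.m_assoc mult.assoc intro: A.m_comm)
qed

lemma cring_MR: "cring MR"
  by (rule cring_monoid_ring[OF comm_monoid_M])

sublocale MR: cring MR
  by (rule cring_MR)

text \<open>A chosen polynomial for each element of \<open>A\<close>. The choice is canonical only
  modulo \<open>F\<close>, so what is built on it obeys the algebraic laws only modulo
  \<open>F\<close>.\<close>

definition rep :: "'a \<Rightarrow> 'k poly poly" where "rep U = (SOME a. a \<in> E \<and> cl a = U)"

lemma rep: "a \<in> E \<Longrightarrow> rep (cl a) \<in> E" "a \<in> E \<Longrightarrow> cl (rep (cl a)) = cl a"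
  using someI_ex[of "\<lambda>b. b \<in> E \<and> cl b = cl a"] by (auto simp: rep_def)

lemma rep_dvd: "a \<in> E \<Longrightarrow> F dvd rep (cl a) - a"
  using rep[of a] h_eq_iff[of "rep (cl a)" a] by simp

text \<open>The value of the pure tensor of the two components, as a polynomial over the closure;
  \<open>ev\<close> extends it additively.\<close>

definition gen :: "'a \<times> 'k alg_closure \<Rightarrow> 'k alg_closure poly poly" where
  "gen p = base_lift (rep (fst p)) * [:[:snd p:]:]"

definition ev :: "('a \<times> 'k alg_closure \<Rightarrow>\<^sub>0 int) \<Rightarrow> 'k alg_closure poly poly" where
  "ev u = (\<Sum>p\<in>Poly_Mapping.keys u. of_int (Poly_Mapping.lookup u p) * gen p)"

lemma ev_superset:
  assumes "finite S" "Poly_Mapping.keys u \<subseteq> S"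
  shows "ev u = (\<Sum>p\<in>S. of_int (Poly_Mapping.lookup u p) * gen p)"
  unfolding ev_def using assms
  by (intro sum.mono_neutral_left) (auto simp: in_keys_iff)

lemma ev_diff: "ev (u - v) = ev u - ev v"
proof -
  let ?S = "Poly_Mapping.keys u \<union> Poly_Mapping.keys v"
  have S: "finite ?S" "Poly_Mapping.keys u \<subseteq> ?S" "Poly_Mapping.keys v \<subseteq> ?S"
    "Poly_Mapping.keys (u - v) \<subseteq> ?S" using keys_diff[of u v] by auto
  show ?thesis
    unfolding ev_superset[OF S(1,2)] ev_superset[OF S(1,3)] ev_superset[OF S(1,4)]
    by (simp add: lookup_minus left_diff_distrib sum_subtractf)
qed

lemma ev_zero [simp]: "ev 0 = 0"
  by (simp add: ev_def)

lemma ev_add: "ev (u + v) = ev u + ev v"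
  using ev_diff[of "u + v" v] by (simp add: algebra_simps)

lemma ev_of [simp]: "ev (frag_of p) = gen p"
  by (simp add: ev_def)

lemma lift_dvd: "F dvd a \<Longrightarrow> base_lift F dvd base_lift a"
  by (auto elim!: dvdE simp: base_lift.hom_mult)

lemma gen_cl:
  assumes "a \<in> E"
  shows "base_lift F dvd gen (cl a, b) - base_lift a * [:[:b:]:]"
proof -
  have "gen (cl a, b) - base_lift a * [:[:b:]:] = base_lift (rep (cl a) - a) * [:[:b:]:]"
    unfolding gen_def fst_conv snd_conv base_lift.hom_minus left_diff_distrib ..
  then show ?thesis using lift_dvd[OF rep_dvd[OF assms]] by (metis dvd_mult2)
qed

lemma gen_DK: "U \<in> cl ` E \<Longrightarrow> gen (U, b) \<in> DK"
  unfolding gen_def fst_conv snd_conv by (intro DK.D_mult lift_DK const_DK) (auto intro: rep(1))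

lemma ev_DK:
  assumes "Poly_Mapping.keys u \<subseteq> carrier M"
  shows "ev u \<in> DK"
  using assms by (induction u rule: frag_induction) (auto simp: carrier_A gen_DK ev_diff)

lemma ev_mult:
  assumes u: "Poly_Mapping.keys u \<subseteq> carrier M" and v: "Poly_Mapping.keys v \<subseteq> carrier M"
  shows "base_lift F dvd ev (frag_mult M u v) - ev u * ev v"
  using u
proof (induction u rule: frag_induction)
  case (one x)
  show ?case using v
  proof (induction v rule: frag_induction)
    case (one y)
    obtain a b c d where ab: "a \<in> E" "c \<in> E" "x = (cl a, b)" "y = (cl c, d)"
      using one \<open>x \<in> carrier M\<close> by (auto simp: carrier_A)
    let ?A = "base_lift a * [:[:b:]:]" and ?C = "base_lift c * [:[:d:]:]"
    have g: "base_lift F dvd gen x - ?A" "base_lift F dvd gen y - ?C" using gen_cl ab by auto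
    have "x \<otimes>\<^bsub>M\<^esub> y = (cl (a * c), b * d)" using ab by (simp add: carrier_A h_mult)
    then have 1: "base_lift F dvd gen (x \<otimes>\<^bsub>M\<^esub> y) - base_lift (a * c) * [:[:b * d:]:]"
      using gen_cl[of "a * c" "b * d"] ab by simp
    have "[:[:b * d:]:] = [:[:b:]:] * [:[:d:]:]" by simp
    then have AC: "base_lift (a * c) * [:[:b * d:]:] = ?A * ?C"
      by (simp only: base_lift.hom_mult mult_ac)
    have "gen (x \<otimes>\<^bsub>M\<^esub> y) - gen x * gen y = (gen (x \<otimes>\<^bsub>M\<^esub> y) - ?A * ?C)
        - ((gen x - ?A) * gen y + ?A * (gen y - ?C))"
      by (simp only: algebra_simps)
    also have "base_lift F dvd \<dots>"
      by (rule dvd_diff[OF 1[unfolded AC] dvd_add[OF dvd_mult2[OF g(1)] dvd_mult[OF g(2)]]])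
    finally show ?case by (simp add: frag_mult_of)
  next
    case (diff v w)
    have "ev (frag_mult M (frag_of x) (v - w)) - ev (frag_of x) * ev (v - w)
      = (ev (frag_mult M (frag_of x) v) - ev (frag_of x) * ev v) - (ev (frag_mult M (frag_of x) w) - ev (frag_of x) * ev w)"
      by (simp add: frag_mult_diff_right ev_diff algebra_simps)
    then show ?case using diff by (metis dvd_diff)
  qed (simp add: frag_mult_zero)
next
  case (diff u w)
  have "ev (frag_mult M (u - w) v) - ev (u - w) * ev v
    = (ev (frag_mult M u v) - ev u * ev v) - (ev (frag_mult M w v) - ev w * ev v)"
    by (simp add: frag_mult_diff_left ev_diff algebra_simps)
  then show ?case using diff by (metis dvd_diff)
qed (simp add: frag_mult_zero)

text \<open>The kernel of \<open>ev\<close> modulo \<open>F\<close>, to be identified with the ideal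
  \<open>J\<close> of tensor relations.\<close>

definition K0 :: "('a \<times> 'k alg_closure \<Rightarrow>\<^sub>0 int) set" where
  "K0 = {u \<in> carrier MR. base_lift F dvd ev u}"

lemma MR_uminus: "u \<in> carrier MR \<Longrightarrow> \<ominus>\<^bsub>MR\<^esub> u = - u"
  by (rule MR.minus_equality) (auto simp: monoid_ring_simps)

lemma MR_simps: "u \<in> carrier MR \<longleftrightarrow> Poly_Mapping.keys u \<subseteq> carrier M"
  by (simp add: monoid_ring_simps)

lemma ev_uminus: "ev (- u) = - ev u"
  using ev_diff[of 0 u] by simp

lemma K0_ideal: "ideal K0 MR"
proof (rule idealI[OF MR.ring_axioms])
  show "subgroup K0 (add_monoid MR)"
  proof (rule MR.add.subgroupI)
    show "K0 \<subseteq> carrier MR" by (auto simp: K0_def)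
    have "0 \<in> K0" by (simp add: K0_def MR_simps)
    then show "K0 \<noteq> {}" by blast
    show "\<ominus>\<^bsub>MR\<^esub> u \<in> K0" if "u \<in> K0" for u
      using that by (simp add: K0_def MR_uminus MR_simps ev_uminus)
    show "u \<oplus>\<^bsub>MR\<^esub> v \<in> K0" if "u \<in> K0" "v \<in> K0" for u v
      using that by (simp add: K0_def monoid_ring_simps ev_add keys_closed_add)
  qed
  show mult: "v \<otimes>\<^bsub>MR\<^esub> u \<in> K0" if "u \<in> K0" "v \<in> carrier MR" for u v
  proof -
    have c: "v \<otimes>\<^bsub>MR\<^esub> u \<in> carrier MR" using that MR.m_closed by (auto simp: K0_def)
    have "base_lift F dvd ev (frag_mult M v u) - ev v * ev u"
      using that by (intro ev_mult) (auto simp: K0_def MR_simps)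
    moreover have "base_lift F dvd ev v * ev u" using that by (simp add: K0_def)
    ultimately have "base_lift F dvd ev (frag_mult M v u)" using dvd_diff_left_iff by blast
    then show ?thesis using c by (simp add: K0_def monoid_ring_simps(2))
  qed
  show "u \<otimes>\<^bsub>MR\<^esub> v \<in> K0" if "u \<in> K0" "v \<in> carrier MR" for u v
    using mult[OF that] that MR.m_comm[of u v] by (auto simp: K0_def)
qed

lemma gen_add_left:
  assumes "a \<in> E" "a' \<in> E"
  shows "base_lift F dvd gen (cl a \<oplus>\<^bsub>A\<^esub> cl a', b) - gen (cl a, b) - gen (cl a', b)"
proof -
  let ?B = "[:[:b:]:]"
  have "gen (cl (a + a'), b) - gen (cl a, b) - gen (cl a', b)
      = (gen (cl (a + a'), b) - base_lift (a + a') * ?B) - (gen (cl a, b) - base_lift a * ?B)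
        - (gen (cl a', b) - base_lift a' * ?B)"
    by (simp only: base_lift.hom_add distrib_right) (simp only: algebra_simps)
  also have "base_lift F dvd \<dots>"
    using gen_cl[OF D_add[OF assms]] gen_cl[OF assms(1)] gen_cl[OF assms(2)] by (rule dvd_diff[OF dvd_diff])
  finally show ?thesis using assms by (simp add: h_add)
qed

lemma relations_K0: "tensor_relations A smap ring_of_type_algebra to_ac \<subseteq> K0"
proof
  fix u assume "u \<in> tensor_relations A smap ring_of_type_algebra to_ac"
  then consider (left) a a' b where "a \<in> E" "a' \<in> E"
      "u = frag_of (cl a \<oplus>\<^bsub>A\<^esub> cl a', b) - frag_of (cl a, b) - frag_of (cl a', b)"
    | (right) a b b' where "a \<in> E" "u = frag_of (cl a, b + b') - frag_of (cl a, b) - frag_of (cl a, b')"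
    | (bal) a b r where "a \<in> E" "u = frag_of (smap r \<otimes>\<^bsub>A\<^esub> cl a, b) - frag_of (cl a, to_ac r * b)"
    unfolding tensor_relations_def carrier_A by (auto simp: ring_of_type_algebra_def)
  then show "u \<in> K0"
  proof cases
    case left
    then have "u \<in> carrier MR" unfolding MR_simps left(3)
      by (intro keys_closed_diff) (auto simp: carrier_A h_add)
    then show ?thesis using left gen_add_left by (simp add: K0_def ev_diff)
  next
    case right
    then have "u \<in> carrier MR" unfolding MR_simps right(2)
      by (intro keys_closed_diff) (auto simp: carrier_A)
    moreover have "gen (cl a, b + b') - gen (cl a, b) - gen (cl a, b') = 0"
    proof -
      have "[:[:b + b':]:] = [:[:b:]:] + [:[:b':]:]" by simp
      then show ?thesis by (simp only: gen_def fst_conv snd_conv distrib_left) simp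
    qed
    ultimately show ?thesis using right by (simp add: K0_def ev_diff)
  next
    case bal
    have m: "smap r \<otimes>\<^bsub>A\<^esub> cl a = cl ([:[:r:]:] * a)" using bal const_E by (simp only: smap_def h_mult)
    have c: "[:[:r:]:] * a \<in> E" by (rule D_mult[OF const_E bal(1)])
    have "u \<in> carrier MR" unfolding MR_simps bal(2) m
      by (intro keys_closed_diff) (use c bal in \<open>auto simp: carrier_A\<close>)
    moreover have "base_lift F dvd gen (cl ([:[:r:]:] * a), b) - gen (cl a, to_ac r * b)"
    proof -
      have "[:[:to_ac r * b:]:] = [:[:to_ac r:]:] * [:[:b:]:]" by simp
      moreover have "base_lift [:[:r:]:] = [:[:to_ac r:]:]"
        by (simp add: base_lift_pCons map_poly_pCons_zero base_lift.hom_zero)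
      ultimately have "base_lift ([:[:r:]:] * a) * [:[:b:]:] = base_lift a * [:[:to_ac r * b:]:]"
        by (simp only: base_lift.hom_mult mult_ac)
      then have "gen (cl ([:[:r:]:] * a), b) - gen (cl a, to_ac r * b) =
         (gen (cl ([:[:r:]:] * a), b) - base_lift ([:[:r:]:] * a) * [:[:b:]:])
          - (gen (cl a, to_ac r * b) - base_lift a * [:[:to_ac r * b:]:])" by simp
      also have "base_lift F dvd \<dots>" using gen_cl[OF c] gen_cl[OF bal(1)] by (rule dvd_diff)
      finally show ?thesis .
    qed
    ultimately show ?thesis using bal m by (simp add: K0_def ev_diff)
  qed
qed

lemma J_ideal: "ideal J MR"
  using relations_K0 by (intro MR.genideal_ideal) (auto simp: K0_def)

lemma J_K0: "J \<subseteq> K0"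
  by (rule MR.genideal_minimal[OF K0_ideal relations_K0])

lemma J_mem: "u \<in> tensor_relations A smap ring_of_type_algebra to_ac \<Longrightarrow> u \<in> J"
  using MR.genideal_self[of "tensor_relations A smap ring_of_type_algebra to_ac"] relations_K0
  by (auto simp: K0_def)

lemma J_closed:
  shows "0 \<in> J" "u \<in> J \<Longrightarrow> v \<in> J \<Longrightarrow> u + v \<in> J" "u \<in> J \<Longrightarrow> - u \<in> J" "u \<in> J \<Longrightarrow> v \<in> J \<Longrightarrow> u - v \<in> J"
proof -
  interpret J: ideal J MR by (rule J_ideal)
  show "0 \<in> J" using additive_subgroup.zero_closed[OF J.is_additive_subgroup] by (simp add: monoid_ring_simps)
  show add: "u + v \<in> J" if "u \<in> J" "v \<in> J" for u v
    using additive_subgroup.a_closed[OF J.is_additive_subgroup that] by (simp add: monoid_ring_simps)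
  show neg: "- u \<in> J" if "u \<in> J" for u
    using additive_subgroup.a_inv_closed[OF J.is_additive_subgroup that] MR_uminus[of u] that J_K0
    by (auto simp: K0_def)
  show "u - v \<in> J" if "u \<in> J" "v \<in> J" using add[OF that(1) neg[OF that(2)]] by simp
qed

lemma J_left: "a \<in> E \<Longrightarrow> a' \<in> E \<Longrightarrow> frag_of (cl (a + a'), b) - frag_of (cl a, b) - frag_of (cl a', b) \<in> J"
  by (rule J_mem) (auto simp: tensor_relations_def carrier_A h_add[symmetric] ring_of_type_algebra_def)

lemma J_right: "a \<in> E \<Longrightarrow> frag_of (cl a, b + b') - frag_of (cl a, b) - frag_of (cl a, b') \<in> J"
  by (rule J_mem) (auto simp: tensor_relations_def carrier_A ring_of_type_algebra_def)

lemma J_balanced: "a \<in> E \<Longrightarrow> frag_of (cl ([:[:r:]:] * a), b) - frag_of (cl a, to_ac r * b) \<in> J"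
proof -
  assume a: "a \<in> E"
  then have "cl ([:[:r:]:] * a) = smap r \<otimes>\<^bsub>A\<^esub> cl a" using const_E by (simp only: smap_def h_mult)
  then show ?thesis using a
    by (intro J_mem) (auto simp: tensor_relations_def carrier_A ring_of_type_algebra_def)
qed

lemma J_zero_left: "frag_of (cl 0, b) \<in> J"
  using J_closed(3)[OF J_left[of 0 0 b]] by simp

lemma J_zero_right: "a \<in> E \<Longrightarrow> frag_of (cl a, 0) \<in> J"
  using J_closed(3)[OF J_right[of a 0 0]] by simp

lemma J_sum_right:
  assumes "finite T" "a \<in> E"
  shows "frag_of (cl a, \<Sum>t\<in>T. f t) - (\<Sum>t\<in>T. frag_of (cl a, f t)) \<in> J"
  using assms(1)
proof (induction T)
  case empty
  then show ?case using J_zero_right[OF assms(2)] by simp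
next
  case (insert s T)
  have "(frag_of (cl a, f s + (\<Sum>t\<in>T. f t)) - frag_of (cl a, f s) - frag_of (cl a, \<Sum>t\<in>T. f t))
    + (frag_of (cl a, \<Sum>t\<in>T. f t) - (\<Sum>t\<in>T. frag_of (cl a, f t))) \<in> J"
    by (rule J_closed(2)[OF J_right[OF assms(2)] insert.IH])
  then show ?case using insert by (simp add: algebra_simps)
qed

lemma J_sum: "(\<And>t. t \<in> T \<Longrightarrow> f t \<in> J) \<Longrightarrow> sum f T \<in> J"
  by (induction T rule: infinite_finite_induct) (auto intro: J_closed)

text \<open>Modulo the relations, every tensor is \<open>\<Sum> a\<^sub>t \<otimes> t\<close> over a basis, with \<open>a\<^sub>t\<close> the coordinates of its value.\<close>

lemma tensor_normal_form:
  assumes T: "finite T"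
    and u: "Poly_Mapping.keys u \<subseteq> {(cl a, b) | a b. a \<in> E \<and> {t. coord t b \<noteq> 0} \<subseteq> T}" (is "_ \<subseteq> ?S")
  shows "u - (\<Sum>t\<in>T. frag_of (cl (pcoord t (ev u)), t)) \<in> J \<and> ev u \<in> DK"
  using u
proof (induction u rule: frag_induction)
  case zero
  show ?case using J_closed(3)[OF J_sum[of T "\<lambda>t. frag_of (cl 0, t)"]] J_zero_left by simp
next
  case (one x)
  then obtain a b where ab: "a \<in> E" "{t. coord t b \<noteq> 0} \<subseteq> T" "x = (cl a, b)" by blast
  have r: "rep (cl a) \<in> E" "cl (rep (cl a)) = cl a" using rep ab by auto
  let ?a = "rep (cl a)"
  have pc: "pcoord t (ev (frag_of x)) = [:[:coord t b:]:] * ?a" for t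
  proof -
    have "pcoord t (ev (frag_of x)) = ?a * [:[:coord t b:]:]"
      unfolding ev_of gen_def ab(3) fst_conv snd_conv by (rule pcoord_const)
    then show ?thesis by (simp only: mult.commute)
  qed
  \<comment> \<open>The second component is expanded along the basis; the balancing relation then
    moves each scalar coordinate to the first component.\<close>
  have "frag_of (cl ?a, \<Sum>t\<in>T. to_ac (coord t b) * t) - (\<Sum>t\<in>T. frag_of (cl ?a, to_ac (coord t b) * t)) \<in> J"
    by (rule J_sum_right[OF T r(1)])
  moreover have "(\<Sum>t\<in>T. frag_of (cl ([:[:coord t b:]:] * ?a), t) - frag_of (cl ?a, to_ac (coord t b) * t)) \<in> J"
    by (rule J_sum) (rule J_balanced[OF r(1)])
  ultimately have "(frag_of (cl ?a, \<Sum>t\<in>T. to_ac (coord t b) * t) - (\<Sum>t\<in>T. frag_of (cl ?a, to_ac (coord t b) * t)))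
     - (\<Sum>t\<in>T. frag_of (cl ([:[:coord t b:]:] * ?a), t) - frag_of (cl ?a, to_ac (coord t b) * t)) \<in> J"
    by (rule J_closed(4))
  then have "frag_of (cl ?a, \<Sum>t\<in>T. to_ac (coord t b) * t) - (\<Sum>t\<in>T. frag_of (cl ([:[:coord t b:]:] * ?a), t)) \<in> J"
    by (simp add: sum_subtractf)
  then have "frag_of x - (\<Sum>t\<in>T. frag_of (cl (pcoord t (ev (frag_of x))), t)) \<in> J"
    unfolding pc using coord_expansion[OF T ab(2)] ab(3) r(2) by simp
  moreover have "ev (frag_of x) \<in> DK" using gen_DK ab by simp
  ultimately show ?case by blast
next
  case (diff u v)
  \<comment> \<open>The coordinate of \<open>ev u\<close> is the sum of those of
    \<open>ev u - ev v\<close> and \<open>ev v\<close>, so this is the relation of additivity on the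
    left.\<close>
  have "frag_of (cl (pcoord t (ev u)), t) - frag_of (cl (pcoord t (ev u - ev v)), t)
      - frag_of (cl (pcoord t (ev v)), t) \<in> J" for t
  proof -
    have "pcoord t (ev u - ev v) \<in> E" "pcoord t (ev v) \<in> E" using diff coord_E DK.D_diff by auto
    from J_left[OF this, of t] show ?thesis by (simp add: pcoord_diff)
  qed
  then have s: "(\<Sum>t\<in>T. frag_of (cl (pcoord t (ev u)), t) - frag_of (cl (pcoord t (ev u - ev v)), t)
      - frag_of (cl (pcoord t (ev v)), t)) \<in> J" by (rule J_sum)
  have "(u - (\<Sum>t\<in>T. frag_of (cl (pcoord t (ev u)), t))) - (v - (\<Sum>t\<in>T. frag_of (cl (pcoord t (ev v)), t)))
     + (\<Sum>t\<in>T. frag_of (cl (pcoord t (ev u)), t) - frag_of (cl (pcoord t (ev u - ev v)), t)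
      - frag_of (cl (pcoord t (ev v)), t)) \<in> J"
    using diff s by (intro J_closed(2)[OF J_closed(4)]) auto
  then have "u - v - (\<Sum>t\<in>T. frag_of (cl (pcoord t (ev (u - v))), t)) \<in> J"
    by (simp add: sum_subtractf sum.distrib ev_diff algebra_simps)
  then show ?case using diff by (simp add: ev_diff)
qed

text \<open>If \<open>ev u\<close> is divisible by \<open>F\<close>, so are all its coordinates, and
  the normal form of \<open>u\<close> is a sum of tensors with first component zero.\<close>

lemma K0_J: "K0 \<subseteq> J"
proof
  fix u assume u: "u \<in> K0"
  define T where "T = (\<Union>p\<in>Poly_Mapping.keys u. {t. coord t (snd p) \<noteq> 0})"
  have T: "finite T" unfolding T_def using finite_coord by auto
  have "Poly_Mapping.keys u \<subseteq> {(cl a, b) | a b. a \<in> E \<and> {t. coord t b \<noteq> 0} \<subseteq> T}"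
    using u unfolding K0_def MR_simps T_def by (fastforce simp: carrier_A)
  then have nf: "u - (\<Sum>t\<in>T. frag_of (cl (pcoord t (ev u)), t)) \<in> J" "ev u \<in> DK"
    using tensor_normal_form[OF T] by auto
  have "base_lift F dvd ev u" using u by (simp add: K0_def)
  then have "F dvd pcoord t (ev u)" for t by (rule pcoord_dvd)
  then have "cl (pcoord t (ev u)) = cl 0" for t
    using h_eq_iff[of "pcoord t (ev u)" 0] coord_E[OF nf(2)] by simp
  then have "u - (\<Sum>t\<in>T. frag_of (cl 0, t)) \<in> J" using nf(1) by simp
  then have "u - (\<Sum>t\<in>T. frag_of (cl 0, t)) + (\<Sum>t\<in>T. frag_of (cl 0, t)) \<in> J"
    by (rule J_closed(2)) (rule J_sum, rule J_zero_left)
  then show "u \<in> J" by simp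
qed

lemma J_eq: "J = K0"
  using J_K0 K0_J by blast

text \<open>A coset of \<open>J\<close>, described through the value of its elements, so that it is
  indexed by polynomials in \<open>DK\<close>.\<close>

definition tensor_class :: "'k alg_closure poly poly \<Rightarrow> ('a \<times> 'k alg_closure \<Rightarrow>\<^sub>0 int) set" where
  "tensor_class g = {u \<in> carrier MR. base_lift F dvd ev u - g}"

lemma tensor_class_coset:
  assumes u: "u \<in> carrier MR"
  shows "J +>\<^bsub>MR\<^esub> u = tensor_class (ev u)"
proof (intro equalityI subsetI)
  fix w assume "w \<in> J +>\<^bsub>MR\<^esub> u"
  then obtain k where k: "k \<in> K0" "w = k + u"
    unfolding J_eq a_r_coset_def' by (auto simp: monoid_ring_simps)
  then show "w \<in> tensor_class (ev u)"
    using u by (simp add: tensor_class_def K0_def MR_simps keys_closed_add ev_add)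
next
  fix w assume w: "w \<in> tensor_class (ev u)"
  then have "w - u \<in> K0"
    using u by (simp add: tensor_class_def K0_def MR_simps keys_closed_diff ev_diff)
  then show "w \<in> J +>\<^bsub>MR\<^esub> u"
    unfolding J_eq a_r_coset_def' by (auto simp: monoid_ring_simps intro!: bexI[of _ "w - u"])
qed

lemma tensor_class_eqI: "base_lift F dvd g - g' \<Longrightarrow> tensor_class g = tensor_class g'"
proof -
  assume d: "base_lift F dvd g - g'"
  have "base_lift F dvd e - g \<longleftrightarrow> base_lift F dvd e - g'" for e
  proof -
    have "e - g' = (e - g) + (g - g')" by simp
    then show ?thesis using d by (metis dvd_add_left_iff)
  qed
  then show ?thesis by (simp add: tensor_class_def)
qed

lemma ev_surj:
  assumes g: "g \<in> DK"
  shows "\<exists>u\<in>carrier MR. base_lift F dvd ev u - g"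
proof -
  obtain T where T: "finite T" "g = (\<Sum>t\<in>T. base_lift (pcoord t g) * [:[:t:]:])"
    using pcoord_expansion by blast
  have "\<exists>u\<in>carrier MR. base_lift F dvd ev u - (\<Sum>t\<in>T. base_lift (pcoord t g) * [:[:t:]:])"
    using T(1)
  proof (induction T)
    case empty
    show ?case by (intro bexI[of _ 0]) (simp_all add: MR_simps)
  next
    case (insert s T)
    then obtain u where u: "u \<in> carrier MR" "base_lift F dvd ev u - (\<Sum>t\<in>T. base_lift (pcoord t g) * [:[:t:]:])" by blast
    let ?v = "frag_of (cl (pcoord s g), s)"
    have v: "base_lift F dvd ev ?v - base_lift (pcoord s g) * [:[:s:]:]"
      using gen_cl[OF coord_E[OF g]] by simp
    have "ev (?v + u) - (\<Sum>t\<in>insert s T. base_lift (pcoord t g) * [:[:t:]:])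
      = (ev ?v - base_lift (pcoord s g) * [:[:s:]:]) + (ev u - (\<Sum>t\<in>T. base_lift (pcoord t g) * [:[:t:]:]))"
      using insert by (simp add: ev_add algebra_simps)
    then have "base_lift F dvd ev (?v + u) - (\<Sum>t\<in>insert s T. base_lift (pcoord t g) * [:[:t:]:])"
      using dvd_add[OF v u(2)] by (simp only:)
    moreover have "?v + u \<in> carrier MR"
      using u coord_E[OF g] unfolding MR_simps by (intro keys_closed_add) (auto simp: carrier_A)
    ultimately show ?case by blast
  qed
  then show ?thesis using T(2) by simp
qed

text \<open>\<open>ev\<close> is multiplicative modulo \<open>F\<close>, reaches every class of
  \<open>DK\<close> and has kernel \<open>J\<close>, so it identifies the tensor product with
  DK/(F).\<close>

theorem presented_base_change:
  "presented_ring (geometric_base_change A smap) DK {g. base_lift F dvd g} tensor_class"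
proof -
  let ?B = "geometric_base_change A smap"
  have B: "?B = MR Quot J" by (simp add: geometric_base_change_def tensor_product_def)
  interpret J: ideal J MR by (rule J_ideal)
  have rep_class: "\<exists>u\<in>carrier MR. tensor_class g = J +>\<^bsub>MR\<^esub> u \<and> base_lift F dvd ev u - g" if g: "g \<in> DK" for g
    using ev_surj[OF g] tensor_class_coset tensor_class_eqI by metis
  have carrier: "carrier ?B = tensor_class ` DK"
  proof (intro equalityI subsetI)
    fix U assume "U \<in> carrier ?B"
    then obtain u where "u \<in> carrier MR" "U = J +>\<^bsub>MR\<^esub> u"
      unfolding B FactRing_simps by auto
    then show "U \<in> tensor_class ` DK" using tensor_class_coset ev_DK by (auto simp: MR_simps)
  next
    fix U assume "U \<in> tensor_class ` DK"
    then obtain u where "u \<in> carrier MR" "U = J +>\<^bsub>MR\<^esub> u" using rep_class by blast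
    then show "U \<in> carrier ?B" unfolding B FactRing_simps by auto
  qed
  have mult: "tensor_class g \<otimes>\<^bsub>?B\<^esub> tensor_class g' = tensor_class (g * g')" if g: "g \<in> DK" "g' \<in> DK" for g g'
  proof -
    obtain u where u: "u \<in> carrier MR" "tensor_class g = J +>\<^bsub>MR\<^esub> u" "base_lift F dvd ev u - g"
      using rep_class[OF g(1)] by blast
    obtain v where v: "v \<in> carrier MR" "tensor_class g' = J +>\<^bsub>MR\<^esub> v" "base_lift F dvd ev v - g'"
      using rep_class[OF g(2)] by blast
    have "tensor_class g \<otimes>\<^bsub>?B\<^esub> tensor_class g' = J +>\<^bsub>MR\<^esub> (u \<otimes>\<^bsub>MR\<^esub> v)"
      unfolding B u(2) v(2) FactRing_def using J.rcoset_mult_add[OF u(1) v(1)] by simp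
    also have "\<dots> = tensor_class (ev (frag_mult M u v))"
      using tensor_class_coset[OF MR.m_closed[OF u(1) v(1)]] by (simp add: monoid_ring_simps(2))
    also have "\<dots> = tensor_class (g * g')"
    proof (rule tensor_class_eqI)
      have "ev (frag_mult M u v) - g * g' = (ev (frag_mult M u v) - ev u * ev v)
          + ((ev u - g) * ev v + g * (ev v - g'))" by (simp add: algebra_simps)
      also have "base_lift F dvd \<dots>"
        using ev_mult[of u v] u v by (intro dvd_add[OF _ dvd_add[OF dvd_mult2 dvd_mult]]) (auto simp: MR_simps)
      finally show "base_lift F dvd ev (frag_mult M u v) - g * g'" .
    qed
    finally show ?thesis .
  qed
  have add: "tensor_class g \<oplus>\<^bsub>?B\<^esub> tensor_class g' = tensor_class (g + g')" if g: "g \<in> DK" "g' \<in> DK" for g g'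
  proof -
    obtain u where u: "u \<in> carrier MR" "tensor_class g = J +>\<^bsub>MR\<^esub> u" "base_lift F dvd ev u - g"
      using rep_class[OF g(1)] by blast
    obtain v where v: "v \<in> carrier MR" "tensor_class g' = J +>\<^bsub>MR\<^esub> v" "base_lift F dvd ev v - g'"
      using rep_class[OF g(2)] by blast
    have "tensor_class g \<oplus>\<^bsub>?B\<^esub> tensor_class g' = J +>\<^bsub>MR\<^esub> (u \<oplus>\<^bsub>MR\<^esub> v)"
      unfolding B u(2) v(2) FactRing_def using J.a_rcos_sum[OF u(1) v(1)] by simp
    also have "\<dots> = tensor_class (ev (u + v))"
      using tensor_class_coset[OF MR.a_closed[OF u(1) v(1)]] by (simp add: monoid_ring_simps)
    also have "\<dots> = tensor_class (g + g')"
    proof (rule tensor_class_eqI)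
      have "ev (u + v) - (g + g') = (ev u - g) + (ev v - g')" by (simp add: ev_add algebra_simps)
      then show "base_lift F dvd ev (u + v) - (g + g')" using dvd_add[OF u(3) v(3)] by (simp only:)
    qed
    finally show ?thesis .
  qed
  have one: "\<one>\<^bsub>?B\<^esub> = tensor_class 1"
  proof -
    have "\<one>\<^bsub>?B\<^esub> = tensor_class (ev (frag_of \<one>\<^bsub>M\<^esub>))"
      unfolding B FactRing_def using tensor_class_coset[OF MR.one_closed] by (simp add: monoid_ring_simps)
    also have "\<dots> = tensor_class 1"
      using gen_cl[OF D_one, of 1] by (intro tensor_class_eqI) (simp add: carrier_A h_one base_lift.hom_one flip: one_pCons)
    finally show ?thesis .
  qed
  have zero: "\<zero>\<^bsub>?B\<^esub> = tensor_class 0"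
    unfolding B FactRing_def J_eq by (simp add: tensor_class_def K0_def)
  have eq: "tensor_class g = tensor_class g' \<longleftrightarrow> g - g' \<in> {g. base_lift F dvd g}" if g: "g \<in> DK" "g' \<in> DK" for g g'
  proof
    assume e: "tensor_class g = tensor_class g'"
    obtain u where "u \<in> carrier MR" "base_lift F dvd ev u - g" using ev_surj[OF g(1)] by blast
    moreover from this have "base_lift F dvd ev u - g'" using e by (auto simp: tensor_class_def)
    ultimately have "base_lift F dvd (ev u - g') - (ev u - g)" by (simp only: dvd_diff)
    then show "g - g' \<in> {g. base_lift F dvd g}" by simp
  qed (use tensor_class_eqI in blast)
  show ?thesis
    by (intro presented_ring.intro subring_DK presented_ring_axioms.intro carrier mult add one zero eq)
qed

end

subsection \<open>The coordinate rings\<close>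

definition residue :: "'a::comm_ring_1 \<Rightarrow> 'a \<Rightarrow> 'a set" where
  "residue F g = {g'. F dvd g' - g}"

lemma residue_eq_iff: "residue F a = residue F b \<longleftrightarrow> F dvd a - b"
proof
  assume "residue F a = residue F b"
  moreover have "a \<in> residue F a" by (simp add: residue_def)
  ultimately show "F dvd a - b" by (simp add: residue_def)
next
  assume d: "F dvd a - b"
  have "F dvd e - a \<longleftrightarrow> F dvd e - b" for e
  proof -
    have "e - b = (e - a) + (a - b)" by simp
    then show ?thesis using d by (metis dvd_add_left_iff)
  qed
  then show "residue F a = residue F b" by (simp add: residue_def)
qed

lemma residue_coset: "{g. F dvd g} +>\<^bsub>ring_of_type_algebra\<^esub> g = residue F g"
proof (intro equalityI subsetI)
  fix g' assume "g' \<in> residue F g"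
  then show "g' \<in> {g. F dvd g} +>\<^bsub>ring_of_type_algebra\<^esub> g"
    unfolding a_r_coset_def' residue_def by (intro UN_I[of "g' - g"]) simp_all
qed (auto simp: a_r_coset_def' residue_def)

text \<open>The carrier is overwritten because \<open>Y0_ring\<close> keeps the coset operations of
  the full quotient and only shrinks the carrier.\<close>

lemma presented_quotient:
  fixes F :: "'a::comm_ring_1"
  assumes "subring_ideal E {g. F dvd g}"
  shows "presented_ring ((ring_of_type_algebra Quot {g. F dvd g})\<lparr>carrier := residue F ` E\<rparr>)
    E {g. F dvd g} (residue F)"
proof -
  have I: "PIdl\<^bsub>ring_of_type_algebra\<^esub> F = {g. F dvd g}"
    by (auto simp: cgenideal_def dvd_def mult.commute)
  interpret R: cring "ring_of_type_algebra :: 'a ring" by (rule cring_from_type_algebra)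
  interpret ideal "{g. F dvd g}" "ring_of_type_algebra :: 'a ring"
    unfolding I[symmetric] by (rule R.cgenideal_ideal) simp
  have mult: "residue F a \<otimes>\<^bsub>ring_of_type_algebra Quot {g. F dvd g}\<^esub> residue F b = residue F (a * b)" for a b
    using rcoset_mult_add[of a b] by (simp add: FactRing_def residue_coset)
  have add: "residue F a \<oplus>\<^bsub>ring_of_type_algebra Quot {g. F dvd g}\<^esub> residue F b = residue F (a + b)" for a b
    using a_rcos_sum[of a b] by (simp add: FactRing_def residue_coset)
  have "\<one>\<^bsub>ring_of_type_algebra Quot {g. F dvd g}\<^esub> = residue F 1"
    "\<zero>\<^bsub>ring_of_type_algebra Quot {g. F dvd g}\<^esub> = residue F 0"
    by (simp_all add: FactRing_def residue_coset) (simp add: residue_def)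
  with mult add show ?thesis
    by (intro presented_ring.intro assms presented_ring_axioms.intro) (simp_all add: residue_eq_iff)
qed

context
  fixes m n :: nat
  assumes m: "m \<ge> 2" and n: "n \<ge> 1"
begin

lemma dynatomic_ideal_eq: "dynatomic_ideal m n = {g :: 'r::comm_ring_1 poly poly. red (dyn m n) dvd g}"
  using dynatomic_eq_dyn[OF m, of n] n
  by (auto simp: dynatomic_ideal_def red_def cgenideal_def dvd_def mult.commute)

lemma Y_structure_map_eq: "Y_structure_map m n = (\<lambda>r. residue (red (dyn m n)) [:[:r:]:])"
  by (rule ext) (simp add: Y_structure_map_def dynatomic_ideal_eq residue_coset)

lemma presented_Y1:
  "presented_ring (Y1_ring m n) UNIV {g. red (dyn m n) dvd g} (residue (red (dyn m n)))"
proof -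
  let ?F = "red (dyn m n) :: 'a poly poly"
  have "Y1_ring m n = (ring_of_type_algebra Quot {g. ?F dvd g})\<lparr>carrier := residue ?F ` UNIV\<rparr>"
    unfolding Y1_ring_def dynatomic_ideal_eq
    by (auto simp: FactRing_def A_RCOSETS_def' residue_coset)
  moreover have "subring_ideal UNIV {g. ?F dvd g}"
    by unfold_locales (auto simp: ideal_in_def)
  ultimately show ?thesis by (simp only: presented_quotient)
qed

lemma presented_Y0:
  assumes "of_nat n \<noteq> (0 :: 'k::field)"
  shows "presented_ring (Y0_ring m n :: 'k poly poly set ring) (poly_action.D (red (dyn m n)) (unicritical m))
    {g. red (dyn m n) dvd g} (residue (red (dyn m n)))"
proof -
  let ?F = "red (dyn m n) :: 'k poly poly"
  interpret poly_action ?F "unicritical m" n by (rule poly_action_dyn[OF m n assms])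
  \<comment> \<open>The comorphism is a union over all representatives; these are congruent modulo
    \<open>F\<close> and stay so under \<open>\<sigma>\<close>, so the union is a single
    coset.\<close>
  have sig: "sigma_comorphism m n (residue ?F g) = residue ?F (\<sigma> g)" for g
  proof -
    have "residue ?F (\<sigma> g') = residue ?F (\<sigma> g)" if "g' \<in> residue ?F g" for g'
      using that \<sigma>_dvd[of "g' - g"] by (simp add: residue_eq_iff) (simp add: residue_def)
    moreover have "g \<in> residue ?F g" by (simp add: residue_def)
    ultimately show ?thesis
      unfolding sigma_comorphism_def dynatomic_ideal_eq residue_coset \<sigma>_def[symmetric] by blast
  qed
  have c: "carrier (Y1_ring m n) = range (residue ?F)"
    using presented_ring.carrier_A[OF presented_Y1] .
  have "{U \<in> carrier (Y1_ring m n). sigma_comorphism m n U = U} = residue ?F ` D"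
  proof -
    have "residue ?F (\<sigma> g) = residue ?F g \<longleftrightarrow> g \<in> D" for g by (simp add: residue_eq_iff D_iff)
    then show ?thesis unfolding c using sig by fastforce
  qed
  then have "Y0_ring m n = (ring_of_type_algebra Quot {g. ?F dvd g})\<lparr>carrier := residue ?F ` D\<rparr>"
    unfolding Y0_ring_def by (simp add: Y1_ring_def dynatomic_ideal_eq)
  then show ?thesis using presented_quotient[OF subring_D] by (simp only:)
qed

end

subsection \<open>Finite generation of the invariants\<close>

context poly_action
begin

lemma \<sigma>_hom: "comm_ring_hom \<sigma>"
  by unfold_locales simp_all

interpretation \<sigma>: map_poly_comm_ring_hom \<sigma>
  using \<sigma>_hom by (simp add: map_poly_comm_ring_hom_def)

text \<open>The variable \<open>x\<close> is a root of the monic polynomial \<open>\<Prod>i<n. t - \<sigma>\<^sup>i x\<close>, whose coefficients are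
  invariant.\<close>

definition orbit_poly :: "'k poly poly poly" where "orbit_poly = (\<Prod>i<n. [:- iterate i, 1:])"

text \<open>\<open>\<sigma>\<close> shifts the indices of the factors by one. Only the factors with
  index 0 and \<open>n\<close> differ, and these agree modulo \<open>F\<close>.\<close>

lemma orbit_poly_coeff_D: "coeff orbit_poly j \<in> D"
proof -
  obtain l where l: "n = Suc l" using n_pos by (cases n) auto
  define R where "R = (\<Prod>i<l. [:- iterate (Suc i), 1:])"
  have "map_poly \<sigma> orbit_poly = (\<Prod>i<n. [:- iterate (Suc i), 1:])"
    by (simp add: orbit_poly_def \<sigma>.hom_prod map_poly_pCons_zero iterate_def)
  then have "map_poly \<sigma> orbit_poly = R * [:- iterate n, 1:]" by (simp add: l R_def)
  moreover have "orbit_poly = (\<Prod>i<Suc l. [:- iterate i, 1:])" by (simp only: orbit_poly_def flip: l)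
  then have "orbit_poly = R * [:- iterate 0, 1:]"
    unfolding R_def by (simp add: prod.lessThan_Suc_shift mult.commute del: prod.lessThan_Suc)
  ultimately have "map_poly \<sigma> orbit_poly - orbit_poly = R * ([:- iterate n, 1:] - [:- iterate 0, 1:])"
    by (simp only: right_diff_distrib)
  also have "\<dots> = smult (iterate 0 - iterate n) R" by simp
  finally have "coeff (map_poly \<sigma> orbit_poly - orbit_poly) j = (iterate 0 - iterate n) * coeff R j" by simp
  then have "\<sigma> (coeff orbit_poly j) - coeff orbit_poly j = - (iterate n - [:0, 1:]) * coeff R j"
    by (simp add: coeff_map_poly iterate_def)
  moreover have "F dvd iterate n - [:0, 1:]" using \<sigma>_order[of "[:0, 1:]"] by (simp add: iterate_def)
  ultimately show ?thesis unfolding D_iff by (metis dvd_minus_iff dvd_mult2)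
qed

lemma orbit_poly_root: "[:0, 1:] ^ n = - (\<Sum>j<n. coeff orbit_poly j * [:0, 1:] ^ j)"
proof -
  have deg: "degree orbit_poly = n"
    unfolding orbit_poly_def by (subst degree_prod_eq_sum_degree) auto
  have "lead_coeff orbit_poly = 1"
    unfolding orbit_poly_def by (simp add: lead_coeff_prod)
  then have lead: "coeff orbit_poly n = 1" by (simp add: deg)
  have "[:- iterate 0, 1:] dvd orbit_poly"
    unfolding orbit_poly_def using n_pos by (intro dvd_prodI) auto
  then have "poly orbit_poly (iterate 0) = 0" by (simp add: poly_eq_0_iff_dvd)
  then have "(\<Sum>j\<le>n. coeff orbit_poly j * [:0, 1:] ^ j) = 0"
    by (simp add: poly_altdef deg iterate_def)
  moreover have "{..n} = insert n {..<n}" by auto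
  ultimately have "[:0, 1:] ^ n + (\<Sum>j<n. coeff orbit_poly j * [:0, 1:] ^ j) = 0" by (simp add: lead)
  then show ?thesis by (rule eq_neg_iff_add_eq_0[THEN iffD2])
qed

text \<open>The generators are c, the coefficients of the orbit polynomial and the averages of the
  powers of x below \<open>n\<close>. \<open>G\<close> is the part of \<open>D\<close> they reach,
  and \<open>W\<close> is the set of polynomials with average in \<open>G\<close>. \<open>W\<close>
  is stable under sums and multiplication by \<open>G\<close>, and contains all powers of x: the
  high ones reduce through the orbit polynomial. So \<open>W\<close> is everything, and an invariant
  is congruent to its average.\<close>

lemma finite_type_D:
  assumes pres: "presented_ring A D {g. F dvd g} cl"
  shows "finite_type A (\<lambda>r. cl [:[:r:]:])"
proof -
  interpret presented_ring A D "{g. F dvd g}" cl by (rule pres)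
  interpret A: cring A by (rule cring_A)
  let ?x = "[:0, 1:] :: 'k poly poly" and ?c = "[:[:0, 1:]:] :: 'k poly poly"
  define S where "S = insert ?c (coeff orbit_poly ` {..<n} \<union> (\<lambda>j. rey (?x ^ j)) ` {..<n})"
  define B where "B = generate_ring A (range (\<lambda>r. cl [:[:r:]:]) \<union> cl ` S)"
  have S: "finite S" "S \<subseteq> D" by (auto simp: S_def const_D orbit_poly_coeff_D rey_D)
  have B_carrier: "B \<subseteq> carrier A"
    unfolding B_def using S const_D by (intro A.generate_ring_incl) (auto simp: carrier_A)
  define G where "G = {g \<in> D. cl g \<in> B}"
  have G_add: "a + b \<in> G" if "a \<in> G" "b \<in> G" for a b
    using that generate_ring.eng_add[of "cl a" A _ "cl b"] by (auto simp: G_def B_def h_add D.D_add)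
  have G_mult: "a * b \<in> G" if "a \<in> G" "b \<in> G" for a b
    using that generate_ring.eng_mult[of "cl a" A _ "cl b"] by (auto simp: G_def B_def h_mult D.D_mult)
  have G_cong: "b \<in> G" if "a \<in> G" "b \<in> D" "F dvd a - b" for a b
    using that h_eq_iff[of a b] by (auto simp: G_def)
  have G_S: "a \<in> G" if "a \<in> S" for a
    using that S by (auto simp: G_def B_def intro: generate_ring.incl)
  have G_base: "[:[:r:]:] \<in> G" for r
    using const_D by (auto simp: G_def B_def intro: generate_ring.incl)
  have G_const: "[:r:] \<in> G" for r
  proof (induction r)
    case 0
    show ?case using G_base[of 0] by simp
  next
    case (pCons a r)
    have "[:pCons a r:] = [:[:a:]:] + ?c * [:r:]" by simp
    moreover have "?c \<in> G" using G_S by (simp add: S_def)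
    ultimately show ?case using G_add[OF G_base[of a] G_mult[OF _ pCons.IH]] by (simp only:)
  qed
  define W where "W = {g. rey g \<in> G}"
  have W_mult: "d * g \<in> W" if "d \<in> G" "g \<in> W" for d g
  proof -
    have d: "d \<in> D" "d * rey g \<in> G" using that G_mult by (auto simp: G_def W_def)
    have "F dvd d * rey g - rey (d * g)" using rey_mult[OF d(1), of g] by (metis dvd_minus_iff minus_diff_eq)
    then show ?thesis using G_cong[OF d(2) rey_D] by (simp add: W_def)
  qed
  have W_sum: "sum f K \<in> W" if "\<And>i. i \<in> K \<Longrightarrow> f i \<in> W" for f :: "nat \<Rightarrow> 'k poly poly" and K
    using that G_const[of 0]
    by (induction K rule: infinite_finite_induct) (auto simp: W_def rey_zero rey_add G_add)
  have neg: "[:[:- 1:]:] * g = - g" for g :: "'k poly poly" by (simp add: poly_eq_iff)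
  have pow: "?x ^ j \<in> W" for j
  proof (induction j rule: less_induct)
    case (less j)
    show ?case
    proof (cases "j < n")
      case True
      then show ?thesis using G_S by (auto simp: W_def S_def)
    next
      case False
      then have "?x ^ j = ?x ^ (j - n) * ?x ^ n" by (simp flip: power_add)
      also have "\<dots> = [:[:- 1:]:] * (\<Sum>i<n. coeff orbit_poly i * ?x ^ (j - n + i))"
        unfolding orbit_poly_root neg by (simp add: sum_distrib_left power_add mult.left_commute)
      also have "\<dots> \<in> W"
      proof (rule W_mult[OF G_base W_sum])
        fix i assume "i \<in> {..<n}"
        then have "coeff orbit_poly i \<in> G" "j - n + i < j" using G_S False by (auto simp: S_def)
        then show "coeff orbit_poly i * ?x ^ (j - n + i) \<in> W" using W_mult less by blast
      qed
      finally show ?thesis .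
    qed
  qed
  have W_UNIV: "g \<in> W" for g
  proof -
    have "g = (\<Sum>j\<le>degree g. [:coeff g j:] * ?x ^ j)"
      using poly_as_sum_of_monoms[of g] by (simp add: monom_altdef)
    also have "\<dots> \<in> W" by (intro W_sum W_mult G_const pow)
    finally show ?thesis .
  qed
  have "D \<subseteq> G"
  proof
    fix d assume d: "d \<in> D"
    have "rey d \<in> G" using W_UNIV[of d] by (simp add: W_def)
    then show "d \<in> G" by (rule G_cong[OF _ d rey_fix[OF d]])
  qed
  then have "carrier A \<subseteq> B" by (auto simp: G_def carrier_A)
  then show ?thesis
    unfolding finite_type_def using S B_carrier
    by (intro exI[of _ "cl ` S"]) (auto simp: B_def carrier_A)
qed

text \<open>The action is defined over the base field, so lifts and coordinates of invariants are
  invariant: forming invariants commutes with the field extension.\<close>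

lemma tensor_presented_D:
  assumes pres: "presented_ring A D {g. F dvd g} cl"
    and lift: "poly_action (base_lift F) (base_lift \<phi>) n"
  shows "tensor_presented A F D cl (poly_action.D (base_lift F) (base_lift \<phi>))"
proof -
  interpret K: poly_action "base_lift F" "base_lift \<phi>" n by (rule lift)
  show ?thesis
  proof (intro tensor_presented.intro pres tensor_presented_axioms.intro K.subring_D const_D K.const_D)
    fix a assume "a \<in> D"
    then have "base_lift F dvd base_lift (\<sigma> a - a)" by (auto simp: D_iff base_lift.hom_mult elim!: dvdE)
    then show "base_lift a \<in> K.D"
      by (simp add: K.D_iff \<sigma>_def K.\<sigma>_def base_lift.hom_minus base_lift_pcompose)
  next
    fix g t assume "g \<in> K.D"
    then have "F dvd pcoord t (K.\<sigma> g - g)" unfolding K.D_iff by (rule pcoord_dvd)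
    then show "pcoord t g \<in> D"
      by (simp add: D_iff \<sigma>_def K.\<sigma>_def pcoord_diff pcoord_pcompose)
  qed
qed

end

lemma D_trivial: "poly_action.D F [:0, 1:] = UNIV"
  using poly_action.D_def[OF poly_action_trivial, of F]
  by (simp add: poly_action.\<sigma>_def[OF poly_action_trivial] pcompose_idR)

subsection \<open>Smoothness and irreducibility of the two curves\<close>

lemma funpow_period_dvd:
  fixes f :: "'a \<Rightarrow> 'a"
  assumes "(f ^^ a) x = x" "(f ^^ b) x = x"
  shows "(f ^^ gcd a b) x = x"
  using assms
proof (induction a b rule: gcd_nat_induct)
  case (step a b)
  have "(f ^^ (k * b)) x = x" for k
    using step.prems(2) by (induction k) (simp_all add: funpow_add)
  moreover have "(f ^^ a) x = (f ^^ (a mod b)) ((f ^^ (a div b * b)) x)"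
    by (metis comp_apply funpow_add mod_div_mult_eq)
  ultimately have "(f ^^ (a mod b)) x = x" using step.prems(1) by simp
  then show ?case using step.IH[OF step.prems(2)] step.hyps by (metis gcd_red_nat)
qed simp

text \<open>A return time between 0 and \<open>n\<close> is prime to \<open>n\<close>, and then
  Euclid's algorithm makes 1 a return time.\<close>

lemma prime_period_separated:
  fixes f :: "'a \<Rightarrow> 'a"
  assumes "prime n" "(f ^^ n) x = x"
  shows "(\<forall>i. (f ^^ i) x = x) \<or> (\<forall>i. 0 < i \<and> i < n \<longrightarrow> (f ^^ i) x \<noteq> x)"
proof (rule disjCI)
  assume "\<not> (\<forall>i. 0 < i \<and> i < n \<longrightarrow> (f ^^ i) x \<noteq> x)"
  then obtain i where i: "0 < i" "i < n" "(f ^^ i) x = x" by blast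
  have "\<not> n dvd i" using i by (auto dest: dvd_imp_le)
  then have "gcd i n = 1" using assms(1) by (metis coprime_iff_gcd_eq_1 coprime_commute prime_imp_coprime)
  then have "f x = x" using funpow_period_dvd[OF i(3) assms(2)] by simp
  then have "(f ^^ j) x = x" for j by (induction j) simp_all
  then show "\<forall>i. (f ^^ i) x = x" by blast
qed

context
  fixes m n :: nat and Tk :: "'k::field itself"
  assumes m: "m \<ge> 2" and n: "n \<ge> 1" and nk: "of_nat n \<noteq> (0 :: 'k)"
    and mk: "of_nat m \<noteq> (0 :: 'k)" and m1k: "of_nat (m - 1) \<noteq> (0 :: 'k)"
begin

abbreviation "Fk \<equiv> red (dyn m n) :: 'k poly poly"
abbreviation "FK \<equiv> red (dyn m n) :: 'k alg_closure poly poly"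
abbreviation "Y1k \<equiv> Y1_ring m n :: 'k poly poly set ring"
abbreviation "Y0k \<equiv> Y0_ring m n :: 'k poly poly set ring"
abbreviation "structure_map \<equiv> Y_structure_map m n :: 'k \<Rightarrow> 'k poly poly set"

lemma of_nat_alg_closure: "of_nat j \<noteq> (0 :: 'k) \<Longrightarrow> of_nat j \<noteq> (0 :: 'k alg_closure)"
  by (metis to_ac_of_nat to_ac_eq_0_iff)

lemmas unitK = of_nat_alg_closure[OF nk] of_nat_alg_closure[OF mk] of_nat_alg_closure[OF m1k]

text \<open>Four actions: the digit 0 marks the dynamical action, which gives Y_0, and 1 the trivial
  one, which gives Y_1; lower case is over the base field, upper case over its closure.\<close>

interpretation k0: poly_action Fk "unicritical m" n
  by (rule poly_action_dyn[OF m n nk])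

interpretation k1: poly_action Fk "[:0, 1:]" "Suc 0"
  by (rule poly_action_trivial)

interpretation K0: curve_action FK "unicritical m" n
  by (rule curve_action_dynK[OF m unitK(2,3) n unitK(1)])

interpretation K1: curve_action FK "[:0, 1:]" "Suc 0"
  by (rule curve_action_trivial[OF m unitK(2,3) n])

lemma base_lift_unicritical: "base_lift (unicritical m :: 'k poly poly) = unicritical m"
  by (metis base_lift_red red_unicritical)

lemma base_change_Y1: "\<exists>h. presented_ring (geometric_base_change Y1k structure_map) K1.D {g. FK dvd g} h"
proof -
  have lift: "poly_action (base_lift Fk) (base_lift [:0, 1:]) (Suc 0)"
    by (simp add: base_lift_pCons base_lift.hom_one base_lift.hom_zero poly_action_trivial)
  interpret tensor_presented Y1k Fk k1.D "residue Fk" "poly_action.D (base_lift Fk) (base_lift [:0, 1:])"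
    by (rule k1.tensor_presented_D[OF _ lift]) (use presented_Y1[OF m n] in \<open>simp add: D_trivial\<close>)
  have "structure_map = smap" by (rule ext) (simp add: Y_structure_map_eq[OF m n] smap_def)
  then show ?thesis
    using presented_base_change by (auto simp: base_lift_red base_lift_pCons)
qed

lemma base_change_Y0: "\<exists>h. presented_ring (geometric_base_change Y0k structure_map) K0.D {g. FK dvd g} h"
proof -
  have lift: "poly_action (base_lift Fk) (base_lift (unicritical m)) n"
    unfolding base_lift_red base_lift_unicritical by (rule K0.poly_action_axioms)
  interpret tensor_presented Y0k Fk k0.D "residue Fk" "poly_action.D (base_lift Fk) (base_lift (unicritical m))"
    by (rule k0.tensor_presented_D[OF presented_Y0[OF m n nk] lift])
  have "structure_map = smap" by (rule ext) (simp add: Y_structure_map_eq[OF m n] smap_def)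
  then show ?thesis
    using presented_base_change unfolding base_lift_red base_lift_unicritical by auto
qed

lemma finite_type_Y: "finite_type Y1k structure_map" "finite_type Y0k structure_map"
proof -
  have "presented_ring Y1k k1.D {g. Fk dvd g} (residue Fk)"
    using presented_Y1[OF m n] by (simp add: D_trivial)
  from k1.finite_type_D[OF this] k0.finite_type_D[OF presented_Y0[OF m n nk]]
  show "finite_type Y1k structure_map" "finite_type Y0k structure_map"
    unfolding Y_structure_map_eq[OF m n] by blast+
qed

lemma eval2_unicritical: "eval2 x c (unicritical m) = x ^ m + c"
  by (simp add: unicritical_def var_x_def var_c_def)

lemma K0_orb_fixed: "x ^ m + c = x \<Longrightarrow> K0.orb x c i = x"
  by (induction i) (simp_all add: K0.orb_eq eval2_unicritical)

lemma smooth_iff: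
  assumes "prime n"
  shows "smooth_over_field Y1k structure_map \<longleftrightarrow> smooth_over_field Y0k structure_map"
proof -
  obtain h1 h0 where h1: "presented_ring (geometric_base_change Y1k structure_map) K1.D {g. FK dvd g} h1"
    and h0: "presented_ring (geometric_base_change Y0k structure_map) K0.D {g. FK dvd g} h0"
    using base_change_Y1 base_change_Y0 by blast
  have n1: "n > 1" using assms by (rule prime_gt_1_nat)
  have orbits: "(\<forall>i. K0.orb x c i = x) \<or> (\<forall>i. 0 < i \<and> i < n \<longrightarrow> K0.orb x c i \<noteq> x)"
    if "eval2 x c FK = 0" for x c
    using prime_period_separated[OF assms K0.orb_n[OF that, unfolded K0.orb_eq]] unfolding K0.orb_eq .
  show ?thesis
    unfolding smooth_over_field_def
  proof (intro conj_cong iffI)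
    assume reg: "\<forall>P\<in>spec (geometric_base_change Y1k structure_map).
      regular_local_ring (localization (geometric_base_change Y1k structure_map) P)"
    \<comment> \<open>\<open>regular_at\<close> depends only on the equation and the subring. The
      trivial action has all polynomials as \<open>D\<close>, so its criterion is the one that the
      dynamical action can descend.\<close>
    have "K0.regular_at UNIV x c" if "eval2 x c FK = 0" for x c
      using K1.regular_spec_imp[OF h1 reg that] by (simp add: D_trivial)
    then show "\<forall>P\<in>spec (geometric_base_change Y0k structure_map).
      regular_local_ring (localization (geometric_base_change Y0k structure_map) P)"
      using K0.regular_spec[OF h0] orbits unfolding K0.separated_def by blast
  next
    assume reg: "\<forall>P\<in>spec (geometric_base_change Y0k structure_map).
      regular_local_ring (localization (geometric_base_change Y0k structure_map) P)"
    have "K0.regular_at UNIV x c" if V: "eval2 x c FK = 0" for x c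
      using orbits[OF V]
    proof
      assume "\<forall>i. K0.orb x c i = x"
      then have "K0.orb x c 1 = x" by blast
      then have "x ^ m + c = x" by (simp add: K0.orb_eq eval2_unicritical)
      then show ?thesis using fixed_point_regular[OF m unitK(2,3) n1 unitK(1) V] by simp
    next
      assume "\<forall>i. 0 < i \<and> i < n \<longrightarrow> K0.orb x c i \<noteq> x"
      then show ?thesis using K0.regular_ascends[OF V] K0.regular_spec_imp[OF h0 reg V] by blast
    qed
    \<comment> \<open>For the group of order one the only index below \<open>n\<close> is 0, so each
      point counts as fixed.\<close>
    moreover have "K1.separated x c" for x c by (auto simp: K1.separated_def)
    ultimately show "\<forall>P\<in>spec (geometric_base_change Y1k structure_map).
      regular_local_ring (localization (geometric_base_change Y1k structure_map) P)"
      using K1.regular_spec[OF h1] by blast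
  qed (simp_all add: finite_type_Y)
qed

lemma geometrically_irreducible_iff:
  "geometrically_irreducible Y1k structure_map \<longleftrightarrow> geometrically_irreducible Y0k structure_map"
proof -
  obtain h1 h0 where h1: "presented_ring (geometric_base_change Y1k structure_map) K1.D {g. FK dvd g} h1"
    and h0: "presented_ring (geometric_base_change Y0k structure_map) K0.D {g. FK dvd g} h0"
    using base_change_Y1 base_change_Y0 by blast
  have 1: "geometrically_irreducible Y1k structure_map \<longleftrightarrow> K0.irreducible_primes UNIV"
    unfolding geometrically_irreducible_def presented_ring.irreducible_spec_iff[OF h1] K0.irreducible_primes_def
    by (simp only: D_trivial)
  have 0: "geometrically_irreducible Y0k structure_map \<longleftrightarrow> K0.irreducible_primes K0.D"
    unfolding geometrically_irreducible_def presented_ring.irreducible_spec_iff[OF h0] K0.irreducible_primes_def ..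
  have "K0.irreducible_primes UNIV" if D: "K0.irreducible_primes K0.D"
  proof (cases "n = 1")
    \<comment> \<open>For n = 1 the equation is f_c(x) = x itself, so the action is trivial modulo
      \<open>FK\<close> and every polynomial is invariant.\<close>
    case True
    have "FK = period m 1"
      using arg_cong[OF period_prod[OF m, of 1], of "red :: _ \<Rightarrow> 'k alg_closure poly poly"] True
      by (simp add: red_period)
    then have "FK = unicritical m - [:0, 1:]" by (simp add: period_def iter_1 var_x_def)
    then have "FK dvd K0.\<sigma> g - g" for g
      using pcompose_diff_dvd[of "unicritical m" "[:0, 1:]" g] by (simp add: K0.\<sigma>_def pcompose_idR)
    then have "K0.D = UNIV" by (simp add: K0.D_def)
    then show ?thesis using D by simp
  next
    case False
    then have n1: "n > 1" using n by simp
    obtain x c where V: "eval2 x c FK = 0" and fixed: "x ^ m + c = x"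
      using fixed_point_exists[OF m unitK(2,3) n1] by blast
    obtain \<pi> where "eval2 x c \<pi> = 0"
      "\<And>a. eval2 x c a = 0 \<Longrightarrow> \<exists>u r. eval2 x c u \<noteq> 0 \<and> FK dvd u * a - r * \<pi>"
      using fixed_point_regular[OF m unitK(2,3) n1 unitK(1) V fixed] unfolding K0.regular_at_def by blast
    then obtain q F' where "prime_elem q" "FK = q * F'" "eval2 x c q = 0" "eval2 x c F' \<noteq> 0"
      using K0.regular_at_factor[OF V] by blast
    then show ?thesis using K0.irreducible_ascends[OF D V K0_orb_fixed[OF fixed]] by blast
  qed
  then show ?thesis unfolding 0 1 using K0.irreducible_descends by blast
qed

end

theorem theorem4:
  fixes m n p :: nat
  assumes "m \<ge> 2" and "n \<ge> 1"
    and "prime p" and "CARD('p::prime_card) = p"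
    and "\<not> p dvd n * m * (m - 1)"
  shows "(prime n \<longrightarrow>
            (Y1_good_reduction TYPE('p) m n \<longleftrightarrow> Y0_good_reduction TYPE('p) m n)) \<and>
         (Y1_geom_irreducible_mod TYPE('p) m n \<longleftrightarrow> Y0_geom_irreducible_mod TYPE('p) m n)"
proof -
  have nz: "of_nat j \<noteq> (0 :: 'p mod_ring)" if "j dvd n * m * (m - 1)" for j
    using of_nat_0_mod_ring_dvd[of j, where 'a = 'p] assms(4,5) that by (metis dvd_trans)
  have "of_nat n \<noteq> (0 :: 'p mod_ring)" "of_nat m \<noteq> (0 :: 'p mod_ring)" "of_nat (m - 1) \<noteq> (0 :: 'p mod_ring)"
    by (rule nz, simp add: mult.assoc)+
  then show ?thesis
    using smooth_iff[OF assms(1,2), where 'k = "'p mod_ring"]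
      geometrically_irreducible_iff[OF assms(1,2), where 'k = "'p mod_ring"]
    by (simp add: Y1_good_reduction_def Y0_good_reduction_def Y1_geom_irreducible_mod_def
        Y0_geom_irreducible_mod_def)
qed

end
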